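(* For $n\geqslant3$, the semigroup $\mathcal{OR}_n$ has exactly $$3n + \sum_{k=2}^{n}\sum_{i=1}^{n-k+1}i^{2}\binom{n-i+k-2}{2k-3}(F_{2k-1}+F_{2k+1}-k^2+k-2) + ((-1)^n+2)\sum_{k=3}^n \sum_{i=1}^{n-k+1}i^{2}\binom{n-i+k-2}{2k-3} \left(k + \frac{(-1)^k+1}{8} k^2\right)$$ (semigroup) endomorphisms.
   Context: Let $\Omega_n=\{1<2<\cdots<n\}$. A sequence $(a_1,\ldots,a_t)$ in $\Omega_n$ is cyclic [anti-cyclic] if there is at most one index $i\in\{1,\ldots,t\}$ with $a_i>a_{i+1}$ [$a_i<a_{i+1}$], where $a_{t+1}=a_1$. $\mathcal{OR}_n$ is the monoid (under composition) of all full transformations $\alpha$ of $\Omega_n$ that are oriented, i.e. such that the sequence $(1\alpha,2\alpha,\ldots,n\alpha)$ is cyclic or anti-cyclic. $F_i$ denotes the $i$th Fibonacci number ($F_0=0$, $F_1=F_2=1$). *)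

theory Defs
  imports "HOL-Algebra.Group" "HOL-Number_Theory.Fib"
begin

text \<open>A sequence \<open>(a 1, \<dots>, a t)\<close> is given by a function of which only the values on
  \<open>{1..t}\<close> matter.  The successor of the index \<open>t\<close> is \<open>1\<close>.\<close>

definition next_index :: "nat \<Rightarrow> nat \<Rightarrow> nat" where
  "next_index t i = (if i = t then 1 else i + 1)"

definition cyclic_seq :: "nat \<Rightarrow> (nat \<Rightarrow> 'a::linorder) \<Rightarrow> bool" where
  "cyclic_seq t a \<longleftrightarrow> card {i \<in> {1..t}. a i > a (next_index t i)} \<le> 1"

definition anti_cyclic_seq :: "nat \<Rightarrow> (nat \<Rightarrow> 'a::linorder) \<Rightarrow> bool" where
  "anti_cyclic_seq t a \<longleftrightarrow> card {i \<in> {1..t}. a i < a (next_index t i)} \<le> 1"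

text \<open>Full transformations of \<open>{1..n}\<close> are extensional functions, so that each is represented
  exactly once.  Maps act on the right: \<open>\<alpha> \<otimes> \<beta>\<close> is \<open>\<alpha>\<close> followed by \<open>\<beta>\<close>.\<close>

definition OR :: "nat \<Rightarrow> (nat \<Rightarrow> nat) monoid" where
  "OR n = \<lparr> carrier = {\<alpha> \<in> {1..n} \<rightarrow>\<^sub>E {1..n}. cyclic_seq n \<alpha> \<or> anti_cyclic_seq n \<alpha>},
            mult = (\<lambda>\<alpha> \<beta>. compose {1..n} \<beta> \<alpha>),
            one = (\<lambda>x\<in>{1..n}. x) \<rparr>"

text \<open>\<^const>\<open>hom\<close> does not require preservation of the identity, so its members are semigroup
  homomorphisms.  Restricting to extensional maps makes different members different as maps
  on the carrier.\<close>

definition semigroup_endos :: "('a, 'b) monoid_scheme \<Rightarrow> ('a \<Rightarrow> 'a) set" where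
  "semigroup_endos S = hom S S \<inter> extensional (carrier S)"

end

theory Submission
  imports Defs "HOL-Library.Infinite_Set"
begin

text \<open>An oriented map \<open>{1..n} \<rightarrow> {1..m}\<close> is the reduction of a monotone \<open>f\<close> on the integers with
  \<open>f (x + n) = f x + m\<close>, or of its negative; so oriented maps compose, and the units of \<open>OR n\<close> are
  the dihedral maps. If an endomorphism is injective on the units, it fixes the identity, because
  \<open>e (OR n) e\<close> is isomorphic to \<open>OR k\<close> for an idempotent \<open>e\<close> of rank \<open>k\<close> and has at most \<open>2 k\<close> units;
  it then permutes the constant maps and is a conjugation by a unit, which gives \<open>2 n\<close> endomorphisms.
  Otherwise some nontrivial rotation has the same image as the identity, and this collapses all
  singular maps to one idempotent \<open>z\<close>. The units then act on the image of \<open>e = \<phi> 1\<close> fixing a point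
  of the image of \<open>z\<close>, so they take at most two values \<open>e\<close> and \<open>g\<close>, with \<open>g\<close> a reflection.
  Such endomorphisms are counted by pairs \<open>(e, z)\<close>, or by triples \<open>(e, g, z)\<close> and a subgroup of
  index two in the dihedral group; by the isomorphism with \<open>OR k\<close> it suffices to know the number of
  idempotents of each rank. An idempotent of rank at least two is a unique rotation of an
  order-preserving one whose last block is rotated past \<open>n\<close> by less than its length.\<close>

subsection \<open>Oriented sequences and their lifts\<close>

text \<open>Constant maps do most of the work: \<open>a \<odot>[n] cst n p\<close> is
  \<open>cst n p\<close>, and \<open>cst n p \<odot>[n] a\<close> is \<open>cst n (a p)\<close>. So
  an endomorphism that permutes the constants is governed by a permutation of the points, and one
  that identifies two constants identifies them all. The units alone say too little: automorphisms
  of the dihedral group may multiply rotation amounts by any unit modulo n, and only an idempotent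
  of rank n - 1 forces this factor to be 1 or -1. The hypothesis n \<ge> 3 keeps rotations and
  reflections apart. Origin of the constants: 3 n is the 2 n conjugations plus the n pairs
  \<open>(e, z)\<close> with \<open>e\<close> of rank one, where \<open>z = e\<close>. The factor
  (-1)^n + 2 is the number of subgroups of index two in the dihedral group, 3 or 1. The Fibonacci
  expression is the number of idempotents of \<open>OR k\<close>. In the second sum, k counts the
  constants, each with the reflection fixing its value, and k^2 / 4 for even k counts the symmetric
  idempotents with two antipodal values.\<close>

definition res :: "nat \<Rightarrow> int \<Rightarrow> nat" where
  "res n x = nat ((x - 1) mod int n) + 1"

lemma res_in: "n > 0 \<Longrightarrow> res n x \<in> {1..n}"
  unfolding res_def by (auto simp: Suc_le_eq nat_less_iff)

lemma res_ge [simp]: "Suc 0 \<le> res n x"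
  unfolding res_def by simp

lemma res_pos [simp]: "0 < res n x"
  unfolding res_def by simp

lemma res_le [simp]: "n > 0 \<Longrightarrow> res n x \<le> n"
  using res_in by auto

lemma int_res: "n > 0 \<Longrightarrow> int (res n x) = (x - 1) mod int n + 1"
  unfolding res_def by simp

lemma res_int [simp]: "i \<in> {1..n} \<Longrightarrow> res n (int i) = i"
  unfolding res_def by (auto simp: nat_eq_iff)

lemma res_cong: "n > 0 \<Longrightarrow> int n dvd int (res n x) - x"
proof -
  assume "n > 0"
  then have "int (res n x) - x = - ((x - 1) - (x - 1) mod int n)" by (simp add: int_res)
  then show ?thesis by (metis dvd_minus_mod dvd_minus_iff)
qed

lemma res_eq_iff: "n > 0 \<Longrightarrow> res n x = res n y \<longleftrightarrow> int n dvd x - y"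
proof -
  assume n: "n > 0"
  have "res n x = res n y \<longleftrightarrow> int (res n x) = int (res n y)" by simp
  also have "\<dots> \<longleftrightarrow> (x - 1) mod int n = (y - 1) mod int n" by (simp add: int_res n)
  also have "\<dots> \<longleftrightarrow> int n dvd x - y" by (simp add: mod_eq_dvd_iff)
  finally show ?thesis .
qed

lemma res_add_period [simp]: "n > 0 \<Longrightarrow> res n (x + int n) = res n x"
  by (simp add: res_eq_iff)

lemma mono_int_stepI:
  fixes f :: "int \<Rightarrow> int"
  assumes "\<And>x. f x \<le> f (x + 1)" shows "mono f"
proof
  fix x y :: int assume "x \<le> y"
  then show "f x \<le> f y"
    by (induction rule: int_ge_induct) (auto intro: order_trans assms)
qed

text \<open>The lift \<open>f\<close> has degree exactly one; a constant map is covered by a lift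
  that jumps by all of \<open>m\<close> at once. The sign stays outside \<open>f\<close>, so that
  \<open>f\<close> is monotone in both cases. Two sizes are needed because local monoids are reached
  through maps between \<open>{1..n}\<close> and \<open>{1..k}\<close>.\<close>

definition oriented :: "nat \<Rightarrow> nat \<Rightarrow> (nat \<Rightarrow> nat) \<Rightarrow> bool" where
  "oriented n m a \<longleftrightarrow> (\<exists>f \<sigma>. mono f \<and> (\<forall>x. f (x + int n) = f x + int m) \<and> \<sigma> \<in> {1, -1} \<and>
     (\<forall>x. a (res n x) = res m (\<sigma> * f x)))"

lemma orientedI:
  assumes "mono f" "\<And>x. f (x + int n) = f x + int m" "\<sigma> \<in> {1, -1}"
    "\<And>x. a (res n x) = res m (\<sigma> * f x)"
  shows "oriented n m a"
  using assms unfolding oriented_def by blast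

text \<open>Lifts compose. If the inner sign is -1, the outer lift \<open>g\<close> is replaced by
  the map taking \<open>x\<close> to \<open>- g (- x)\<close>, which is again monotone of the same
  degree, and the signs multiply.\<close>

lemma oriented_comp:
  assumes "oriented n m a" "oriented m p b"
  shows "oriented n p (\<lambda>x. b (a x))"
proof -
  obtain f \<sigma> where f: "mono f" "\<And>x. f (x + int n) = f x + int m" "\<sigma> \<in> {1, -1}"
    "\<And>x. a (res n x) = res m (\<sigma> * f x)" using assms(1) unfolding oriented_def by blast
  obtain g \<tau> where g: "mono g" "\<And>x. g (x + int m) = g x + int p" "\<tau> \<in> {1, -1}"
    "\<And>x. b (res m x) = res p (\<tau> * g x)" using assms(2) unfolding oriented_def by blast
  show ?thesis
  proof (cases "\<sigma> = 1")
    case True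
    show ?thesis
      by (rule orientedI[of "\<lambda>x. g (f x)" _ _ \<tau>])
        (use f g True in \<open>auto intro!: monoI dest: monoD\<close>)
  next
    case False
    then have s: "\<sigma> = -1" using f by auto
    have g': "g (- int m - x) = g (- x) - int p" for x using g(2)[of "- int m - x"] by simp
    show ?thesis
      by (rule orientedI[of "\<lambda>x. - g (- f x)" _ _ "- \<tau>"])
        (use f g s g' in \<open>auto intro!: monoI monoD[OF g(1)] monoD[OF f(1)] simp: diff_conv_add_uminus[symmetric] add.commute\<close>)
  qed
qed

lemma oriented_cong:
  assumes "n > 0" "\<And>i. i \<in> {1..n} \<Longrightarrow> a i = b i"
  shows "oriented n m a \<longleftrightarrow> oriented n m b"
  unfolding oriented_def using assms res_in[of n] by simp

lemma next_index_res:
  assumes "n > 0" shows "next_index n (res n x) = res n (x + 1)"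
proof -
  have "next_index n (res n x) \<in> {1..n}"
    using res_in[OF assms, of x] assms by (auto simp: next_index_def Suc_le_eq order_le_less)
  moreover have "int n dvd int (next_index n (res n x)) - (x + 1)"
  proof (cases "res n x = n")
    case True
    then have "int n dvd int n - x" using res_cong[OF assms, of x] by simp
    then have "int n dvd (int n - x) - int n" by (rule dvd_diff) simp
    then show ?thesis using True by (simp add: next_index_def)
  next
    case False
    then show ?thesis using res_cong[OF assms, of x] by (simp add: next_index_def)
  qed
  then have "res n (int (next_index n (res n x))) = res n (x + 1)"
    by (simp only: res_eq_iff[OF assms])
  ultimately show ?thesis by (simp only: res_int)
qed

lemma cyclic_seq_lift:
  assumes "n > 0" "m > 0" "a ` {1..n} \<subseteq> {1..m}" "cyclic_seq n a"
  obtains f where "mono f" "\<And>x. f (x + int n) = f x + int m" "\<And>x. a (res n x) = res m (f x)"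
proof -
  let ?D = "{i \<in> {1..n}. a i > a (next_index n i)}"
  have "\<exists>d \<in> {1..n}. ?D \<subseteq> {d}"
  proof (cases "?D = {}")
    \<comment> \<open>Without a descent the sequence is constant, and every position would serve as
      the cut.\<close>
    case True have "n \<in> {1..n}" using assms(1) by simp
    moreover have "?D \<subseteq> {n}" unfolding True by (rule empty_subsetI)
    ultimately show ?thesis by blast
  next
    case False
    moreover have "finite ?D" by simp
    ultimately have "card ?D \<noteq> 0" by (simp only: card_eq_0_iff simp_thms)
    then have "card ?D = 1" using assms(4) unfolding cyclic_seq_def by linarith
    then obtain d where d: "?D = {d}" by (rule card_1_singletonE)
    moreover have "d \<in> ?D" unfolding d by simp
    ultimately have "d \<in> {1..n}" "?D \<subseteq> {d}" by blast+
    then show ?thesis by blast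
  qed
  then obtain d where d: "d \<in> {1..n}" and D: "?D \<subseteq> {d}" by blast
  \<comment> \<open>Values after the unique descent are raised by \<open>m\<close>, which absorbs
    the drop because all values lie in \<open>{1..m}\<close>; each full turn of the index adds
    another \<open>m\<close>.\<close>
  define h where "h i = int (a i) + (if d < i then int m else 0)" for i
  define f where "f x = h (res n x) + int m * ((x - 1) div int n)" for x
  have step: "f x \<le> f (x + 1)" for x
  proof -
    have i: "res n x \<in> {1..n}" by (rule res_in) fact
    have x: "x - 1 = int n * ((x - 1) div int n) + int (res n x) - 1"
      using assms(1) by (simp add: int_res)
    have nD: "res n x \<noteq> d \<Longrightarrow> a (res n x) \<le> a (next_index n (res n x))"
    proof (rule ccontr)
      assume "res n x \<noteq> d" "\<not> a (res n x) \<le> a (next_index n (res n x))"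
      then have "res n x \<in> ?D" using i by simp
      then show False using D \<open>res n x \<noteq> d\<close> by blast
    qed
    have am: "i \<in> {1..n} \<Longrightarrow> 1 \<le> a i \<and> a i \<le> m" for i using assms(3)
      by (simp only: image_subset_iff atLeastAtMost_iff)
    show ?thesis
    proof (cases "res n x = n")
      case True
      then have "x = int n * ((x - 1) div int n + 1)" using x by (simp add: algebra_simps)
      moreover have "int n * q div int n = q" for q using assms(1) by simp
      ultimately have xd: "x div int n = (x - 1) div int n + 1" by metis
      have r: "res n (x + 1) = 1"
        using True next_index_res[OF assms(1), of x] by (simp add: next_index_def)
      have "h n \<le> h 1 + int m"
        using nD True d am[of n] am[of 1] assms(1) unfolding h_def next_index_def
        by (cases "d = n") auto
      then show ?thesis unfolding f_def r True using xd by (simp add: distrib_left)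
    next
      case False
      then have r: "res n (x + 1) = res n x + 1"
        using next_index_res[OF assms(1), of x] by (simp add: next_index_def)
      have "int (res n x) < int n" using False i by auto
      moreover have "x = int n * ((x - 1) div int n) + int (res n x)" using x by linarith
      ultimately have xd: "x div int n = (x - 1) div int n"
        by (intro int_div_pos_eq[of _ _ _ "int (res n x)"]) auto
      have "h (res n x) \<le> h (res n x + 1)"
        using nD False d am[of "res n x"] am[of "res n x + 1"] i unfolding h_def next_index_def
        by (cases "res n x = d") auto
      then show ?thesis unfolding f_def r using xd by simp
    qed
  qed
  show thesis
  proof (rule that)
    show "mono f" by (rule mono_int_stepI) (rule step)
    show "f (x + int n) = f x + int m" for x
    proof -
      have "(x + int n - 1) div int n = (x - 1) div int n + 1"
        using assms(1) div_add_self2[of "int n" "x - 1"] by (simp add: algebra_simps)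
      then show ?thesis unfolding f_def using assms(1) by (simp add: distrib_left)
    qed
    show "a (res n x) = res m (f x)" for x
    proof -
      have "a (res n x) \<in> {1..m}" using assms res_in by blast
      then have "res m (int (a (res n x))) = a (res n x)" by simp
      moreover have "int m dvd int (a (res n x)) - f x" unfolding f_def h_def by auto
      then have "res m (int (a (res n x))) = res m (f x)" by (simp only: res_eq_iff[OF assms(2)])
      ultimately show ?thesis by simp
    qed
  qed
qed

text \<open>The quotient \<open>g\<close> of the lift by \<open>m\<close> increases at every descent
  of \<open>a\<close>, yet it grows by only one over a full period, so there is at most one
  descent.\<close>

lemma lift_cyclic_seq:
  assumes "n > 0" "m > 0" "mono f" "\<And>x. f (x + int n) = f x + int m"
    "\<And>x. a (res n x) = res m (f x)"
  shows "cyclic_seq n a"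
proof -
  define g where "g x = (f x - 1) div int m" for x
  have g: "mono g" unfolding g_def
    using assms(2) by (intro monoI zdiv_mono1 diff_right_mono monoD[OF assms(3)]) simp_all
  have gn: "g (int n + 1) = g 1 + 1"
  proof -
    have "f (int n + 1) - 1 = f 1 - 1 + int m" using assms(4)[of 1] by (simp add: add.commute)
    then show ?thesis unfolding g_def using assms(2) by (simp only: div_add_self2)
  qed
  have lt: "g (int i) < g (int i + 1)" if "i \<in> {1..n}" "a i > a (next_index n i)" for i
  proof -
    have "a i = res m (f (int i))" "a (next_index n i) = res m (f (int i + 1))"
      using assms(5)[of "int i"] assms(5)[of "int i + 1"] next_index_res[OF assms(1), of "int i"] that
      by simp_all
    then have "int (res m (f (int i + 1))) < int (res m (f (int i)))" using that by simp
    then have "(f (int i) - 1) mod int m > (f (int i + 1) - 1) mod int m"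
      by (simp add: int_res[OF assms(2)])
    moreover have "f (int i) \<le> f (int i + 1)" using assms(3) by (simp add: monoD)
    moreover have g1: "g (int i) \<le> g (int i + 1)" using g by (simp add: monoD)
    moreover have "f (int i) - 1 = int m * g (int i) + (f (int i) - 1) mod int m"
      "f (int i + 1) - 1 = int m * g (int i + 1) + (f (int i + 1) - 1) mod int m"
      unfolding g_def by simp_all
    ultimately have "g (int i) \<noteq> g (int i + 1)" by auto
    then show ?thesis using g1 by linarith
  qed
  have uniq: "i = j" if "i \<in> {1..n}" "a i > a (next_index n i)" "j \<in> {1..n}" "a j > a (next_index n j)" for i j
  proof (rule ccontr)
    assume "i \<noteq> j"
    have *: False if "i < j" "i \<in> {1..n}" "j \<in> {1..n}" "g (int i) < g (int i + 1)" "g (int j) < g (int j + 1)" for i j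
    proof -
      have "g 1 \<le> g (int i)" "g (int i + 1) \<le> g (int j)" "g (int j + 1) \<le> g (int n + 1)"
        using that g by (auto intro!: monoD[OF g])
      then show False using that gn by linarith
    qed
    show False using *[OF _ that(1,3) lt[OF that(1,2)] lt[OF that(3,4)]]
        *[OF _ that(3,1) lt[OF that(3,4)] lt[OF that(1,2)]] \<open>i \<noteq> j\<close> by (cases i j rule: linorder_cases) simp_all
  qed
  have "card {i \<in> {1..n}. a i > a (next_index n i)} \<le> 1"
  proof (cases "{i \<in> {1..n}. a i > a (next_index n i)} = {}")
    case True then show ?thesis by (simp only: card.empty)
  next
    case False
    then obtain i where "i \<in> {1..n}" "a i > a (next_index n i)" by blast
    then have "{i \<in> {1..n}. a i > a (next_index n i)} \<subseteq> {i}" using uniq by blast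
    then show ?thesis using card_mono[of "{i}"] by simp
  qed
  then show ?thesis unfolding cyclic_seq_def .
qed

lemma res_reflect: "m > 0 \<Longrightarrow> res m (1 - x) = m + 1 - res m x"
proof -
  assume m: "m > 0"
  have "m + 1 - res m x \<in> {1..m}" using res_in[OF m, of x] res_pos[of m x] unfolding atLeastAtMost_iff by arith
  moreover have "int m dvd int (m + 1 - res m x) - (1 - x)"
  proof -
    have "int (m + 1 - res m x) - (1 - x) = int m - (int (res m x) - x)"
      using res_le[OF m, of x] by (simp add: of_nat_diff)
    then show ?thesis using res_cong[OF m, of x] by (metis dvd_diff dvd_refl)
  qed
  then have "res m (int (m + 1 - res m x)) = res m (1 - x)" by (simp only: res_eq_iff[OF m])
  ultimately show ?thesis by (simp only: res_int)
qed

lemma anti_cyclic_seq_reflect: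
  assumes "n > 0" "a ` {1..n} \<subseteq> {1..m::nat}"
  shows "anti_cyclic_seq n a \<longleftrightarrow> cyclic_seq n (\<lambda>i. m + 1 - a i)"
proof -
  have "{i \<in> {1..n}. a i < a (next_index n i)}
    = {i \<in> {1..n}. m + 1 - a i > m + 1 - a (next_index n i)}"
  proof (rule Collect_cong, rule conj_cong[OF refl])
    fix i assume i: "i \<in> {1..n}"
    then have "next_index n i \<in> {1..n}" by (auto simp: next_index_def)
    with i have "a i \<in> {1..m}" "a (next_index n i) \<in> {1..m}" using assms(2) by blast+
    then have "a i \<le> m" "a (next_index n i) \<le> m" by auto
    then show "a i < a (next_index n i) \<longleftrightarrow> m + 1 - a (next_index n i) < m + 1 - a i" by arith
  qed
  then show ?thesis unfolding anti_cyclic_seq_def cyclic_seq_def by simp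
qed

lemma oriented_iff:
  assumes "n > 0" "m > 0" "a ` {1..n} \<subseteq> {1..m}"
  shows "oriented n m a \<longleftrightarrow> cyclic_seq n a \<or> anti_cyclic_seq n a"
proof
  assume "oriented n m a"
  then obtain f \<sigma> where f: "mono f" "\<And>x. f (x + int n) = f x + int m" "\<sigma> \<in> {1, -1}"
    "\<And>x. a (res n x) = res m (\<sigma> * f x)" unfolding oriented_def by blast
  show "cyclic_seq n a \<or> anti_cyclic_seq n a"
  proof (cases "\<sigma> = 1")
    case True then show ?thesis using lift_cyclic_seq[of n m f a] f assms by auto
  next
    case False
    then have s: "\<sigma> = -1" using f by auto
    have "cyclic_seq n (\<lambda>i. m + 1 - a i)"
    \<comment> \<open>Reflecting the values turns \<open>res m (- f x)\<close> into
      \<open>res m (f x + 1)\<close>, hence the shift by one; the converse direction subtracts it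
      again.\<close>
    proof (rule lift_cyclic_seq[OF assms(1,2), of "\<lambda>x. f x + 1"])
      show "m + 1 - a (res n x) = res m (f x + 1)" for x
        using res_reflect[OF assms(2), of "- f x"] f(4)[of x] s by (simp add: add.commute)
      show "mono (\<lambda>x. f x + 1)" using f(1) by (simp add: mono_def)
    qed (simp add: f(2))
    then show ?thesis using anti_cyclic_seq_reflect[OF assms(1,3)] by simp
  qed
next
  assume "cyclic_seq n a \<or> anti_cyclic_seq n a"
  then show "oriented n m a"
  proof
    assume "cyclic_seq n a"
    then obtain f where "mono f" "\<And>x. f (x + int n) = f x + int m" "\<And>x. a (res n x) = res m (f x)"
      using cyclic_seq_lift[OF assms] by blast
    then show ?thesis by (intro orientedI[of f _ _ 1]) auto
  next
    assume "anti_cyclic_seq n a"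
    then have c: "cyclic_seq n (\<lambda>i. m + 1 - a i)" using anti_cyclic_seq_reflect[OF assms(1,3)] by simp
    have s: "(\<lambda>i. m + 1 - a i) ` {1..n} \<subseteq> {1..m}" using assms(3) by force
    obtain f where f: "mono f" "\<And>x. f (x + int n) = f x + int m" "\<And>x. m + 1 - a (res n x) = res m (f x)"
      using cyclic_seq_lift[OF assms(1,2) s c] by blast
    have "a (res n x) = res m (- (f x - 1))" for x
    proof -
      have "a (res n x) \<in> {1..m}" using assms res_in by blast
      then have "a (res n x) = m + 1 - (m + 1 - a (res n x))" by auto
      then show ?thesis using f(3)[of x] res_reflect[OF assms(2), of "f x"] by simp
    qed
    moreover have "mono (\<lambda>x. f x - 1)" by (intro monoI diff_right_mono monoD[OF f(1)])
    ultimately show ?thesis by (intro orientedI[of "\<lambda>x. f x - 1" _ _ "-1"]) (simp_all add: f(2))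
  qed
qed

text \<open>The difference \<open>f z - f x\<close> of the lift is a multiple of \<open>m\<close>
  between 0 and \<open>m\<close>. So it is 0 or \<open>m\<close>, and monotonicity makes
  \<open>f\<close> constant on the arc from \<open>x\<close> to \<open>z\<close> or on the
  complementary one. Later arguments about kernel classes use orientation through this fact.\<close>

lemma oriented_arc:
  assumes "oriented n m a" "m > 0" "x \<le> z" "z \<le> x + int n" "a (res n x) = a (res n z)"
  shows "(\<forall>y\<in>{x..z}. a (res n y) = a (res n x)) \<or> (\<forall>y\<in>{z..x + int n}. a (res n y) = a (res n x))"
proof -
  obtain f \<sigma> where f: "mono f" "\<And>x. f (x + int n) = f x + int m" "\<sigma> \<in> {1, -1}"
    "\<And>x. a (res n x) = res m (\<sigma> * f x)" using assms(1) unfolding oriented_def by blast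
  have le: "f x \<le> f z" "f z \<le> f x + int m"
    using monoD[OF f(1) assms(3)] monoD[OF f(1) assms(4)] f(2)[of x] by simp_all
  have "int m dvd \<sigma> * f z - \<sigma> * f x"
    using assms(5) f(4)[of x] f(4)[of z] res_eq_iff[OF assms(2), of "\<sigma> * f z" "\<sigma> * f x"] by simp
  then have "int m dvd \<sigma> * (f z - f x)" by (simp add: right_diff_distrib)
  then have "int m dvd f z - f x"
    using f(3) dvd_minus_iff[of "int m" "f z - f x"] by auto
  then obtain q where q: "f z - f x = int m * q" by (rule dvdE)
  then have "0 \<le> int m * q" "int m * q \<le> int m * 1" using le by auto
  then have "0 \<le> q" "q \<le> 1" using assms(2) by (simp_all add: zero_le_mult_iff)
  then have "q = 0 \<or> q = 1" by linarith
  then consider "f z = f x" | "f z = f x + int m" using q by (metis add.commute add_0 diff_eq_eq mult_1_right mult_zero_right)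
  then show ?thesis
  proof cases
    case 1
    then have "f y = f x" if "y \<in> {x..z}" for y
      using that monoD[OF f(1), of x y] monoD[OF f(1), of y z] by auto
    then have "\<forall>y\<in>{x..z}. a (res n y) = a (res n x)" by (metis f(4))
    then show ?thesis ..
  next
    case 2
    then have "f y = f z" if "y \<in> {z..x + int n}" for y
      using that monoD[OF f(1), of z y] monoD[OF f(1), of y "x + int n"] f(2)[of x] by auto
    then have "\<forall>y\<in>{z..x + int n}. a (res n y) = a (res n z)" by (metis f(4))
    then show ?thesis unfolding assms(5) by (rule disjI2)
  qed
qed

subsection \<open>The monoid of oriented maps\<close>

abbreviation OR_mult :: "(nat \<Rightarrow> nat) \<Rightarrow> nat \<Rightarrow> (nat \<Rightarrow> nat) \<Rightarrow> nat \<Rightarrow> nat" ("_ \<odot>[_] _" [70, 0, 71] 70) where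
  "a \<odot>[n] b \<equiv> a \<otimes>\<^bsub>OR n\<^esub> b"

lemma carrier_OR:
  assumes "n > 0"
  shows "carrier (OR n) = {a \<in> {1..n} \<rightarrow>\<^sub>E {1..n}. oriented n n a}"
proof -
  have "oriented n n a \<longleftrightarrow> cyclic_seq n a \<or> anti_cyclic_seq n a" if "a \<in> {1..n} \<rightarrow>\<^sub>E {1..n}" for a
    using that assms by (intro oriented_iff) auto
  then show ?thesis unfolding OR_def by auto
qed

lemma OR_oriented: "n > 0 \<Longrightarrow> a \<in> carrier (OR n) \<Longrightarrow> oriented n n a"
  by (simp add: carrier_OR)

lemma OR_apply_in: "a \<in> carrier (OR n) \<Longrightarrow> i \<in> {1..n} \<Longrightarrow> a i \<in> {1..n}"
  unfolding OR_def by (auto simp: PiE_iff)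

lemma OR_res_in: "n > 0 \<Longrightarrow> a \<in> carrier (OR n) \<Longrightarrow> a (res n x) \<in> {1..n}"
  by (rule OR_apply_in) (auto simp: res_in)

lemma OR_extensional: "a \<in> carrier (OR n) \<Longrightarrow> a \<in> extensional {1..n}"
  unfolding OR_def by (auto simp: PiE_iff)

lemma OR_eqI:
  assumes "a \<in> carrier (OR n)" "b \<in> carrier (OR n)" "\<And>i. i \<in> {1..n} \<Longrightarrow> a i = b i"
  shows "a = b"
  using assms OR_extensional extensionalityI by blast

lemma OR_res_eqI:
  assumes "a \<in> carrier (OR n)" "b \<in> carrier (OR n)" "\<And>x. a (res n x) = b (res n x)"
  shows "a = b"
  using assms(1,2) by (rule OR_eqI) (metis assms(3) res_int)

lemma restrict_in_OR:
  assumes "n > 0" "oriented n n f" "f ` {1..n} \<subseteq> {1..n}"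
  shows "restrict f {1..n} \<in> carrier (OR n)"
proof -
  have "oriented n n (restrict f {1..n}) \<longleftrightarrow> oriented n n f" using assms(1) by (rule oriented_cong) simp
  then show ?thesis using assms by (auto simp: carrier_OR)
qed

lemma mult_OR_apply [simp]: "i \<in> {1..n} \<Longrightarrow> (a \<odot>[n] b) i = b (a i)"
  unfolding OR_def by (simp add: compose_def)

lemma mult_OR_res [simp]: "n > 0 \<Longrightarrow> (a \<odot>[n] b) (res n x) = b (a (res n x))"
  by (rule mult_OR_apply[OF res_in])

lemma one_OR_apply [simp]: "i \<in> {1..n} \<Longrightarrow> \<one>\<^bsub>OR n\<^esub> i = i"
  unfolding OR_def by simp

lemma one_OR_res [simp]: "n > 0 \<Longrightarrow> \<one>\<^bsub>OR n\<^esub> (res n x) = res n x"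
  by (rule one_OR_apply[OF res_in])

lemma oriented_mono:
  assumes "n > 0" "m > 0" "f ` {1..n} \<subseteq> {1..m}" "mono_on {1..n} f"
  shows "oriented n m f"
proof -
  have "{i \<in> {1..n}. f i > f (next_index n i)} \<subseteq> {n}"
  proof (intro subsetI, rule ccontr)
    fix i assume i: "i \<in> {i \<in> {1..n}. f i > f (next_index n i)}" "i \<notin> {n}"
    then have "f i \<le> f (i + 1)" by (intro mono_onD[OF assms(4)]) auto
    then show False using i by (simp add: next_index_def)
  qed
  then have "cyclic_seq n f" unfolding cyclic_seq_def using card_mono[of "{n}"] by fastforce
  then show ?thesis using oriented_iff[OF assms(1-3)] by simp
qed

lemma mult_in_OR:
  assumes "n > 0" "a \<in> carrier (OR n)" "b \<in> carrier (OR n)"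
  shows "a \<odot>[n] b \<in> carrier (OR n)"
proof -
  have "restrict (\<lambda>x. b (a x)) {1..n} \<in> carrier (OR n)"
  proof (rule restrict_in_OR[OF assms(1)])
    show "oriented n n (\<lambda>x. b (a x))"
      by (rule oriented_comp[OF OR_oriented OR_oriented]) fact+
    show "(\<lambda>x. b (a x)) ` {1..n} \<subseteq> {1..n}"
      by (intro image_subsetI OR_apply_in[OF assms(3)] OR_apply_in[OF assms(2)])
  qed
  then show ?thesis unfolding OR_def by (simp add: compose_def)
qed

lemma monoid_OR: "n > 0 \<Longrightarrow> monoid (OR n)"
proof
  assume n: "n > 0"
  show one: "\<one>\<^bsub>OR n\<^esub> \<in> carrier (OR n)"
  proof -
    have "restrict (\<lambda>x. x) {1..n} \<in> carrier (OR n)"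
      using n by (intro restrict_in_OR oriented_mono) (auto simp: mono_on_def)
    then show ?thesis unfolding OR_def by simp
  qed
  fix a b c assume [simp]: "a \<in> carrier (OR n)"
  show "\<one>\<^bsub>OR n\<^esub> \<odot>[n] a = a"
    using n one by (intro OR_eqI[of _ n]) (auto intro!: mult_in_OR)
  show "a \<odot>[n] \<one>\<^bsub>OR n\<^esub> = a"
    using n one OR_apply_in[of a n] by (intro OR_eqI[of _ n]) (auto intro!: mult_in_OR)
  assume [simp]: "b \<in> carrier (OR n)"
  show "a \<odot>[n] b \<in> carrier (OR n)" using n by (simp add: mult_in_OR)
  assume [simp]: "c \<in> carrier (OR n)"
  show "a \<odot>[n] b \<odot>[n] c = a \<odot>[n] (b \<odot>[n] c)"
    using n OR_apply_in[of a n] by (intro OR_eqI[of _ n]) (simp_all add: mult_in_OR)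
qed

section \<open>Rotations, reflections and constant maps\<close>

definition dih :: "nat \<Rightarrow> int \<Rightarrow> int \<Rightarrow> nat \<Rightarrow> nat" where
  "dih n s c = (\<lambda>i\<in>{1..n}. res n (s * int i + c))"

definition cst :: "nat \<Rightarrow> nat \<Rightarrow> nat \<Rightarrow> nat" where
  "cst n p = (\<lambda>i\<in>{1..n}. p)"

lemma cst_apply [simp]: "i \<in> {1..n} \<Longrightarrow> cst n p i = p"
  by (simp add: cst_def)

lemma cst_res [simp]: "n > 0 \<Longrightarrow> cst n p (res n x) = p"
  by (rule cst_apply[OF res_in])

lemma cst_in_OR [simp]: "p \<in> {1..n} \<Longrightarrow> cst n p \<in> carrier (OR n)"
  unfolding cst_def by (intro restrict_in_OR oriented_mono) (auto simp: mono_on_def)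

lemma cst_mult:
  assumes "p \<in> {1..n}" "a \<in> carrier (OR n)"
  shows "cst n p \<odot>[n] a = cst n (a p)"
proof (rule OR_eqI)
  have "n > 0" using assms(1) by simp
  then show "cst n p \<odot>[n] a \<in> carrier (OR n)" using assms by (simp add: mult_in_OR)
  show "cst n (a p) \<in> carrier (OR n)" by (rule cst_in_OR[OF OR_apply_in[OF assms(2,1)]])
qed simp

lemma mult_cst:
  assumes "p \<in> {1..n}" "a \<in> carrier (OR n)"
  shows "a \<odot>[n] cst n p = cst n p"
proof (rule OR_eqI)
  have "n > 0" using assms(1) by simp
  then show "a \<odot>[n] cst n p \<in> carrier (OR n)" using assms by (simp add: mult_in_OR)
  show "cst n p \<in> carrier (OR n)" by (intro cst_in_OR assms)
  show "(a \<odot>[n] cst n p) i = cst n p i" if "i \<in> {1..n}" for i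
    using that OR_apply_in[OF assms(2) that] by (simp only: mult_OR_apply cst_apply)
qed

lemma dih_res [simp]:
  assumes "n > 0" shows "dih n s c (res n x) = res n (s * x + c)"
proof -
  have "dih n s c (res n x) = res n (s * int (res n x) + c)"
    unfolding dih_def by (rule restrict_apply'[OF res_in[OF assms]])
  also have "\<dots> = res n (s * x + c)"
  proof (subst res_eq_iff[OF assms])
    have "s * int (res n x) + c - (s * x + c) = s * (int (res n x) - x)" by (simp add: algebra_simps)
    then show "int n dvd s * int (res n x) + c - (s * x + c)" using res_cong[OF assms] by simp
  qed
  finally show ?thesis .
qed

lemma dih_in_OR [simp]: "n > 0 \<Longrightarrow> s \<in> {1, -1} \<Longrightarrow> dih n s c \<in> carrier (OR n)"
proof -
  assume n: "n > 0" and s: "s \<in> {1, -1}"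
  have "oriented n n (dih n s c)"
    using n s by (intro orientedI[of "\<lambda>x. x + s * c" n n s]) (auto simp: mono_def algebra_simps)
  moreover have "dih n s c \<in> {1..n} \<rightarrow>\<^sub>E {1..n}"
    unfolding dih_def using res_in[OF n] by auto
  ultimately show ?thesis using n by (simp add: carrier_OR)
qed

lemma dih_mult:
  assumes "n > 0" "s \<in> {1, -1}" "t \<in> {1, -1}"
  shows "dih n s c \<odot>[n] dih n t d = dih n (s * t) (t * c + d)"
  using assms by (intro OR_res_eqI[of _ n]) (auto intro!: mult_in_OR simp: algebra_simps)

lemma dih_one: "n > 0 \<Longrightarrow> dih n 1 0 = \<one>\<^bsub>OR n\<^esub>"
  by (intro OR_res_eqI[of _ n]) (auto simp: monoid.one_closed monoid_OR)

lemma dih_cong: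
  assumes "n > 0" "int n dvd c - d" shows "dih n s c = dih n s d"
  unfolding dih_def using assms by (auto simp: res_eq_iff)

text \<open>Comparing the values at 0 and at 1 shows that \<open>n\<close> divides
  \<open>c - d\<close> and \<open>s - t\<close>. The latter is at most 2 in absolute value, hence 0
  when n \<ge> 3; for smaller \<open>n\<close> reflections coincide with rotations.\<close>

lemma dih_eq_iff:
  assumes "n \<ge> 3" "s \<in> {1, -1}" "t \<in> {1, -1}"
  shows "dih n s c = dih n t d \<longleftrightarrow> s = t \<and> int n dvd c - d"
proof
  assume e: "dih n s c = dih n t d"
  have n: "n > 0" using assms by simp
  have *: "int n dvd s * x + c - (t * x + d)" for x
    using arg_cong[OF e, of "\<lambda>f. f (res n x)"] n by (simp add: res_eq_iff)
  have 0: "int n dvd c - d" using *[of 0] by simp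
  have "int n dvd (s * 1 + c - (t * 1 + d)) - (c - d)" using *[of 1] 0 by (rule dvd_diff)
  then have "int n dvd s - t" by (simp add: algebra_simps)
  moreover have "\<bar>s - t\<bar> < int n" using assms by auto
  ultimately have "s = t" using zdvd_not_zless[of "\<bar>s - t\<bar>" "int n"] by fastforce
  then show "s = t \<and> int n dvd c - d" using 0 by simp
qed (use assms dih_cong in auto)

text \<open>Injectivity makes each step of the lift at least one, and \<open>n\<close> steps add up
  to \<open>n\<close>, so every step is exactly one.\<close>

lemma OR_inj_dih:
  assumes "n > 0" "a \<in> carrier (OR n)" "inj_on a {1..n}"
  obtains s c where "s \<in> {1, -1}" "c \<in> {0..<int n}" "a = dih n s c"
proof -
  obtain f \<sigma> where f: "mono f" "\<And>x. f (x + int n) = f x + int n" "\<sigma> \<in> {1, -1}"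
    "\<And>x. a (res n x) = res n (\<sigma> * f x)"
    using OR_oriented[OF assms(1,2)] unfolding oriented_def by blast
  have step: "f (x + 1) \<ge> f x + 1" for x
  proof (cases "n = 1")
    case True then show ?thesis using f(2)[of x] by simp
  next
    case False
    then have "\<not> int n dvd (x + 1) - x" using assms(1) by simp
    then have "res n x \<noteq> res n (x + 1)" using res_eq_iff[OF assms(1)] by metis
    then have "a (res n x) \<noteq> a (res n (x + 1))" using res_in[OF assms(1)] inj_onD[OF assms(3)] by metis
    then have "f x \<noteq> f (x + 1)" using f(4) by metis
    moreover have "f x \<le> f (x + 1)" by (rule monoD[OF f(1)]) simp
    ultimately show ?thesis by linarith
  qed
  have g: "mono (\<lambda>x. f x - x)"
    by (rule mono_int_stepI) (use step in \<open>simp add: algebra_simps\<close>)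
  \<comment> \<open>\<open>f x - x\<close> is monotone and has period \<open>n\<close>, so it cannot
    increase anywhere.\<close>
  have "f (x + 1) - (x + 1) \<le> f x - x" for x
    using monoD[OF g, of "x + 1" "x + int n"] f(2)[of x] assms(1) by simp
  then have "mono (\<lambda>x. x - f x)" by (intro mono_int_stepI) (simp add: algebra_simps)
  then have eq: "f x = x + f 0" for x
    using monoD[OF g, of x 0] monoD[OF g, of 0 x] monoD[of "\<lambda>x. x - f x" x 0] monoD[of "\<lambda>x. x - f x" 0 x]
    by (cases "x \<le> 0") simp_all
  have *: "a = dih n \<sigma> (\<sigma> * f 0)"
  proof (rule OR_res_eqI[OF assms(2) dih_in_OR[OF assms(1) f(3)]])
    show "a (res n x) = dih n \<sigma> (\<sigma> * f 0) (res n x)" for x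
      using f(4)[of x] eq[of x] assms(1) by (simp add: distrib_left)
  qed
  have "int n dvd \<sigma> * f 0 - (\<sigma> * f 0) mod int n" by (rule dvd_minus_mod)
  then have "a = dih n \<sigma> ((\<sigma> * f 0) mod int n)" using * dih_cong[OF assms(1)] by metis
  then show thesis using f(3) assms(1) by (intro that[of \<sigma> "(\<sigma> * f 0) mod int n"]) simp_all
qed

lemma inj_on_dih:
  assumes "n > 0" "s \<in> {1, -1}" shows "inj_on (dih n s c) {1..n}"
proof
  fix i j assume ij: "i \<in> {1..n}" "j \<in> {1..n}" "dih n s c i = dih n s c j"
  have "dih n s c (res n (int i)) = dih n s c (res n (int j))" using ij by simp
  then have "int n dvd s * int i + c - (s * int j + c)"
    by (simp add: assms(1) res_eq_iff del: res_int)
  then have "int n dvd int i - int j"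
    using assms(2) dvd_minus_iff[of "int n" "int i - int j"] by auto
  then have "res n (int i) = res n (int j)" using res_eq_iff[OF assms(1)] by blast
  then show "i = j" using ij by simp
qed

text \<open>One of the two arcs between points with equal values is constant by
  \<open>oriented_arc\<close>, and either arc contains a pair of neighbours, possibly
  \<open>n\<close> and 1.\<close>

lemma OR_not_inj_adjacent:
  assumes "n > 0" "a \<in> carrier (OR n)" "\<not> inj_on a {1..n}"
  obtains x where "a (res n x) = a (res n (x + 1))"
proof -
  obtain i j where ij: "i \<in> {1..n}" "j \<in> {1..n}" "a i = a j" "i < j"
    using assms(3) unfolding inj_on_def by (metis linorder_neqE_nat)
  have "(\<forall>y\<in>{int i..int j}. a (res n y) = a (res n (int i))) \<or>
      (\<forall>y\<in>{int j..int i + int n}. a (res n y) = a (res n (int i)))"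
    using ij assms by (intro oriented_arc[OF OR_oriented]) simp_all
  then show thesis
  proof
    assume *: "\<forall>y\<in>{int i..int j}. a (res n y) = a (res n (int i))"
    have "a (res n (int i + 1)) = a (res n (int i))" by (rule bspec[OF *]) (use ij(4) in simp)
    then show thesis using that[of "int i"] by simp
  next
    assume *: "\<forall>y\<in>{int j..int i + int n}. a (res n y) = a (res n (int i))"
    have "a (res n (int j)) = a (res n (int i))" "a (res n (int j + 1)) = a (res n (int i))"
      by (rule bspec[OF *]; use ij in simp)+
    then show thesis using that[of "int j"] by simp
  qed
qed

subsection \<open>Local monoids and units\<close>

text \<open>For an idempotent \<open>e\<close> these are the products \<open>e a e\<close>, a monoid
  with identity \<open>e\<close>; the equations avoid a witness \<open>a\<close>.\<close>

definition local_monoid :: "nat \<Rightarrow> (nat \<Rightarrow> nat) \<Rightarrow> (nat \<Rightarrow> nat) set" where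
  "local_monoid n e = {a \<in> carrier (OR n). e \<odot>[n] a = a \<and> a \<odot>[n] e = a}"

lemma idempotent_fix:
  assumes "e \<odot>[n] e = e" "p \<in> e ` {1..n}" shows "e p = p"
proof -
  obtain i where "i \<in> {1..n}" "p = e i" using assms(2) by blast
  then show ?thesis using arg_cong[OF assms(1), of "\<lambda>f. f i"] by simp
qed

definition local_iso :: "nat \<Rightarrow> (nat \<Rightarrow> nat) \<Rightarrow> nat \<Rightarrow> ((nat \<Rightarrow> nat) \<Rightarrow> nat \<Rightarrow> nat) \<Rightarrow> bool" where
  "local_iso n e k \<Phi> \<longleftrightarrow> bij_betw \<Phi> (local_monoid n e) (carrier (OR k)) \<and>
     (\<forall>a\<in>local_monoid n e. \<forall>b\<in>local_monoid n e. \<Phi> (a \<odot>[n] b) = \<Phi> a \<odot>[k] \<Phi> b) \<and>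
     \<Phi> e = \<one>\<^bsub>OR k\<^esub>"

lemma local_isoD:
  assumes "local_iso n e k \<Phi>"
  shows local_iso_bij: "bij_betw \<Phi> (local_monoid n e) (carrier (OR k))"
    and local_iso_inj: "inj_on \<Phi> (local_monoid n e)"
    and local_iso_in: "a \<in> local_monoid n e \<Longrightarrow> \<Phi> a \<in> carrier (OR k)"
    and local_iso_surj: "b \<in> carrier (OR k) \<Longrightarrow> \<exists>a\<in>local_monoid n e. b = \<Phi> a"
    and local_iso_mult: "a \<in> local_monoid n e \<Longrightarrow> b \<in> local_monoid n e \<Longrightarrow>
      \<Phi> (a \<odot>[n] b) = \<Phi> a \<odot>[k] \<Phi> b"
    and local_iso_one: "\<Phi> e = \<one>\<^bsub>OR k\<^esub>"
  using assms unfolding local_iso_def bij_betw_def by blast+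

text \<open>An element of the local monoid maps into the image \<open>X\<close> of \<open>e\<close>
  and is determined by its restriction to \<open>X\<close>. Relabelling \<open>X\<close> in
  increasing order by \<open>{1..k}\<close> is order-preserving, hence oriented in both directions,
  so oriented maps correspond to oriented maps.\<close>

lemma local_iso_exists:
  assumes "n > 0" "e \<in> carrier (OR n)" "e \<odot>[n] e = e"
  defines "k \<equiv> card (e ` {1..n})"
  shows "\<exists>\<Phi>. local_iso n e k \<Phi>"
proof -
  define X where "X = e ` {1..n}"
  have finX: "finite X" unfolding X_def by simp
  have Xn: "X \<subseteq> {1..n}" unfolding X_def using OR_apply_in[OF assms(2)] by blast
  have kX: "k = card X" unfolding k_def X_def ..
  have "X \<noteq> {}" using assms(1) unfolding X_def by simp
  then have k: "k > 0" using finX kX by (simp add: card_gt_0_iff)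
  obtain h where h: "bij_betw h {..<k} X" "strict_mono_on {..<k} h"
    unfolding kX by (rule ex_bij_betw_strict_mono_card[OF finX])
  define x where "x i = h (i - 1)" for i
  have hX: "h ` {..<k} = X" using h(1) by (rule bij_betw_imp_surj_on)
  have xX: "x i \<in> X" if "i \<in> {1..k}" for i
    using that unfolding x_def hX[symmetric] by (intro imageI) auto
  have xn: "x i \<in> {1..n}" if "i \<in> {1..k}" for i using xX[OF that] Xn by blast
  have x_less: "x i < x j" if "i \<in> {1..k}" "j \<in> {1..k}" "i < j" for i j
    unfolding x_def using that by (intro strict_mono_onD[OF h(2)]) auto
  have x_surj: "\<exists>i\<in>{1..k}. p = x i" if "p \<in> X" for p
  proof -
    have "p \<in> h ` {..<k}" using that unfolding hX .
    then obtain i where "i < k" "p = h i" by auto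
    then show ?thesis by (intro bexI[of _ "Suc i"]) (auto simp: x_def)
  qed
  \<comment> \<open>A monotone extension of the inverse of \<open>x\<close> to all of
    \<open>{1..n}\<close>; the maximum with 1 takes care of points below the least element of
    \<open>X\<close>, where the count is 0.\<close>
  define y where "y p = max 1 (card {q \<in> X. q \<le> p})" for p
  have yk: "y p \<in> {1..k}" for p
    unfolding y_def kX using card_mono[OF finX, of "{q \<in> X. q \<le> p}"] k kX by auto
  have y_mono: "y p \<le> y q" if "p \<le> q" for p q
    unfolding y_def using that by (intro max.mono card_mono) (auto simp: finX)
  have yx: "y (x i) = i" if i: "i \<in> {1..k}" for i
  proof -
    have "{q \<in> X. q \<le> x i} = x ` {1..i}"
    proof (intro equalityI subsetI)
      fix q assume q: "q \<in> {q \<in> X. q \<le> x i}"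
      then obtain j where j: "j \<in> {1..k}" "q = x j" using x_surj by blast
      then have "\<not> i < j" using x_less[OF i j(1)] q by auto
      then show "q \<in> x ` {1..i}" using j by auto
    next
      fix q assume "q \<in> x ` {1..i}"
      then obtain j where j: "j \<in> {1..i}" "q = x j" by blast
      then have jk: "j \<in> {1..k}" using i by auto
      have "x j \<le> x i" using x_less[OF jk i] j by (cases "j = i") auto
      then show "q \<in> {q \<in> X. q \<le> x i}" using j xX[OF jk] by simp
    qed
    moreover have "inj_on x {1..i}"
    proof (rule inj_onI)
      fix j l assume "j \<in> {1..i}" "l \<in> {1..i}" "x j = x l"
      moreover from this have "j \<in> {1..k}" "l \<in> {1..k}" using i by auto
      ultimately show "j = l" using x_less[of j l] x_less[of l j] by (metis less_irrefl linorder_neqE_nat)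
    qed
    ultimately show ?thesis unfolding y_def using i by (simp add: card_image)
  qed
  have xy: "x (y p) = p" if "p \<in> X" for p using x_surj[OF that] yx by metis
  have eX: "e p = p" if "p \<in> X" for p using idempotent_fix[OF assms(3)] that unfolding X_def by blast
  have eXi: "e i \<in> X" if "i \<in> {1..n}" for i unfolding X_def using that by blast
  have or_x: "oriented k n x"
    using k assms(1) xn x_less by (intro oriented_mono) (auto simp: mono_on_def le_less)
  have or_y: "oriented n k y"
    using k assms(1) yk y_mono by (intro oriented_mono) (auto simp: mono_on_def)
  define \<Phi> where "\<Phi> a = restrict (\<lambda>i. y (a (x i))) {1..k}" for a
  \<comment> \<open>Elements of the local monoid absorb \<open>e\<close> on the left, so
    precomposing with \<open>e\<close> recovers their values outside \<open>X\<close>.\<close>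
  define \<Psi> where "\<Psi> b = restrict (\<lambda>j. x (b (y (e j)))) {1..n}" for b
  have \<Phi>: "\<Phi> a \<in> carrier (OR k)" if "a \<in> local_monoid n e" for a
  proof -
    have "oriented n n a" using that assms(1) by (simp add: local_monoid_def OR_oriented)
    then have "oriented k k (\<lambda>i. y (a (x i)))"
      by (intro oriented_comp[OF or_x] oriented_comp[OF _ or_y])
    then show ?thesis unfolding \<Phi>_def using yk k by (intro restrict_in_OR) auto
  qed
  have \<Psi>_apply: "\<Psi> b j = x (b (y (e j)))" if "j \<in> {1..n}" for b j
    unfolding \<Psi>_def using that by simp
  have \<Psi>_X: "\<Psi> b j \<in> X" if "b \<in> carrier (OR k)" "j \<in> {1..n}" for b j
    unfolding \<Psi>_apply[OF that(2)] by (intro xX OR_apply_in[OF that(1)] yk)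
  have \<Psi>_OR: "\<Psi> b \<in> carrier (OR n)" if "b \<in> carrier (OR k)" for b
    unfolding \<Psi>_def
  proof (rule restrict_in_OR[OF assms(1)])
    show "oriented n n (\<lambda>j. x (b (y (e j))))"
      by (intro oriented_comp[OF OR_oriented[OF assms(1,2)]] oriented_comp[OF or_y]
          oriented_comp[OF OR_oriented[OF k that]] or_x)
    show "(\<lambda>j. x (b (y (e j)))) ` {1..n} \<subseteq> {1..n}"
      by (intro image_subsetI xn OR_apply_in[OF that] yk)
  qed
  have \<Psi>: "\<Psi> b \<in> local_monoid n e" if "b \<in> carrier (OR k)" for b
  proof -
    have "e \<odot>[n] \<Psi> b = \<Psi> b"
    proof (rule OR_eqI[of _ n])
      fix i assume i: "i \<in> {1..n}"
      have "e (e i) = e i" using eX[OF eXi[OF i]] .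
      then show "(e \<odot>[n] \<Psi> b) i = \<Psi> b i"
        using i OR_apply_in[OF assms(2) i] by (simp add: \<Psi>_apply)
    qed (intro mult_in_OR assms \<Psi>_OR that)+
    moreover have "\<Psi> b \<odot>[n] e = \<Psi> b"
    proof (rule OR_eqI[of _ n])
      fix i assume i: "i \<in> {1..n}"
      then show "(\<Psi> b \<odot>[n] e) i = \<Psi> b i" using eX[OF \<Psi>_X[OF that i]] by simp
    qed (intro mult_in_OR assms \<Psi>_OR that)+
    ultimately show ?thesis unfolding local_monoid_def using \<Psi>_OR[OF that] by simp
  qed
  have aX: "a i \<in> X" "a (e i) = a i" if "a \<in> local_monoid n e" "i \<in> {1..n}" for a i
  proof -
    have a: "a \<in> carrier (OR n)" "e \<odot>[n] a = a" "a \<odot>[n] e = a"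
      using that(1) unfolding local_monoid_def by auto
    have "e (a i) = a i" using arg_cong[OF a(3), of "\<lambda>f. f i"] that(2) by simp
    then show "a i \<in> X" using eXi[OF OR_apply_in[OF a(1) that(2)]] by simp
    show "a (e i) = a i" using arg_cong[OF a(2), of "\<lambda>f. f i"] that(2) by simp
  qed
  have "bij_betw \<Phi> (local_monoid n e) (carrier (OR k))"
  proof (rule bij_betw_byWitness[where f' = \<Psi>])
    show "\<forall>a\<in>local_monoid n e. \<Psi> (\<Phi> a) = a"
    proof
      fix a assume a: "a \<in> local_monoid n e"
      have a': "a \<in> carrier (OR n)" using a unfolding local_monoid_def by simp
      show "\<Psi> (\<Phi> a) = a"
      proof (rule OR_eqI[OF \<Psi>_OR[OF \<Phi>[OF a]] a'])
        fix i assume i: "i \<in> {1..n}"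
        have "\<Phi> a (y (e i)) = y (a (e i))"
          unfolding \<Phi>_def using yk xy[OF eXi[OF i]] by simp
        then show "\<Psi> (\<Phi> a) i = a i" unfolding \<Psi>_apply[OF i] using aX[OF a i] xy by simp
      qed
    qed
    show "\<forall>b\<in>carrier (OR k). \<Phi> (\<Psi> b) = b"
    proof
      fix b assume b: "b \<in> carrier (OR k)"
      show "\<Phi> (\<Psi> b) = b"
      proof (rule OR_eqI[OF \<Phi>[OF \<Psi>[OF b]] b])
        fix i assume i: "i \<in> {1..k}"
        have "\<Psi> b (x i) = x (b i)" using \<Psi>_apply[OF xn[OF i]] eX[OF xX[OF i]] yx[OF i] by simp
        then show "\<Phi> (\<Psi> b) i = b i" unfolding \<Phi>_def using i yx[OF OR_apply_in[OF b i]] by simp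
      qed
    qed
  qed (use \<Phi> \<Psi> in auto)
  moreover have "\<Phi> (a \<odot>[n] b) = \<Phi> a \<odot>[k] \<Phi> b"
    if "a \<in> local_monoid n e" "b \<in> local_monoid n e" for a b
  proof (rule extensionalityI[of _ "{1..k}"])
    fix i assume i: "i \<in> {1..k}"
    have 1: "(a \<odot>[n] b) (x i) = b (a (x i))" by (rule mult_OR_apply[OF xn[OF i]])
    have 2: "(\<Phi> a \<odot>[k] \<Phi> b) i = \<Phi> b (\<Phi> a i)" by (rule mult_OR_apply[OF i])
    have 3: "\<Phi> a i = y (a (x i))" unfolding \<Phi>_def using i by simp
    have 4: "\<Phi> b (y (a (x i))) = y (b (x (y (a (x i)))))" unfolding \<Phi>_def using yk by simp
    have 5: "\<Phi> (a \<odot>[n] b) i = y ((a \<odot>[n] b) (x i))" unfolding \<Phi>_def using i by simp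
    show "\<Phi> (a \<odot>[n] b) i = (\<Phi> a \<odot>[k] \<Phi> b) i"
      unfolding 5 1 2 3 4 xy[OF aX(1)[OF that(1) xn[OF i]]] ..
  qed (unfold \<Phi>_def OR_def, simp_all)
  moreover have "\<Phi> e = \<one>\<^bsub>OR k\<^esub>"
  proof (rule extensionalityI[of _ "{1..k}"])
    fix i assume i: "i \<in> {1..k}"
    have "\<Phi> e i = y (e (x i))" unfolding \<Phi>_def using i by simp
    then show "\<Phi> e i = \<one>\<^bsub>OR k\<^esub> i"
      unfolding eX[OF xX[OF i]] yx[OF i] one_OR_apply[OF i] .
  qed (unfold \<Phi>_def OR_def, simp_all)
  ultimately have "local_iso n e k \<Phi>" unfolding local_iso_def by (intro conjI ballI)
  then show ?thesis by blast
qed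

lemma finite_OR: "finite (carrier (OR n))"
proof -
  have "carrier (OR n) \<subseteq> {1..n} \<rightarrow>\<^sub>E {1..n}" unfolding OR_def by auto
  then show ?thesis by (rule finite_subset) (simp add: finite_PiE)
qed

section \<open>The group of units\<close>

definition units :: "nat \<Rightarrow> (nat \<Rightarrow> nat) set" where
  "units n = {a \<in> carrier (OR n). inj_on a {1..n}}"

lemma unitsE:
  assumes "n > 0" "u \<in> units n"
  obtains s c where "s \<in> {1, -1}" "c \<in> {0..<int n}" "u = dih n s c"
  using OR_inj_dih[OF assms(1)] assms(2) unfolding units_def by blast

lemma dih_in_units [simp]: "n > 0 \<Longrightarrow> s \<in> {1, -1} \<Longrightarrow> dih n s c \<in> units n"
  unfolding units_def using inj_on_dih[of n s c] by simp

lemma units_OR: "u \<in> units n \<Longrightarrow> u \<in> carrier (OR n)"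
  unfolding units_def by simp

lemma units_eq:
  assumes "n > 0" shows "units n = (\<lambda>(s, c). dih n s c) ` ({1, -1} \<times> {0..<int n})"
proof (intro equalityI subsetI)
  fix u assume "u \<in> units n"
  then show "u \<in> (\<lambda>(s, c). dih n s c) ` ({1, -1} \<times> {0..<int n})"
    by (rule unitsE[OF assms]) (auto intro!: image_eqI)
qed (use assms in auto)

lemma finite_units: "finite (units n)"
  by (rule finite_subset[OF _ finite_OR]) (auto simp: units_def)

lemma card_units_le: "n > 0 \<Longrightarrow> card (units n) \<le> 2 * n"
  unfolding units_eq by (rule order_trans[OF card_image_le]) (auto simp: card_cartesian_product)

lemma inj_on_dih_params:
  assumes "n \<ge> 3" shows "inj_on (\<lambda>(s, c). dih n s c) ({1, -1} \<times> {0..<int n})"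
proof (rule inj_onI, clarsimp split del: if_split)
  fix s c t d assume *: "s = 1 \<or> s = -1" "0 \<le> c" "c < int n" "t = 1 \<or> t = -1" "0 \<le> d" "d < int n"
    "dih n s c = dih n t d"
  then have "s = t" "int n dvd c - d" using dih_eq_iff[OF assms, of s t c d] by auto
  moreover from this(2) have "c mod int n = d mod int n" by (simp add: mod_eq_dvd_iff)
  ultimately show "s = t \<and> c = d" using * by simp
qed

lemma card_units: "n \<ge> 3 \<Longrightarrow> card (units n) = 2 * n"
  by (subst units_eq) (auto simp: card_image inj_on_dih_params card_cartesian_product)

text \<open>An injective first factor permutes the finite set \<open>{1..n}\<close>, so the second
  factor is tested on every point. Thus the singular maps form an ideal, which is why a map that is
  constant on them can be multiplicative.\<close>

lemma mult_in_units_iff: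
  assumes "n > 0" "a \<in> carrier (OR n)" "b \<in> carrier (OR n)"
  shows "a \<odot>[n] b \<in> units n \<longleftrightarrow> a \<in> units n \<and> b \<in> units n"
proof -
  have ab: "a \<odot>[n] b \<in> carrier (OR n)" by (rule mult_in_OR[OF assms])
  have "inj_on (a \<odot>[n] b) {1..n} \<longleftrightarrow> inj_on (b \<circ> a) {1..n}" by (intro inj_on_cong) simp
  also have "\<dots> \<longleftrightarrow> inj_on a {1..n} \<and> inj_on b (a ` {1..n})"
    by (metis comp_inj_on_iff inj_on_imageI2)
  also have "\<dots> \<longleftrightarrow> inj_on a {1..n} \<and> inj_on b {1..n}"
  proof (rule conj_cong[OF refl])
    assume "inj_on a {1..n}"
    moreover have "a ` {1..n} \<subseteq> {1..n}" using OR_apply_in[OF assms(2)] by blast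
    ultimately have "a ` {1..n} = {1..n}" by (intro endo_inj_surj) simp_all
    then show "inj_on b (a ` {1..n}) \<longleftrightarrow> inj_on b {1..n}" by simp
  qed
  finally show ?thesis using ab assms unfolding units_def by simp
qed

lemma one_in_units [simp]: "n > 0 \<Longrightarrow> \<one>\<^bsub>OR n\<^esub> \<in> units n"
  using dih_in_units[of n 1 0] dih_one[of n] by simp

lemma units_inverse:
  assumes "n > 0" "u \<in> units n"
  obtains v where "v \<in> units n" "u \<odot>[n] v = \<one>\<^bsub>OR n\<^esub>" "v \<odot>[n] u = \<one>\<^bsub>OR n\<^esub>"
proof -
  obtain s c where s: "s \<in> {1, -1}" and u: "u = dih n s c" using unitsE[OF assms] by metis
  have "s * s = 1" using s by auto
  then show thesis using assms(1) s
    by (intro that[of "dih n s (- s * c)"]) (simp_all add: u dih_mult dih_one mult.assoc[symmetric])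
qed

lemma cst_not_unit: "n \<ge> 2 \<Longrightarrow> cst n p \<notin> units n"
proof
  assume n: "n \<ge> 2" and "cst n p \<in> units n"
  then have "inj_on (cst n p) {1..n}" by (simp add: units_def)
  then have "(1::nat) = 2" by (rule inj_onD) (use n in simp_all)
  then show False by simp
qed

lemma right_inverse_unit:
  assumes "n > 0" "a \<in> carrier (OR n)" "b \<in> carrier (OR n)" "a \<odot>[n] b = \<one>\<^bsub>OR n\<^esub>"
  shows "a \<in> units n"
  using mult_in_units_iff[OF assms(1-3)] assms(1,4) by simp

subsection \<open>Endomorphisms that identify units\<close>

lemma res_small:
  assumes "0 < x" "x \<le> 2 * n" shows "res n (int x) = (if x \<le> n then x else x - n)"
proof -
  have n: "n > 0" using assms by (cases n) auto
  show ?thesis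
  proof (cases "x \<le> n")
    case True then show ?thesis using assms by simp
  next
    case False
    then have "res n (int x) = res n (int (x - n))" using n by (simp add: res_eq_iff of_nat_diff)
    also have "\<dots> = x - n" using False assms by (intro res_int) auto
    finally show ?thesis using False by simp
  qed
qed

lemma mono_in_OR:
  assumes "n > 0" "\<And>i. i \<in> {1..n} \<Longrightarrow> f i \<in> {1..n}"
    "\<And>i j. i \<in> {1..n} \<Longrightarrow> j \<in> {1..n} \<Longrightarrow> i \<le> j \<Longrightarrow> f i \<le> f j"
  shows "restrict f {1..n} \<in> carrier (OR n)"
proof (rule restrict_in_OR[OF assms(1) oriented_mono[OF assms(1,1)]])
  show "f ` {1..n} \<subseteq> {1..n}" using assms(2) by blast
  then show "f ` {1..n} \<subseteq> {1..n}" .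
  show "mono_on {1..n} f" using assms(3) by (rule mono_onI)
qed

text \<open>The quotient of two identified units is identified with the identity. If it is a
  reflection, its product with a conjugate is the rotation by two, nontrivial for n \<ge> 3. A
  rotation by \<open>n - 1\<close> is traded for its inverse, because the collapse of truncations
  needs \<open>d \<le> n - 2\<close>.\<close>

lemma endo_rotation_kernel:
  assumes "n \<ge> 3" "\<phi> \<in> hom (OR n) (OR n)" "\<not> inj_on \<phi> (units n)"
  obtains d where "1 \<le> d" "d \<le> n - 2" "\<phi> (dih n 1 (int d)) = \<phi> \<one>\<^bsub>OR n\<^esub>"
proof -
  have n: "n > 0" using assms(1) by simp
  interpret monoid "OR n" by (rule monoid_OR[OF n])
  note hm = hom_mult[OF assms(2)]
  obtain u v where uv: "u \<in> units n" "v \<in> units n" "u \<noteq> v" "\<phi> u = \<phi> v"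
    using assms(3) unfolding inj_on_def by blast
  obtain v' where v': "v' \<in> units n" "v \<odot>[n] v' = \<one>\<^bsub>OR n\<^esub>" "v' \<odot>[n] v = \<one>\<^bsub>OR n\<^esub>"
    using units_inverse[OF n uv(2)] by blast
  define w where "w = u \<odot>[n] v'"
  note c = units_OR[OF uv(1)] units_OR[OF uv(2)] units_OR[OF v'(1)]
  have "\<phi> w = \<phi> u \<odot>[n] \<phi> v'" unfolding w_def by (intro hm c)
  also have "\<dots> = \<phi> (v \<odot>[n] v')" unfolding uv(4) by (intro hm[symmetric] c)
  finally have \<phi>w: "\<phi> w = \<phi> \<one>\<^bsub>OR n\<^esub>" unfolding v'(2) .
  have w1: "w \<noteq> \<one>\<^bsub>OR n\<^esub>"
  proof
    assume "w = \<one>\<^bsub>OR n\<^esub>"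
    then have "u \<odot>[n] v' \<odot>[n] v = v" unfolding w_def using c by simp
    moreover have "u \<odot>[n] v' \<odot>[n] v = u" using c v'(3) by (simp add: m_assoc)
    ultimately show False using uv(3) by simp
  qed
  have "w \<in> units n" unfolding w_def mult_in_units_iff[OF n c(1,3)] using uv(1) v'(1) by simp
  then obtain s b where s: "s \<in> {1, -1}" and w: "w = dih n s b" using unitsE[OF n] by metis
  have "\<exists>c. \<not> int n dvd c \<and> \<phi> (dih n 1 c) = \<phi> \<one>\<^bsub>OR n\<^esub>"
  proof (cases "s = 1")
    case True
    have "\<not> int n dvd b"
    proof
      assume "int n dvd b"
      then have "dih n 1 b = dih n 1 0" by (intro dih_cong[OF n]) simp
      then show False using w w1 True dih_one[OF n] by simp
    qed
    then show ?thesis using \<phi>w w True by blast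
  next
    case False
    then have s: "s = -1" using s by simp
    let ?r = "dih n 1 1" and ?q = "dih n 1 (-1)"
    have rq: "?r \<in> carrier (OR n)" "?q \<in> carrier (OR n)" using n by simp_all
    have wc: "w \<in> carrier (OR n)" using w n s by simp
    \<comment> \<open>\<open>?q\<close> inverts \<open>?r\<close>, so this is the conjugate
      \<open>?r \<odot>[n] w \<odot>[n] ?q\<close> of the reflection, times
      \<open>w\<close>.\<close>
    have "dih n 1 2 = (?r \<odot>[n] w) \<odot>[n] (?q \<odot>[n] w)"
      unfolding w s using n by (simp add: dih_mult)
    then have "\<phi> (dih n 1 2) = (\<phi> ?r \<odot>[n] \<phi> w) \<odot>[n] (\<phi> ?q \<odot>[n] \<phi> w)"
      using rq wc by (simp add: hm)
    also have "\<dots> = \<phi> ((?r \<odot>[n] \<one>\<^bsub>OR n\<^esub>) \<odot>[n] (?q \<odot>[n] \<one>\<^bsub>OR n\<^esub>))"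
      unfolding \<phi>w using rq by (simp only: hm m_closed one_closed)
    also have "\<dots> = \<phi> (?r \<odot>[n] ?q)" using rq by simp
    also have "?r \<odot>[n] ?q = \<one>\<^bsub>OR n\<^esub>" using n by (simp add: dih_mult dih_one)
    finally have "\<phi> (dih n 1 2) = \<phi> \<one>\<^bsub>OR n\<^esub>" .
    moreover have "\<not> int n dvd 2" using assms(1) zdvd_not_zless[of 2 "int n"] by simp
    ultimately show ?thesis by blast
  qed
  then obtain c where c: "\<not> int n dvd c" "\<phi> (dih n 1 c) = \<phi> \<one>\<^bsub>OR n\<^esub>" by blast
  have cm: "0 < c mod int n" "c mod int n < int n"
  proof -
    have "c mod int n \<noteq> 0" "0 \<le> c mod int n" using c(1) n by (simp_all add: dvd_eq_mod_eq_0)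
    then show "0 < c mod int n" by linarith
    show "c mod int n < int n" using n by simp
  qed
  show thesis
  proof (cases "c mod int n \<le> int n - 2")
    case True
    have "dih n 1 (int (nat (c mod int n))) = dih n 1 c"
    proof (rule dih_cong[OF n])
      have "int n dvd c - c mod int n" by (rule dvd_minus_mod)
      moreover have "int (nat (c mod int n)) = c mod int n" using cm by simp
      ultimately show "int n dvd int (nat (c mod int n)) - c" by (simp only: dvd_diff_commute)
    qed
    then show thesis using c(2) cm True by (intro that[of "nat (c mod int n)"]) auto
  next
    case False
    then have m: "c mod int n = int n - 1" using cm by simp
    have "dih n 1 (int 1) = dih n 1 (- c)"
    proof (rule dih_cong[OF n])
      have "int n dvd c - c mod int n" by (rule dvd_minus_mod)
      then have "int n dvd (c - (int n - 1)) + int n" unfolding m by (intro dvd_add) simp_all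
      then show "int n dvd int 1 - - c" by (simp add: add.commute)
    qed
    have inC: "dih n 1 c \<in> carrier (OR n)" "dih n 1 (- c) \<in> carrier (OR n)" using n by simp_all
    have "\<phi> (dih n 1 (- c)) = \<phi> (dih n 1 (- c) \<odot>[n] \<one>\<^bsub>OR n\<^esub>)" using inC by simp
    also have "\<dots> = \<phi> (dih n 1 (- c)) \<odot>[n] \<phi> (dih n 1 c)" unfolding c(2) by (intro hm inC one_closed)
    also have "\<dots> = \<phi> (dih n 1 (- c) \<odot>[n] dih n 1 c)" by (intro hm[symmetric] inC)
    also have "dih n 1 (- c) \<odot>[n] dih n 1 c = \<one>\<^bsub>OR n\<^esub>" using n by (simp add: dih_mult dih_one)
    finally have "\<phi> (dih n 1 (int 1)) = \<phi> \<one>\<^bsub>OR n\<^esub>" unfolding \<open>dih n 1 (int 1) = dih n 1 (- c)\<close> .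
    then show thesis using assms(1) by (intro that[of 1]) auto
  qed
qed

text \<open>The truncations \<open>\<epsilon> k = min k\<close> are collapsed one rank at a time: with \<open>\<rho>\<close> a rotation in the kernel,
  \<open>\<epsilon> k\<close> and \<open>\<epsilon> k \<rho> \<epsilon> k\<close> have the same image, and the latter misses a point \<open>m\<close> of \<open>{1..k}\<close>, so
  it factors through \<open>\<epsilon> (k - 1)\<close>. Every singular map has two cyclically adjacent points with equal
  values, hence is a multiple of a conjugate of \<open>\<epsilon> (n - 1)\<close>.\<close>

lemma endo_collapse:
  assumes "n \<ge> 3" "\<phi> \<in> hom (OR n) (OR n)" "\<not> inj_on \<phi> (units n)"
    "a \<in> carrier (OR n)" "a \<notin> units n"
  shows "\<phi> a = \<phi> (cst n 1)"
proof -
  have n: "n > 0" using assms(1) by simp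
  interpret monoid "OR n" by (rule monoid_OR[OF n])
  note hm = hom_mult[OF assms(2)]
  obtain d where d: "1 \<le> d" "d \<le> n - 2" "\<phi> (dih n 1 (int d)) = \<phi> \<one>\<^bsub>OR n\<^esub>"
    using endo_rotation_kernel[OF assms(1-3)] by blast
  define z where "z = \<phi> (cst n 1)"
  have \<rho>: "dih n 1 c \<in> carrier (OR n)" for c using n by simp
  have c1: "cst n 1 \<in> carrier (OR n)" using n by simp
  have d1: "1 + d \<in> {1..n}" using d(1,2) assms(1) by auto
  have zd: "\<phi> (cst n (1 + d)) = z"
  proof -
    have "dih n 1 (int d) 1 = res n (int (1 + d))" unfolding dih_def using n by simp
    then have "dih n 1 (int d) 1 = 1 + d" using d1 by (simp only: res_int)
    then have "\<phi> (cst n (1 + d)) = \<phi> (cst n 1 \<odot>[n] dih n 1 (int d))"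
      using cst_mult[of 1 n "dih n 1 (int d)"] n by simp
    also have "\<dots> = \<phi> (cst n 1) \<odot>[n] \<phi> \<one>\<^bsub>OR n\<^esub>" using hm[OF c1 \<rho>] d(3) by simp
    also have "\<dots> = \<phi> (cst n 1 \<odot>[n] \<one>\<^bsub>OR n\<^esub>)" by (rule hm[symmetric]) (use c1 in simp_all)
    finally show ?thesis unfolding z_def using c1 by simp
  qed
  have zc: "\<phi> (cst n p) = z" if p: "p \<in> {1..n}" for p
  proof -
    \<comment> \<open>It fixes 1 and sends \<open>1 + d\<close> to \<open>p\<close>, so it carries
      the identification of the constants 1 and \<open>1 + d\<close> to that of 1 and
      \<open>p\<close>.\<close>
    define x where "x = restrict (\<lambda>i. if i = 1 then 1 else p) {1..n}"
    have x: "x \<in> carrier (OR n)" unfolding x_def using p by (intro mono_in_OR) auto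
    have "\<phi> (cst n p) = \<phi> (cst n (1 + d) \<odot>[n] x)"
      using cst_mult[OF d1 x] d1 d(1) by (simp add: x_def)
    also have "\<dots> = \<phi> (cst n 1 \<odot>[n] x)" using hm[OF _ x] c1 cst_in_OR[OF d1] zd z_def by simp
    also have "cst n 1 \<odot>[n] x = cst n 1" using cst_mult[of 1 n x] x n by (simp add: x_def)
    finally show ?thesis unfolding z_def .
  qed
  \<comment> \<open>The maps sent to \<open>z\<close> form a two-sided ideal: \<open>b\<close> may
    be replaced by a constant, and products with constants are constants.\<close>
  have zl: "\<phi> (b \<odot>[n] x) = z" if "\<phi> b = z" "b \<in> carrier (OR n)" "x \<in> carrier (OR n)" for b x
  proof -
    have "\<phi> (b \<odot>[n] x) = \<phi> (cst n 1 \<odot>[n] x)" using hm that c1 z_def by simp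
    also have "cst n 1 \<odot>[n] x = cst n (x 1)" using that n by (intro cst_mult) auto
    finally show ?thesis using zc OR_apply_in[OF that(3), of 1] n by simp
  qed
  have zr: "\<phi> (x \<odot>[n] b) = z" if "\<phi> b = z" "b \<in> carrier (OR n)" "x \<in> carrier (OR n)" for b x
  proof -
    have "\<phi> (x \<odot>[n] b) = \<phi> (x \<odot>[n] cst n 1)" using hm that c1 z_def by simp
    also have "x \<odot>[n] cst n 1 = cst n 1" using that n by (intro mult_cst) auto
    finally show ?thesis unfolding z_def .
  qed
  define \<epsilon> where "\<epsilon> k = restrict (\<lambda>i. min i k) {1..n}" for k
  have \<epsilon>: "\<epsilon> k \<in> carrier (OR n)" if "k \<ge> 1" for k
    unfolding \<epsilon>_def using n that by (intro mono_in_OR) auto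
  have "k + 1 \<le> n - 1 \<longrightarrow> \<phi> (\<epsilon> (k + 1)) = z" for k
  proof (induction k)
    case 0
    have "\<epsilon> 1 = cst n 1" unfolding \<epsilon>_def cst_def by (rule restrict_ext) auto
    then show ?case using z_def by simp
  next
    case (Suc k)
    show ?case
    proof
      assume "Suc k + 1 \<le> n - 1"
      define K where "K = Suc k + 1"
      have K: "2 \<le> K" "K \<le> n - 1" unfolding K_def using \<open>Suc k + 1 \<le> n - 1\<close> by auto
      have IH: "\<phi> (\<epsilon> (K - 1)) = z" using Suc K(2) unfolding K_def by simp
      have \<epsilon>K: "\<epsilon> K \<in> carrier (OR n)" "\<epsilon> (K - 1) \<in> carrier (OR n)" using K \<epsilon> by auto
      define \<beta> where "\<beta> = \<epsilon> K \<odot>[n] dih n 1 (int d) \<odot>[n] \<epsilon> K"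
      have \<beta>: "\<beta> \<in> carrier (OR n)" unfolding \<beta>_def using \<epsilon>K \<rho> by simp
      have "\<phi> \<beta> = \<phi> (\<epsilon> K) \<odot>[n] \<phi> \<one>\<^bsub>OR n\<^esub> \<odot>[n] \<phi> (\<epsilon> K)"
        unfolding \<beta>_def using \<epsilon>K(1) \<rho> d(3) by (simp add: hm)
      also have "\<dots> = \<phi> (\<epsilon> K \<odot>[n] \<one>\<^bsub>OR n\<^esub> \<odot>[n] \<epsilon> K)"
        using \<epsilon>K(1) by (simp only: hm m_closed one_closed)
      also have "\<epsilon> K \<odot>[n] \<one>\<^bsub>OR n\<^esub> \<odot>[n] \<epsilon> K = \<epsilon> K"
      proof (rule OR_eqI[of _ n])
        fix i assume i: "i \<in> {1..n}"
        then have "\<epsilon> K i = min i K" "min i K \<in> {1..n}" using K unfolding \<epsilon>_def by auto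
        then show "(\<epsilon> K \<odot>[n] \<one>\<^bsub>OR n\<^esub> \<odot>[n] \<epsilon> K) i = \<epsilon> K i"
          using \<epsilon>K(1) i by (simp add: \<epsilon>_def)
      qed (use \<epsilon>K in simp_all)
      finally have \<phi>\<beta>: "\<phi> \<beta> = \<phi> (\<epsilon> K)" .
      \<comment> \<open>A point of \<open>{1..K}\<close> missed by \<open>\<beta>\<close>: the
        rotated interval from \<open>1 + d\<close> to \<open>K + d\<close> misses 1 if it does not
        wrap past \<open>n\<close>, and otherwise the point after its wrapped end. In these cases
        \<open>m < K\<close> by \<open>2 \<le> K\<close> and by \<open>d \<le> n - 2\<close>, so
        truncation at \<open>K\<close> does not produce \<open>m\<close> either.\<close>
      define m where "m = (if K + d \<le> n then 1 else K + d - n + 1)"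
      \<comment> \<open>\<open>u\<close> closes the gap at \<open>m\<close> and \<open>v\<close>
        opens it again; in between all values are at most \<open>K - 1\<close>, where truncation
        changes nothing.\<close>
      define u where "u = restrict (\<lambda>i. if i < m then i else max 1 (i - 1)) {1..n}"
      define v where "v = restrict (\<lambda>i. if i < m then i else min n (i + 1)) {1..n}"
      have u: "u \<in> carrier (OR n)" unfolding u_def using n by (intro mono_in_OR) auto
      have v: "v \<in> carrier (OR n)" unfolding v_def using n by (intro mono_in_OR) auto
      have "\<beta> = \<beta> \<odot>[n] (u \<odot>[n] (\<epsilon> (K - 1) \<odot>[n] v))"
      proof (rule OR_eqI[of _ n])
        fix i assume i: "i \<in> {1..n}"
        define j where "j = min i K"
        have j: "1 \<le> j" "j \<le> K" "j \<in> {1..n}" unfolding j_def using i K by auto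
        define q where "q = (if j + d \<le> n then j + d else j + d - n)"
        have q: "q \<in> {1..n}" unfolding q_def using j d K by auto
        have "dih n 1 (int d) j = res n (int (j + d))" unfolding dih_def using j(3) by simp
        also have "\<dots> = q" unfolding q_def using j d K by (intro res_small) auto
        finally have dj: "dih n 1 (int d) j = q" .
        have "\<beta> i = \<epsilon> K (dih n 1 (int d) (\<epsilon> K i))" unfolding \<beta>_def using i by simp
        also have "\<epsilon> K i = j" unfolding \<epsilon>_def j_def using i by simp
        also have "\<epsilon> K (dih n 1 (int d) j) = min q K" unfolding dj using q by (simp add: \<epsilon>_def)
        finally have \<beta>i: "\<beta> i = min q K" .
        have mq: "min q K \<noteq> m" unfolding q_def m_def using j d K by (auto simp: min_def)
        have mK: "m \<le> K" unfolding m_def using d K by auto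
        define b where "b = min q K"
        have b: "1 \<le> b" "b \<le> K" "b \<noteq> m" "b \<in> {1..n}" unfolding b_def using mq q K by auto
        define b' where "b' = (if b < m then b else b - 1)"
        have b': "u b = b'" "b' \<in> {1..n}" "b' \<le> K - 1" "(if b' < m then b' else b' + 1) = b" "b' + 1 \<le> n"
          unfolding u_def b'_def using b mK K by (auto simp: m_def split: if_splits)
        have "\<epsilon> (K - 1) b' = b'" unfolding \<epsilon>_def using b' by simp
        moreover have "v b' = b" unfolding v_def using b' by (auto split: if_splits)
        ultimately have "v (\<epsilon> (K - 1) (u b)) = b" using b'(1) by simp
        then show "\<beta> i = (\<beta> \<odot>[n] (u \<odot>[n] (\<epsilon> (K - 1) \<odot>[n] v))) i"
          using i b b' \<beta>i by (simp add: b_def[symmetric])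
      qed (use \<beta> u v \<epsilon>K in simp_all)
      moreover have "\<phi> (\<beta> \<odot>[n] (u \<odot>[n] (\<epsilon> (K - 1) \<odot>[n] v))) = z"
        using IH \<epsilon>K(2) u v \<beta> by (intro zr zl m_closed) simp_all
      ultimately show "\<phi> (\<epsilon> (Suc k + 1)) = z" using \<phi>\<beta> K_def by simp
    qed
  qed
  from this[of "n - 2"] have \<epsilon>z: "\<phi> (\<epsilon> (n - 1)) = z" using assms(1) by (simp add: numeral_2_eq_2 Suc_diff_Suc)
  have "\<not> inj_on a {1..n}" using assms(4,5) by (simp add: units_def)
  then obtain x where x: "a (res n x) = a (res n (x + 1))" by (rule OR_not_inj_adjacent[OF n assms(4)])
  \<comment> \<open>This rotation moves \<open>n - 1\<close> and \<open>n\<close> to the neighbours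
    \<open>x\<close> and \<open>x + 1\<close> at which \<open>a\<close> agrees.\<close>
  define c where "c = x - (int n - 1)"
  define a' where "a' = dih n 1 c \<odot>[n] a"
  have a': "a' \<in> carrier (OR n)" unfolding a'_def using \<rho> assms(4) by simp
  have "a' (res n (int n - 1)) = a (res n x)" "a' (res n (int n)) = a (res n (x + 1))"
    unfolding a'_def using n by (simp_all add: c_def del: res_int)
  moreover have "res n (int (n - 1)) = n - 1" "res n (int n) = n" using assms(1) by (intro res_int; simp)+
  ultimately have a'n: "a' (n - 1) = a' n" using x assms(1) by (simp add: of_nat_diff)
  have "\<epsilon> (n - 1) \<odot>[n] a' = a'"
  proof (rule OR_eqI[of _ n])
    fix i assume i: "i \<in> {1..n}"
    then have "min i (n - 1) = (if i = n then n - 1 else i)" by auto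
    then show "(\<epsilon> (n - 1) \<odot>[n] a') i = a' i" using i a'n by (simp add: \<epsilon>_def)
  qed (use a' \<epsilon> assms(1) in simp_all)
  moreover have "dih n 1 (- c) \<odot>[n] a' = a"
  proof -
    have "dih n 1 (- c) \<odot>[n] dih n 1 c = \<one>\<^bsub>OR n\<^esub>" using n by (simp add: dih_mult dih_one)
    then show ?thesis unfolding a'_def using assms(4) \<rho> by (simp add: m_assoc[symmetric])
  qed
  ultimately have "a = dih n 1 (- c) \<odot>[n] (\<epsilon> (n - 1) \<odot>[n] a')" by simp
  moreover have "\<phi> (dih n 1 (- c) \<odot>[n] (\<epsilon> (n - 1) \<odot>[n] a')) = z"
    using assms(1) \<epsilon>z \<epsilon> a' \<rho> by (intro zr zl m_closed) simp_all
  ultimately show ?thesis using z_def by simp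
qed

subsection \<open>Endomorphisms that are injective on units\<close>

lemma endo_one_idempotent:
  assumes "n > 0" "\<phi> \<in> hom (OR n) (OR n)"
  shows "\<phi> \<one>\<^bsub>OR n\<^esub> \<in> carrier (OR n)" "\<phi> \<one>\<^bsub>OR n\<^esub> \<odot>[n] \<phi> \<one>\<^bsub>OR n\<^esub> = \<phi> \<one>\<^bsub>OR n\<^esub>"
proof -
  interpret monoid "OR n" by (rule monoid_OR[OF assms(1)])
  show "\<phi> \<one>\<^bsub>OR n\<^esub> \<in> carrier (OR n)" using hom_in_carrier[OF assms(2)] by simp
  show "\<phi> \<one>\<^bsub>OR n\<^esub> \<odot>[n] \<phi> \<one>\<^bsub>OR n\<^esub> = \<phi> \<one>\<^bsub>OR n\<^esub>"
    using hom_mult[OF assms(2) one_closed one_closed] by simp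
qed

lemma endo_local:
  assumes "n > 0" "\<phi> \<in> hom (OR n) (OR n)" "a \<in> carrier (OR n)"
  shows "\<phi> a \<in> local_monoid n (\<phi> \<one>\<^bsub>OR n\<^esub>)"
proof -
  interpret monoid "OR n" by (rule monoid_OR[OF assms(1)])
  show ?thesis unfolding local_monoid_def
    using hom_in_carrier[OF assms(2,3)] hom_mult[OF assms(2) one_closed assms(3)]
      hom_mult[OF assms(2) assms(3) one_closed] assms(3) by simp
qed

lemma endo_unit_local_unit:
  assumes "n > 0" "\<phi> \<in> hom (OR n) (OR n)" "u \<in> units n" "k > 0" "local_iso n (\<phi> \<one>\<^bsub>OR n\<^esub>) k \<Phi>"
  shows "\<Phi> (\<phi> u) \<in> units k"
proof -
  obtain v where v: "v \<in> units n" "u \<odot>[n] v = \<one>\<^bsub>OR n\<^esub>" using units_inverse[OF assms(1,3)] by blast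
  note c = units_OR[OF assms(3)] units_OR[OF v(1)]
  note l = endo_local[OF assms(1,2) c(1)] endo_local[OF assms(1,2) c(2)]
  have "\<Phi> (\<phi> u) \<odot>[k] \<Phi> (\<phi> v) = \<one>\<^bsub>OR k\<^esub>"
    using local_iso_mult[OF assms(5) l] hom_mult[OF assms(2) c] v(2) local_iso_one[OF assms(5)] by simp
  then show ?thesis
    by (rule right_inverse_unit[OF assms(4) local_iso_in[OF assms(5) l(1)] local_iso_in[OF assms(5) l(2)]])
qed

lemma card_image_OR:
  assumes "n > 0" "e \<in> carrier (OR n)"
  shows "card (e ` {1..n}) \<in> {1..n}"
proof -
  have "card (e ` {1..n}) \<le> card {1..n}" by (rule card_image_le) simp
  moreover have "card (e ` {1..n}) > 0" using assms(1) by (simp add: card_gt_0_iff)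
  ultimately show ?thesis by simp
qed

lemma endo_inj_units_one:
  assumes "n \<ge> 3" "\<phi> \<in> hom (OR n) (OR n)" "inj_on \<phi> (units n)"
  shows "\<phi> \<one>\<^bsub>OR n\<^esub> = \<one>\<^bsub>OR n\<^esub>"
proof -
  have n: "n > 0" using assms(1) by simp
  interpret monoid "OR n" by (rule monoid_OR[OF n])
  let ?e = "\<phi> \<one>\<^bsub>OR n\<^esub>"
  note e = endo_one_idempotent[OF n assms(2)]
  define k where "k = card (?e ` {1..n})"
  have k: "k \<in> {1..n}" unfolding k_def by (rule card_image_OR[OF n e(1)])
  obtain \<Phi> where \<Phi>: "local_iso n ?e k \<Phi>" using local_iso_exists[OF n e] unfolding k_def by blast
  have "(\<Phi> \<circ> \<phi>) ` units n \<subseteq> units k"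
  proof (rule image_subsetI)
    fix u assume "u \<in> units n"
    moreover have "k > 0" using k by simp
    ultimately have "\<Phi> (\<phi> u) \<in> units k" by (rule endo_unit_local_unit[OF n assms(2) _ _ \<Phi>])
    then show "(\<Phi> \<circ> \<phi>) u \<in> units k" by simp
  qed
  moreover have "inj_on (\<Phi> \<circ> \<phi>) (units n)"
  proof (rule comp_inj_on[OF assms(3)])
    have "\<phi> ` units n \<subseteq> local_monoid n ?e" using endo_local[OF n assms(2)] units_OR by blast
    then show "inj_on \<Phi> (\<phi> ` units n)" by (rule inj_on_subset[OF local_iso_inj[OF \<Phi>]])
  qed
  ultimately have "card (units n) \<le> card (units k)" by (intro card_inj_on_le[OF _ _ finite_units])
  then have "2 * n \<le> 2 * k" using card_units[OF assms(1)] card_units_le[of k] k by simp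
  then have "card (?e ` {1..n}) = card {1..n}" using k k_def by simp
  moreover have "?e ` {1..n} \<subseteq> {1..n}" using OR_apply_in[OF e(1)] by blast
  ultimately have im: "?e ` {1..n} = {1..n}" by (intro card_subset_eq) simp_all
  show ?thesis
  proof (rule OR_eqI[OF e(1) one_closed])
    fix i assume i: "i \<in> {1..n}"
    then have "?e i = i" by (intro idempotent_fix[OF e(2)]) (simp only: im)
    then show "?e i = \<one>\<^bsub>OR n\<^esub> i" using i by simp
  qed
qed

lemma res_const:
  assumes "n > 0" "\<And>y. x (res n (y + 1)) = x (res n y)" "i \<in> {1..n}"
  shows "x i = x 1"
proof -
  have "x (res n (1 + int j)) = x (res n 1)" for j
  proof (induction j)
    case (Suc j)
    then show ?case using assms(2)[of "1 + int j"] by (simp add: algebra_simps)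
  qed simp
  from this[of "i - 1"] have "x (res n (int i)) = x (res n 1)" using assms(3) by (simp add: of_nat_diff)
  moreover have "res n 1 = 1" using res_int[of 1 n] assms(1) by simp
  ultimately show ?thesis using assms(3) by simp
qed

text \<open>The action on constants defines a point map \<open>\<pi>\<close> with
  \<open>\<pi> (a i) = \<phi> a (\<pi> i)\<close>. The image of the rotation by one makes
  \<open>\<pi>\<close> affine with slope \<open>t\<close>. The image of the idempotent that only
  moves 2 to 1 can be oriented only if \<open>\<pi> 1\<close> and \<open>\<pi> 2\<close> are
  neighbours, so \<open>t\<close> is 1 or -1 modulo \<open>n\<close> and \<open>\<pi>\<close> is
  itself dihedral.\<close>

lemma endo_inj_units_conj:
  assumes "n \<ge> 3" "\<phi> \<in> hom (OR n) (OR n)" "inj_on \<phi> (units n)"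
  obtains s c where "s \<in> {1, -1}" "c \<in> {0..<int n}"
    "\<And>a. a \<in> carrier (OR n) \<Longrightarrow> \<phi> a = dih n s (- s * c) \<odot>[n] a \<odot>[n] dih n s c"
proof -
  have n: "n > 0" using assms(1) by simp
  interpret monoid "OR n" by (rule monoid_OR[OF n])
  note hm = hom_mult[OF assms(2)] and hc = hom_in_carrier[OF assms(2)]
  have one: "\<phi> \<one>\<^bsub>OR n\<^esub> = \<one>\<^bsub>OR n\<^esub>" by (rule endo_inj_units_one[OF assms])
  have \<phi>U: "\<phi> u \<in> units n" if u: "u \<in> units n" for u
  proof -
    obtain v where v: "v \<in> units n" "u \<odot>[n] v = \<one>\<^bsub>OR n\<^esub>" using units_inverse[OF n u] by blast
    then have "\<phi> u \<odot>[n] \<phi> v = \<one>\<^bsub>OR n\<^esub>" using hm[OF units_OR[OF u] units_OR[OF v(1)]] one by simp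
    then show ?thesis by (rule right_inverse_unit[OF n hc[OF units_OR[OF u]] hc[OF units_OR[OF v(1)]]])
  qed
  have surj: "\<phi> ` units n = units n"
    using \<phi>U by (intro endo_inj_surj[OF finite_units _ assms(3)]) blast
  let ?r = "dih n 1 1"
  have r: "?r \<in> units n" "?r \<in> carrier (OR n)" using n by simp_all
  \<comment> \<open>Since \<open>w \<odot>[n] cst n i = cst n i\<close>, the image of each constant
    is invariant under the rotation by one and is therefore constant.\<close>
  obtain w where w: "w \<in> units n" "\<phi> w = ?r" using r(1) surj by (metis imageE)
  define \<pi> where "\<pi> i = \<phi> (cst n i) 1" for i
  have \<phi>cst: "\<phi> (cst n i) = cst n (\<pi> i)" "\<pi> i \<in> {1..n}" if i: "i \<in> {1..n}" for i
  proof -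
    have c: "\<phi> (cst n i) \<in> carrier (OR n)" using hc i by simp
    show "\<pi> i \<in> {1..n}" unfolding \<pi>_def using OR_apply_in[OF c, of 1] n by simp
    have "w \<odot>[n] cst n i = cst n i" by (rule mult_cst[OF i units_OR[OF w(1)]])
    then have "?r \<odot>[n] \<phi> (cst n i) = \<phi> (cst n i)"
      using hm[OF units_OR[OF w(1)] cst_in_OR[OF i]] w(2) by simp
    then have "(?r \<odot>[n] \<phi> (cst n i)) (res n y) = \<phi> (cst n i) (res n y)" for y by (simp only:)
    then have *: "\<phi> (cst n i) (res n (y + 1)) = \<phi> (cst n i) (res n y)" for y using n by simp
    show "\<phi> (cst n i) = cst n (\<pi> i)"
    proof (rule OR_eqI[OF c])
      show "cst n (\<pi> i) \<in> carrier (OR n)" using \<open>\<pi> i \<in> {1..n}\<close> by simp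
      show "\<phi> (cst n i) j = cst n (\<pi> i) j" if "j \<in> {1..n}" for j
        using res_const[where x = "\<phi> (cst n i)", OF n * that] that unfolding \<pi>_def by simp
    qed
  qed
  have \<pi>_act: "\<pi> (a i) = \<phi> a (\<pi> i)" if "i \<in> {1..n}" "a \<in> carrier (OR n)" for a i
  proof -
    have ai: "a i \<in> {1..n}" by (rule OR_apply_in[OF that(2,1)])
    have "cst n (\<pi> (a i)) = \<phi> (cst n i \<odot>[n] a)" unfolding cst_mult[OF that] by (rule \<phi>cst(1)[OF ai, symmetric])
    also have "\<dots> = cst n (\<pi> i) \<odot>[n] \<phi> a" using hm[OF cst_in_OR[OF that(1)] that(2)] \<phi>cst(1)[OF that(1)] by simp
    also have "\<dots> = cst n (\<phi> a (\<pi> i))" by (rule cst_mult[OF \<phi>cst(2)[OF that(1)] hc[OF that(2)]])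
    finally have "cst n (\<pi> (a i)) 1 = cst n (\<phi> a (\<pi> i)) 1" by simp
    then show ?thesis using n by simp
  qed
  obtain s t where s: "s \<in> {1, -1}" and t: "\<phi> ?r = dih n s t" using unitsE[OF n \<phi>U[OF r(1)]] by metis
  \<comment> \<open>If the rotation by one went to a reflection, its square would go to the
    identity, whereas the rotation by two is not the identity and \<open>\<phi>\<close> is injective
    on units.\<close>
  have "s = 1"
  proof (rule ccontr)
    assume "s \<noteq> 1"
    then have "\<phi> ?r \<odot>[n] \<phi> ?r = \<one>\<^bsub>OR n\<^esub>" unfolding t using s n by (auto simp: dih_mult dih_one)
    then have "\<phi> (?r \<odot>[n] ?r) = \<phi> \<one>\<^bsub>OR n\<^esub>" using hm[OF r(2) r(2)] one by simp
    moreover have "?r \<odot>[n] ?r \<in> units n" using n by (simp add: dih_mult)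
    ultimately have "?r \<odot>[n] ?r = \<one>\<^bsub>OR n\<^esub>"
      using one_in_units[OF n] by (rule inj_onD[OF assms(3)])
    then have "dih n 1 2 = dih n 1 0" using n by (simp add: dih_mult dih_one)
    then have "int n dvd 2" using dih_eq_iff[OF assms(1), of 1 1 2 0] by simp
    then show False using assms(1) zdvd_not_zless[of 2 "int n"] by simp
  qed
  have \<pi>_step: "\<pi> (res n (y + 1)) = res n (int (\<pi> (res n y)) + t)" for y
  proof -
    have p: "\<pi> (res n y) \<in> {1..n}" by (rule \<phi>cst(2)[OF res_in[OF n]])
    have "\<pi> (?r (res n y)) = dih n 1 t (\<pi> (res n y))"
      using \<pi>_act[OF res_in[OF n] r(2)] t \<open>s = 1\<close> by simp
    also have "\<dots> = dih n 1 t (res n (int (\<pi> (res n y))))" using p by simp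
    finally show ?thesis using n by (simp del: res_int)
  qed
  have \<pi>_nat: "\<pi> (res n (1 + int j)) = res n (int (\<pi> 1) + t * int j)" for j
  proof (induction j)
    case 0
    have "res n 1 = 1" using res_int[of 1 n] n by simp
    then show ?case using \<phi>cst(2)[of 1] n by simp
  next
    case (Suc j)
    have "\<pi> (res n (1 + int (Suc j))) = res n (int (res n (int (\<pi> 1) + t * int j)) + t)"
      using \<pi>_step[of "1 + int j"] Suc by (simp add: algebra_simps)
    also have "\<dots> = res n (int (\<pi> 1) + t * int (Suc j))"
    proof (subst res_eq_iff[OF n])
      show "int n dvd int (res n (int (\<pi> 1) + t * int j)) + t - (int (\<pi> 1) + t * int (Suc j))"
        using res_cong[OF n, of "int (\<pi> 1) + t * int j"] by (simp add: algebra_simps)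
    qed
    finally show ?case .
  qed
  have \<pi>_eq: "\<pi> i = res n (int (\<pi> 1) + t * (int i - 1))" if "i \<in> {1..n}" for i
  proof -
    have "1 + int (i - 1) = int i" using that by (simp add: of_nat_diff)
    then show ?thesis using \<pi>_nat[of "i - 1"] that by (simp add: of_nat_diff)
  qed
  have \<pi>_surj: "\<pi> ` {1..n} = {1..n}"
  proof
    show "\<pi> ` {1..n} \<subseteq> {1..n}" using \<phi>cst(2) by blast
    \<comment> \<open>The image of \<open>\<pi>\<close> is closed under the rotation by one, because
      \<open>\<pi> (w i) = ?r (\<pi> i)\<close>.\<close>
    have *: "\<exists>i\<in>{1..n}. \<pi> i = res n (int (\<pi> 1) + int j)" for j
    proof (induction j)
      case 0 show ?case using \<phi>cst(2)[of 1] n by (intro bexI[of _ 1]) simp_all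
    next
      case (Suc j)
      then obtain i where i: "i \<in> {1..n}" "\<pi> i = res n (int (\<pi> 1) + int j)" by blast
      have "\<pi> (w i) = ?r (\<pi> i)" using \<pi>_act[OF i(1) units_OR[OF w(1)]] w(2) by simp
      also have "\<dots> = res n (int (\<pi> 1) + int (Suc j))" using i(2) n by (simp add: algebra_simps)
      finally show ?case using OR_apply_in[OF units_OR[OF w(1)] i(1)] by blast
    qed
    show "{1..n} \<subseteq> \<pi> ` {1..n}"
    proof
      fix p assume p: "p \<in> {1..n}"
      have "\<pi> 1 \<le> n" using \<phi>cst(2)[of 1] n by simp
      then have "int (\<pi> 1) + int (p + n - \<pi> 1) = int p + int n" by (simp add: of_nat_diff)
      then show "p \<in> \<pi> ` {1..n}" using *[of "p + n - \<pi> 1"] p n by auto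
    qed
  qed
  then have \<pi>_inj: "inj_on \<pi> {1..n}" by (intro eq_card_imp_inj_on) simp_all
  define E where "E = restrict (\<lambda>i. if i = 2 then 1 else i) {1..n}"
  have E: "E \<in> carrier (OR n)" unfolding E_def by (rule mono_in_OR[OF n]) auto
  define F where "F = \<phi> E"
  have F: "F \<in> carrier (OR n)" unfolding F_def by (rule hc[OF E])
  define a where "a = \<pi> 1"
  define b where "b = \<pi> 2"
  have ab: "a \<in> {1..n}" "b \<in> {1..n}" unfolding a_def b_def using assms(1) by (intro \<phi>cst(2); simp)+
  have "a \<noteq> b" unfolding a_def b_def using inj_on_eq_iff[OF \<pi>_inj, of 1 2] assms(1) by simp
  have Fp: "F p = p" if p: "p \<in> {1..n}" "p \<noteq> b" for p
  proof -
    have "p \<in> \<pi> ` {1..n}" using p(1) \<pi>_surj by simp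
    then obtain i where i: "i \<in> {1..n}" "p = \<pi> i" by blast
    then have "i \<noteq> 2" using p(2) b_def by blast
    then have "E i = i" unfolding E_def using i by simp
    then show ?thesis using \<pi>_act[OF i(1) E] i(2) unfolding F_def by simp
  qed
  have Fb: "F b = a"
  proof -
    have "2 \<in> {1..n}" using assms(1) by simp
    from \<pi>_act[OF this E] show ?thesis using assms(1) unfolding F_def a_def b_def by (simp add: E_def)
  qed
  have Fa: "F a = a" by (rule Fp[OF ab(1) \<open>a \<noteq> b\<close>])
  define \<tau> where "\<tau> = t mod int n"
  have nt: "int n dvd t - \<tau>" unfolding \<tau>_def by (rule dvd_minus_mod)
  have b_res: "b = res n (int a + \<tau>)"
  proof -
    have "b = res n (int a + t)" using \<pi>_eq[of 2] assms(1) unfolding a_def b_def by simp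
    also have "\<dots> = res n (int a + \<tau>)" using nt by (simp add: res_eq_iff n)
    finally show ?thesis .
  qed
  have \<tau>: "0 < \<tau>" "\<tau> < int n"
  proof -
    show "\<tau> < int n" unfolding \<tau>_def using n by simp
    have "\<tau> \<noteq> 0" using b_res ab(1) \<open>a \<noteq> b\<close> by auto
    moreover have "0 \<le> \<tau>" unfolding \<tau>_def using n by simp
    ultimately show "0 < \<tau>" by simp
  qed
  have res_a: "res n (int a) = a" by (rule res_int[OF ab(1)])
  \<comment> \<open>\<open>F\<close> takes the value \<open>a\<close> only at \<open>a\<close> and
    at \<open>b\<close>, and \<open>b\<close> lies \<open>\<tau>\<close> steps after
    \<open>a\<close>.\<close>
  have bad: False if "F (res n (int a + y)) = a" "0 < y" "y < int n" "y \<noteq> \<tau>" for y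
  proof -
    have "\<not> int n dvd y" using that(2,3) zdvd_not_zless by blast
    then have "res n (int a + y) \<noteq> a" using res_eq_iff[OF n, of "int a + y" "int a"] res_a by simp
    moreover have "\<not> int n dvd y - \<tau>"
    proof
      assume "int n dvd y - \<tau>"
      then have "y mod int n = \<tau> mod int n" by (simp add: mod_eq_dvd_iff)
      then show False using that \<tau> by simp
    qed
    then have "res n (int a + y) \<noteq> b" unfolding b_res using res_eq_iff[OF n, of "int a + y" "int a + \<tau>"] by simp
    ultimately show False using Fp[OF res_in[OF n]] that(1) by metis
  qed
  \<comment> \<open>Since \<open>F a = F b\<close>, one of the arcs joining \<open>a\<close> and
    \<open>b\<close> is constant, so by \<open>bad\<close> it has no interior point.\<close>
  have "(\<forall>y\<in>{int a..int a + \<tau>}. F (res n y) = F (res n (int a))) \<or>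
      (\<forall>y\<in>{int a + \<tau>..int a + int n}. F (res n y) = F (res n (int a)))"
    using \<tau> n b_res[symmetric] Fa Fb res_a by (intro oriented_arc[OF OR_oriented[OF n F] n]) simp_all
  then have "\<tau> = 1 \<or> \<tau> = int n - 1"
  proof
    assume *: "\<forall>y\<in>{int a..int a + \<tau>}. F (res n y) = F (res n (int a))"
    have "F (res n (int a + 1)) = a" using bspec[OF *, of "int a + 1"] \<tau> res_a Fa by simp
    then show ?thesis using bad[of 1] assms(1) by fastforce
  next
    assume *: "\<forall>y\<in>{int a + \<tau>..int a + int n}. F (res n y) = F (res n (int a))"
    have "F (res n (int a + (int n - 1))) = a"
      by (subst bspec[OF *]) (use \<tau> res_a Fa in simp_all)
    then show ?thesis using bad[of "int n - 1"] assms(1) by fastforce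
  qed
  then obtain \<sigma> where \<sigma>: "\<sigma> \<in> {1, -1}" "int n dvd t - \<sigma>"
  proof
    assume "\<tau> = 1" then show thesis using nt by (intro that[of 1]) simp_all
  next
    assume *: "\<tau> = int n - 1"
    have "int n dvd (t - \<tau>) + int n" using nt by simp
    then show thesis unfolding * by (intro that[of "-1"]) simp_all
  qed
  \<comment> \<open>Chosen so that \<open>\<sigma> + c\<close> is congruent to
    \<open>\<pi> 1\<close>, and reduced to the range that parametrises the units.\<close>
  define c where "c = (int (\<pi> 1) - \<sigma>) mod int n"
  define P where "P = dih n \<sigma> c"
  have P: "P \<in> carrier (OR n)" unfolding P_def using n \<sigma>(1) by simp
  have P\<pi>: "P i = \<pi> i" if i: "i \<in> {1..n}" for i
  proof -
    have "\<sigma> * int i + c - (int (\<pi> 1) + t * (int i - 1))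
      = (c - (int (\<pi> 1) - \<sigma>)) - (t - \<sigma>) * (int i - 1)" by (simp add: algebra_simps)
    moreover have "int n dvd c - (int (\<pi> 1) - \<sigma>)"
      unfolding c_def by (subst dvd_diff_commute) (rule dvd_minus_mod)
    then have "int n dvd (c - (int (\<pi> 1) - \<sigma>)) - (t - \<sigma>) * (int i - 1)"
      using dvd_mult2[OF \<sigma>(2)] by (rule dvd_diff)
    ultimately have "res n (\<sigma> * int i + c) = \<pi> i" unfolding \<pi>_eq[OF i] res_eq_iff[OF n] by metis
    then show ?thesis unfolding P_def dih_def using i by simp
  qed
  show thesis
  proof (rule that[OF \<sigma>(1), of c])
    show "c \<in> {0..<int n}" unfolding c_def using n by simp
    fix a assume a: "a \<in> carrier (OR n)"
    let ?Q = "dih n \<sigma> (- \<sigma> * c)"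
    have Q: "?Q \<in> carrier (OR n)" using n \<sigma>(1) by simp
    have "a \<odot>[n] P = P \<odot>[n] \<phi> a"
    proof (rule OR_eqI[of _ n])
      fix i assume i: "i \<in> {1..n}"
      show "(a \<odot>[n] P) i = (P \<odot>[n] \<phi> a) i"
        using i P\<pi>[OF i] P\<pi>[OF OR_apply_in[OF a i]] \<pi>_act[OF i a] by simp
    qed (use a P hc in simp_all)
    then have "?Q \<odot>[n] a \<odot>[n] P = ?Q \<odot>[n] P \<odot>[n] \<phi> a"
      using a P Q hc[OF a] by (simp add: m_assoc)
    moreover have "?Q \<odot>[n] P = \<one>\<^bsub>OR n\<^esub>"
      unfolding P_def using n \<sigma>(1) by (auto simp: dih_mult dih_one)
    ultimately show "\<phi> a = ?Q \<odot>[n] a \<odot>[n] dih n \<sigma> c" using hc[OF a] P_def by simp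
  qed
qed

text \<open>A dihedral map of \<open>{1..k}\<close> that fixes \<open>p\<close> is the identity or
  the reflection \<open>dih k (-1) (2 * int p)\<close>; \<open>g\<close> is the preimage of the
  latter under the local isomorphism. For k \<le> 2 the two coincide.\<close>

lemma endo_units_two_values:
  assumes "n \<ge> 3" "\<phi> \<in> hom (OR n) (OR n)" "\<not> inj_on \<phi> (units n)"
  obtains g where "\<And>u. u \<in> units n \<Longrightarrow> \<phi> u \<in> {\<phi> \<one>\<^bsub>OR n\<^esub>, g}"
proof -
  have n: "n > 0" "n \<ge> 2" using assms(1) by simp_all
  interpret monoid "OR n" by (rule monoid_OR[OF n(1)])
  note hm = hom_mult[OF assms(2)] and hc = hom_in_carrier[OF assms(2)]
  let ?e = "\<phi> \<one>\<^bsub>OR n\<^esub>"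
  note e = endo_one_idempotent[OF n(1) assms(2)]
  define k where "k = card (?e ` {1..n})"
  have k: "k > 0" using card_image_OR[OF n(1) e(1)] unfolding k_def by simp
  obtain \<Phi> where \<Phi>: "local_iso n ?e k \<Phi>" using local_iso_exists[OF n(1) e] unfolding k_def by blast
  have c1: "cst n 1 \<in> carrier (OR n)" using n by simp
  define z where "z = \<Phi> (\<phi> (cst n 1))"
  have z: "z \<in> carrier (OR k)" unfolding z_def by (rule local_iso_in[OF \<Phi> endo_local[OF n(1) assms(2) c1]])
  define p where "p = z 1"
  have p: "p \<in> {1..k}" unfolding p_def using OR_apply_in[OF z, of 1] k by simp
  obtain g where g: "g \<in> local_monoid n ?e" "\<Phi> g = dih k (-1) (2 * int p)"
    using local_iso_surj[OF \<Phi> dih_in_OR[OF k, of "-1" "2 * int p"]] by auto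
  have "\<phi> u \<in> {?e, g}" if u: "u \<in> units n" for u
  proof -
    have uc: "u \<in> carrier (OR n)" by (rule units_OR[OF u])
    have "cst n 1 \<odot>[n] u = cst n (u 1)" using n uc by (intro cst_mult) simp_all
    moreover have "\<phi> (cst n (u 1)) = \<phi> (cst n 1)"
      using n OR_apply_in[OF uc, of 1] by (intro endo_collapse[OF assms] cst_not_unit cst_in_OR) simp_all
    ultimately have "\<phi> (cst n 1) \<odot>[n] \<phi> u = \<phi> (cst n 1)" using hm[OF c1 uc] by simp
    then have "z \<odot>[k] \<Phi> (\<phi> u) = z"
      unfolding z_def using local_iso_mult[OF \<Phi> endo_local[OF n(1) assms(2) c1] endo_local[OF n(1) assms(2) uc]]
      by (simp only:)
    then have "(z \<odot>[k] \<Phi> (\<phi> u)) 1 = z 1" by (simp only:)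
    then have fix_p: "\<Phi> (\<phi> u) p = p" using k unfolding p_def by simp
    have "\<Phi> (\<phi> u) \<in> units k" by (rule endo_unit_local_unit[OF n(1) assms(2) u k \<Phi>])
    then obtain s c where s: "s \<in> {1, -1}" and sc: "\<Phi> (\<phi> u) = dih k s c" using unitsE[OF k] by metis
    have "dih k s c (res k (int p)) = res k (int p)" using fix_p p sc by simp
    then have d: "int k dvd s * int p + c - int p" using k by (simp add: res_eq_iff del: res_int)
    have "\<Phi> (\<phi> u) = \<Phi> ?e \<or> \<Phi> (\<phi> u) = \<Phi> g"
    proof (cases "s = 1")
      case True
      then have "dih k s c = dih k 1 0" using d by (simp add: dih_cong[OF k])
      then show ?thesis unfolding sc local_iso_one[OF \<Phi>] by (simp add: dih_one k)
    next
      case False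
      then have s: "s = -1" using s by simp
      have "dih k s c = dih k (-1) (2 * int p)" unfolding s using d s by (intro dih_cong[OF k]) (simp add: algebra_simps)
      then show ?thesis unfolding sc g(2) by simp
    qed
    moreover have "?e \<in> local_monoid n ?e" "\<phi> u \<in> local_monoid n ?e"
      using endo_local[OF n(1) assms(2)] uc by simp_all
    ultimately show ?thesis using g(1) inj_on_eq_iff[OF local_iso_inj[OF \<Phi>]] by blast
  qed
  then show thesis by (rule that)
qed

subsection \<open>Classification of the endomorphisms\<close>

definition idems :: "nat \<Rightarrow> (nat \<Rightarrow> nat) set" where
  "idems n = {e \<in> carrier (OR n). e \<odot>[n] e = e}"

definition idem_pairs :: "nat \<Rightarrow> ((nat \<Rightarrow> nat) \<times> (nat \<Rightarrow> nat)) set" where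
  "idem_pairs n = {(e, z). e \<in> idems n \<and> z \<in> idems n \<and> e \<odot>[n] z = z \<and> z \<odot>[n] e = z}"

text \<open>\<open>g\<close> is an involution among the units of the local monoid; since
  \<open>e\<close> is its square, \<open>z\<close> absorbs \<open>e\<close> as well.\<close>

definition involution_pairs :: "nat \<Rightarrow> (nat \<Rightarrow> nat) \<Rightarrow> ((nat \<Rightarrow> nat) \<times> (nat \<Rightarrow> nat)) set" where
  "involution_pairs n e = {(g, z). g \<in> local_monoid n e \<and> z \<in> idems n \<and>
     g \<noteq> e \<and> g \<odot>[n] g = e \<and> g \<odot>[n] z = z \<and> z \<odot>[n] g = z}"

text \<open>Read as a truth value, membership is a homomorphism onto the group of order two with
  kernel \<open>K\<close>, so these are the subgroups of index two.\<close>

definition index2 :: "nat \<Rightarrow> (nat \<Rightarrow> nat) set set" where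
  "index2 n = {K. K \<subseteq> units n \<and> K \<noteq> units n \<and>
     (\<forall>u\<in>units n. \<forall>v\<in>units n. u \<odot>[n] v \<in> K \<longleftrightarrow> (u \<in> K \<longleftrightarrow> v \<in> K))}"

definition endo_conj :: "nat \<Rightarrow> int \<times> int \<Rightarrow> (nat \<Rightarrow> nat) \<Rightarrow> nat \<Rightarrow> nat" where
  "endo_conj n = (\<lambda>(s, c). \<lambda>a\<in>carrier (OR n). dih n s (- s * c) \<odot>[n] a \<odot>[n] dih n s c)"

definition endo_triv :: "nat \<Rightarrow> (nat \<Rightarrow> nat) \<times> (nat \<Rightarrow> nat) \<Rightarrow> (nat \<Rightarrow> nat) \<Rightarrow> nat \<Rightarrow> nat" where
  "endo_triv n = (\<lambda>(e, z). \<lambda>a\<in>carrier (OR n). if a \<in> units n then e else z)"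

definition endo_sign ::
  "nat \<Rightarrow> (nat \<Rightarrow> nat) set \<times> (nat \<Rightarrow> nat) \<times> (nat \<Rightarrow> nat) \<times> (nat \<Rightarrow> nat) \<Rightarrow> (nat \<Rightarrow> nat) \<Rightarrow> nat \<Rightarrow> nat" where
  "endo_sign n = (\<lambda>(K, e, g, z). \<lambda>a\<in>carrier (OR n).
     if a \<in> units n then (if a \<in> K then e else g) else z)"

lemma finite_idems: "finite (idems n)"
  unfolding idems_def using finite_OR by simp

lemma idems_OR: "e \<in> idems n \<Longrightarrow> e \<in> carrier (OR n)"
  and idems_mult: "e \<in> idems n \<Longrightarrow> e \<odot>[n] e = e"
  unfolding idems_def by auto

lemma local_monoid_OR: "a \<in> local_monoid n e \<Longrightarrow> a \<in> carrier (OR n)"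
  unfolding local_monoid_def by simp

lemma finite_involution_pairs: "finite (involution_pairs n e)"
proof (rule finite_subset)
  show "involution_pairs n e \<subseteq> carrier (OR n) \<times> idems n"
    unfolding involution_pairs_def local_monoid_def by auto
qed (simp add: finite_OR finite_idems)

lemma one_in_index2: "n > 0 \<Longrightarrow> K \<in> index2 n \<Longrightarrow> \<one>\<^bsub>OR n\<^esub> \<in> K"
proof -
  assume n: "n > 0" and K: "K \<in> index2 n"
  interpret monoid "OR n" by (rule monoid_OR[OF n])
  have "\<one>\<^bsub>OR n\<^esub> \<odot>[n] \<one>\<^bsub>OR n\<^esub> \<in> K \<longleftrightarrow> (\<one>\<^bsub>OR n\<^esub> \<in> K \<longleftrightarrow> \<one>\<^bsub>OR n\<^esub> \<in> K)"
    using K one_in_units[OF n] unfolding index2_def by blast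
  then show ?thesis by simp
qed

lemma endo_conj_hom:
  assumes "n > 0" "s \<in> {1, -1}" shows "endo_conj n (s, c) \<in> semigroup_endos (OR n)"
proof -
  interpret monoid "OR n" by (rule monoid_OR[OF assms(1)])
  define P where "P = dih n s c"
  define Q where "Q = dih n s (- s * c)"
  have PQ: "P \<in> carrier (OR n)" "Q \<in> carrier (OR n)" unfolding P_def Q_def using assms by simp_all
  have inv: "P \<odot>[n] Q = \<one>\<^bsub>OR n\<^esub>"
    unfolding P_def Q_def using assms by (auto simp: dih_mult dih_one)
  have EC: "endo_conj n (s, c) a = Q \<odot>[n] a \<odot>[n] P" if "a \<in> carrier (OR n)" for a
    unfolding endo_conj_def P_def Q_def using that by simp
  have "endo_conj n (s, c) \<in> hom (OR n) (OR n)"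
  proof (rule homI)
    fix a b assume ab: "a \<in> carrier (OR n)" "b \<in> carrier (OR n)"
    then show "endo_conj n (s, c) a \<in> carrier (OR n)"
      using PQ by (simp add: EC)
    have "(Q \<odot>[n] a \<odot>[n] P) \<odot>[n] (Q \<odot>[n] b \<odot>[n] P)
      = Q \<odot>[n] a \<odot>[n] (P \<odot>[n] Q) \<odot>[n] b \<odot>[n] P"
      using ab PQ by (simp add: m_assoc)
    also have "\<dots> = Q \<odot>[n] (a \<odot>[n] b) \<odot>[n] P"
      unfolding inv using ab PQ by (simp add: m_assoc)
    finally show "endo_conj n (s, c) (a \<odot>[n] b) = endo_conj n (s, c) a \<odot>[n] endo_conj n (s, c) b"
      using ab by (simp add: EC)
  qed
  then show ?thesis unfolding semigroup_endos_def endo_conj_def by simp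
qed

lemma endo_conj_cst:
  assumes "n > 0" "s \<in> {1, -1}" "p \<in> {1..n}"
  shows "endo_conj n (s, c) (cst n p) = cst n (dih n s c p)"
proof -
  have "dih n s (- s * c) \<odot>[n] cst n p = cst n p"
    using assms by (intro mult_cst dih_in_OR)
  moreover have "cst n p \<odot>[n] dih n s c = cst n (dih n s c p)"
    using assms by (intro cst_mult dih_in_OR)
  ultimately show ?thesis unfolding endo_conj_def using assms(3) by simp
qed

text \<open>Conjugation moves the constants as the conjugating unit moves the points, so the unit
  can be recovered.\<close>

lemma inj_on_endo_conj:
  assumes "n \<ge> 3" shows "inj_on (endo_conj n) ({1, -1} \<times> {0..<int n})"
proof (rule inj_onI)
  fix x y assume x: "x \<in> {1, -1} \<times> {0..<int n}" and y: "y \<in> {1, -1} \<times> {0..<int n}"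
    and e: "endo_conj n x = endo_conj n y"
  obtain s c where xs: "x = (s, c)" by (cases x)
  obtain t d where yt: "y = (t, d)" by (cases y)
  have n: "n > 0" and s: "s \<in> {1, -1}" and t: "t \<in> {1, -1}" using assms x y xs yt by auto
  have "dih n s c = dih n t d"
  proof (rule OR_eqI[OF dih_in_OR[OF n s] dih_in_OR[OF n t]])
    fix i assume i: "i \<in> {1..n}"
    have "cst n (dih n s c i) = cst n (dih n t d i)"
      using endo_conj_cst[OF n s i, of c] endo_conj_cst[OF n t i, of d] e unfolding xs yt by simp
    then have "cst n (dih n s c i) 1 = cst n (dih n t d i) 1" by simp
    then show "dih n s c i = dih n t d i" using n by simp
  qed
  then show "x = y" using inj_onD[OF inj_on_dih_params[OF assms], of x y] x y xs yt by simp
qed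

text \<open>Stated for any \<open>K\<close> obeying the parity rule instead of for
  \<open>index2\<close>, so that \<open>K = units n\<close> with \<open>g = e\<close> covers
  \<open>endo_triv\<close> too.\<close>

lemma endo_sign_hom:
  assumes "n > 0" "K \<subseteq> units n"
    "\<And>u v. u \<in> units n \<Longrightarrow> v \<in> units n \<Longrightarrow> u \<odot>[n] v \<in> K \<longleftrightarrow> (u \<in> K \<longleftrightarrow> v \<in> K)"
    "e \<in> idems n" "z \<in> idems n" "g \<in> local_monoid n e"
    "g \<odot>[n] g = e" "g \<odot>[n] z = z" "z \<odot>[n] g = z"
  shows "endo_sign n (K, e, g, z) \<in> semigroup_endos (OR n)"
proof -
  interpret monoid "OR n" by (rule monoid_OR[OF assms(1)])
  have c: "e \<in> carrier (OR n)" "z \<in> carrier (OR n)" "g \<in> carrier (OR n)"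
    "e \<odot>[n] g = g" "g \<odot>[n] e = g"
    using assms(4-6) unfolding idems_def local_monoid_def by simp_all
  have ez: "e \<odot>[n] z = z" "z \<odot>[n] e = z"
  proof -
    show "e \<odot>[n] z = z" unfolding assms(7)[symmetric] using c assms(8) by (simp add: m_assoc)
    show "z \<odot>[n] e = z" unfolding assms(7)[symmetric] using c assms(9) by (simp add: m_assoc[symmetric])
  qed
  note mu = idems_mult[OF assms(4)] idems_mult[OF assms(5)] assms(7-9) c ez
  have "endo_sign n (K, e, g, z) \<in> hom (OR n) (OR n)"
  proof (rule homI)
    fix a b assume ab: "a \<in> carrier (OR n)" "b \<in> carrier (OR n)"
    then show "endo_sign n (K, e, g, z) a \<in> carrier (OR n)" using c unfolding endo_sign_def by simp
    show "endo_sign n (K, e, g, z) (a \<odot>[n] b)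
      = endo_sign n (K, e, g, z) a \<odot>[n] endo_sign n (K, e, g, z) b"
      using ab mu mult_in_units_iff[OF assms(1) ab] assms(3)[of a b] unfolding endo_sign_def
      by (cases "a \<in> units n"; cases "b \<in> units n"; cases "a \<in> K"; cases "b \<in> K") simp_all
  qed
  then show ?thesis unfolding semigroup_endos_def endo_sign_def by simp
qed

lemma endo_triv_eq_sign: "endo_triv n (e, z) = endo_sign n (units n, e, e, z)"
  unfolding endo_triv_def endo_sign_def by (auto intro!: restrict_ext)

lemma semigroup_endos_cases:
  assumes "n \<ge> 3" "\<phi> \<in> semigroup_endos (OR n)"
  shows "\<phi> \<in> endo_conj n ` ({1, -1} \<times> {0..<int n}) \<union> endo_triv n ` idem_pairs n
     \<union> endo_sign n ` (index2 n \<times> (SIGMA e : idems n. involution_pairs n e))"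
proof -
  have n: "n > 0" "n \<ge> 2" using assms(1) by simp_all
  interpret monoid "OR n" by (rule monoid_OR[OF n(1)])
  have \<phi>: "\<phi> \<in> hom (OR n) (OR n)" and ext: "\<phi> \<in> extensional (carrier (OR n))"
    using assms(2) unfolding semigroup_endos_def by auto
  note hm = hom_mult[OF \<phi>] and hc = hom_in_carrier[OF \<phi>]
  show ?thesis
  proof (cases "inj_on \<phi> (units n)")
    case True
    obtain s c where sc: "s \<in> {1, -1}" "c \<in> {0..<int n}"
      "\<And>a. a \<in> carrier (OR n) \<Longrightarrow> \<phi> a = dih n s (- s * c) \<odot>[n] a \<odot>[n] dih n s c"
      using endo_inj_units_conj[OF assms(1) \<phi> True] by metis
    have "\<phi> = endo_conj n (s, c)"
    proof (rule extensionalityI[OF ext])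
      show "endo_conj n (s, c) \<in> extensional (carrier (OR n))" unfolding endo_conj_def by simp
      show "\<phi> a = endo_conj n (s, c) a" if "a \<in> carrier (OR n)" for a
        using sc(3)[OF that] that unfolding endo_conj_def by simp
    qed
    then show ?thesis using sc(1,2) by blast
  next
    case False
    define e where "e = \<phi> \<one>\<^bsub>OR n\<^esub>"
    define z where "z = \<phi> (cst n 1)"
    have c1: "cst n 1 \<in> carrier (OR n)" using n by simp
    have e: "e \<in> idems n" unfolding e_def idems_def using endo_one_idempotent[OF n(1) \<phi>] by simp
    have loc: "\<phi> a \<in> local_monoid n e" if "a \<in> carrier (OR n)" for a
      unfolding e_def by (rule endo_local[OF n(1) \<phi> that])
    have "cst n 1 \<odot>[n] cst n 1 = cst n 1" using n c1 by (intro mult_cst) simp_all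
    then have z: "z \<in> idems n" unfolding z_def idems_def using hm[OF c1 c1] hc[OF c1] by simp
    have coll: "\<phi> a = z" if "a \<in> carrier (OR n)" "a \<notin> units n" for a
      unfolding z_def by (rule endo_collapse[OF assms(1) \<phi> False that])
    have uz: "\<phi> u \<odot>[n] z = z" "z \<odot>[n] \<phi> u = z" if u: "u \<in> units n" for u
    proof -
      have uc: "u \<in> carrier (OR n)" by (rule units_OR[OF u])
      have "u \<odot>[n] cst n 1 = cst n 1" using n uc by (intro mult_cst) simp_all
      then show "\<phi> u \<odot>[n] z = z" unfolding z_def using hm[OF uc c1] by simp
      have "cst n 1 \<odot>[n] u = cst n (u 1)" using n uc by (intro cst_mult) simp_all
      moreover have "\<phi> (cst n (u 1)) = z"
        using n OR_apply_in[OF uc, of 1] by (intro coll cst_not_unit cst_in_OR) simp_all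
      ultimately show "z \<odot>[n] \<phi> u = z" using hm[OF c1 uc] unfolding z_def by simp
    qed
    obtain g0 where g0: "\<And>u. u \<in> units n \<Longrightarrow> \<phi> u \<in> {e, g0}"
      using endo_units_two_values[OF assms(1) \<phi> False] unfolding e_def by metis
    show ?thesis
    proof (cases "\<forall>u\<in>units n. \<phi> u = e")
      case True
      have "\<phi> = endo_triv n (e, z)"
      proof (rule extensionalityI[OF ext])
        show "endo_triv n (e, z) \<in> extensional (carrier (OR n))" unfolding endo_triv_def by simp
        show "\<phi> a = endo_triv n (e, z) a" if "a \<in> carrier (OR n)" for a
          using that True coll unfolding endo_triv_def by simp
      qed
      moreover have "(e, z) \<in> idem_pairs n"
        using e z loc[OF c1] unfolding idem_pairs_def local_monoid_def z_def by simp
      ultimately show ?thesis by blast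
    next
      case False
      then obtain u0 where u0: "u0 \<in> units n" "\<phi> u0 \<noteq> e" by blast
      define g where "g = \<phi> u0"
      have g: "\<phi> u = e \<or> \<phi> u = g" if "u \<in> units n" for u
        using g0[OF that] g0[OF u0(1)] u0(2) unfolding g_def by auto
      have ge: "g \<noteq> e" unfolding g_def by (rule u0(2))
      have u0c: "u0 \<in> carrier (OR n)" by (rule units_OR[OF u0(1)])
      have gl: "g \<in> local_monoid n e" unfolding g_def by (rule loc[OF u0c])
      have gc: "g \<in> carrier (OR n)" "e \<odot>[n] g = g" "g \<odot>[n] e = g"
        using gl unfolding local_monoid_def by simp_all
      \<comment> \<open>\<open>g \<odot>[n] g\<close> is \<open>e\<close> or \<open>g\<close>; in
        the latter case multiplying by the image of the inverse of \<open>u0\<close> gives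
        \<open>g = e\<close>.\<close>
      have gg: "g \<odot>[n] g = e"
      proof (rule ccontr)
        assume ne: "g \<odot>[n] g \<noteq> e"
        have "u0 \<odot>[n] u0 \<in> units n" using mult_in_units_iff[OF n(1) u0c u0c] u0(1) by simp
        moreover have "\<phi> (u0 \<odot>[n] u0) = g \<odot>[n] g" unfolding g_def by (rule hm[OF u0c u0c])
        ultimately have "g \<odot>[n] g = g" using g ne by metis
        moreover obtain v where v: "v \<in> units n" "u0 \<odot>[n] v = \<one>\<^bsub>OR n\<^esub>"
          using units_inverse[OF n(1) u0(1)] by blast
        have gv: "g \<odot>[n] \<phi> v = e" unfolding g_def e_def using hm[OF u0c units_OR[OF v(1)]] v(2) by simp
        have "g \<odot>[n] g \<odot>[n] \<phi> v = g"
          using gc gv hc[OF units_OR[OF v(1)]] by (simp add: m_assoc)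
        ultimately show False using gv ge by simp
      qed
      define K where "K = {u \<in> units n. \<phi> u = e}"
      have "K \<in> index2 n"
        unfolding index2_def
      proof (intro CollectI conjI ballI)
        show "K \<subseteq> units n" unfolding K_def by blast
        show "K \<noteq> units n" unfolding K_def using u0 by blast
        fix u v assume uv: "u \<in> units n" "v \<in> units n"
        note c = units_OR[OF uv(1)] units_OR[OF uv(2)]
        have "u \<odot>[n] v \<in> units n" using mult_in_units_iff[OF n(1) c] uv by simp
        then show "u \<odot>[n] v \<in> K \<longleftrightarrow> (u \<in> K \<longleftrightarrow> v \<in> K)"
          using uv g[OF uv(1)] g[OF uv(2)] hm[OF c] gc gg ge idems_mult[OF e] unfolding K_def by auto
      qed
      moreover have "(e, g, z) \<in> (SIGMA e : idems n. involution_pairs n e)"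
        using e z gl ge gg uz[OF u0(1)] unfolding involution_pairs_def g_def by simp
      moreover have "\<phi> = endo_sign n (K, e, g, z)"
      proof (rule extensionalityI[OF ext])
        show "endo_sign n (K, e, g, z) \<in> extensional (carrier (OR n))" unfolding endo_sign_def by simp
        show "\<phi> a = endo_sign n (K, e, g, z) a" if "a \<in> carrier (OR n)" for a
          using that g[of a] coll[of a] unfolding endo_sign_def K_def by auto
      qed
      ultimately show ?thesis by blast
    qed
  qed
qed

lemma semigroup_endos_eq:
  assumes "n \<ge> 3"
  shows "semigroup_endos (OR n) = endo_conj n ` ({1, -1} \<times> {0..<int n}) \<union> endo_triv n ` idem_pairs n
     \<union> endo_sign n ` (index2 n \<times> (SIGMA e : idems n. involution_pairs n e))" (is "_ = ?C \<union> ?T \<union> ?S")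
proof
  have n: "n > 0" using assms by simp
  show "semigroup_endos (OR n) \<subseteq> ?C \<union> ?T \<union> ?S" using semigroup_endos_cases[OF assms] by blast
  have "?C \<subseteq> semigroup_endos (OR n)" using endo_conj_hom[OF n] by auto
  moreover have "?T \<subseteq> semigroup_endos (OR n)"
  proof (rule image_subsetI)
    fix x assume "x \<in> idem_pairs n"
    then obtain e z where x: "x = (e, z)" and ez: "e \<in> idems n" "z \<in> idems n"
      "e \<odot>[n] z = z" "z \<odot>[n] e = z" unfolding idem_pairs_def by blast
    have "e \<in> local_monoid n e" using ez(1) unfolding local_monoid_def idems_def by simp
    moreover have "u \<odot>[n] v \<in> units n" if "u \<in> units n" "v \<in> units n" for u v
      using mult_in_units_iff[OF n units_OR[OF that(1)] units_OR[OF that(2)]] that by simp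
    ultimately show "endo_triv n x \<in> semigroup_endos (OR n)"
      unfolding x endo_triv_eq_sign using ez idems_mult[OF ez(1)]
      by (intro endo_sign_hom[OF n]) simp_all
  qed
  moreover have "?S \<subseteq> semigroup_endos (OR n)"
  proof (rule image_subsetI)
    fix x assume x: "x \<in> index2 n \<times> (SIGMA e : idems n. involution_pairs n e)"
    obtain K e g z where xe: "x = (K, e, g, z)" by (metis prod.collapse)
    have K: "K \<in> index2 n" "e \<in> idems n" "(g, z) \<in> involution_pairs n e" using x unfolding xe by simp_all
    have 1: "K \<subseteq> units n" using K(1) unfolding index2_def by blast
    have 2: "u \<odot>[n] v \<in> K \<longleftrightarrow> (u \<in> K \<longleftrightarrow> v \<in> K)" if "u \<in> units n" "v \<in> units n" for u v
      using K(1) that unfolding index2_def by simp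
    have 3: "z \<in> idems n" "g \<in> local_monoid n e" "g \<odot>[n] g = e" "g \<odot>[n] z = z" "z \<odot>[n] g = z"
      using K(3) unfolding involution_pairs_def by simp_all
    show "endo_sign n x \<in> semigroup_endos (OR n)"
      unfolding xe by (rule endo_sign_hom[OF n 1 2 K(2) 3])
  qed
  ultimately show "?C \<union> ?T \<union> ?S \<subseteq> semigroup_endos (OR n)" by (intro Un_least)
qed

text \<open>Conjugations separate the constants 1 and 2, the other two families do not; among these
  \<open>endo_sign\<close> takes two values on the units and \<open>endo_triv\<close> only one. The
  parameters are read off at the units and at a constant.\<close>

lemma card_semigroup_endos:
  assumes "n \<ge> 3"
  shows "card (semigroup_endos (OR n)) = 2 * n + card (idem_pairs n)
     + card (index2 n) * (\<Sum>e\<in>idems n. card (involution_pairs n e))"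
proof -
  let ?P = "{1, -1} \<times> {0..<int n}"
  let ?Q = "index2 n \<times> (SIGMA e : idems n. involution_pairs n e)"
  have n: "n > 0" "n \<ge> 2" using assms by simp_all
  have c12: "cst n 1 \<in> carrier (OR n)" "cst n 2 \<in> carrier (OR n)" "cst n 1 \<notin> units n" "cst n 2 \<notin> units n"
    using n cst_not_unit by simp_all
  have one: "\<one>\<^bsub>OR n\<^esub> \<in> carrier (OR n)" "\<one>\<^bsub>OR n\<^esub> \<in> units n"
    using n by (simp_all add: units_OR)
  have fin: "finite (idem_pairs n)" "finite ?Q"
  proof -
    have "idem_pairs n \<subseteq> idems n \<times> idems n" unfolding idem_pairs_def by blast
    then show "finite (idem_pairs n)" by (rule finite_subset) (simp add: finite_idems)
    have "index2 n \<subseteq> Pow (units n)" unfolding index2_def by blast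
    then have "finite (index2 n)" by (rule finite_subset) (simp add: finite_units)
    then show "finite ?Q" by (intro finite_cartesian_product finite_SigmaI finite_idems finite_involution_pairs)
  qed
  have injT: "inj_on (endo_triv n) (idem_pairs n)"
  proof (rule inj_onI)
    fix x y assume e: "endo_triv n x = endo_triv n y"
    obtain a b where x: "x = (a, b)" by (cases x)
    obtain c d where y: "y = (c, d)" by (cases y)
    show "x = y"
      using fun_cong[OF e, of "\<one>\<^bsub>OR n\<^esub>"] fun_cong[OF e, of "cst n 1"] one c12
      unfolding x y endo_triv_def by simp
  qed
  have injS: "inj_on (endo_sign n) ?Q"
  proof (rule inj_onI)
    fix x y assume x: "x \<in> ?Q" and y: "y \<in> ?Q" and e: "endo_sign n x = endo_sign n y"
    obtain K a g z where xe: "x = (K, a, g, z)" by (metis prod.collapse)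
    obtain L b h w where ye: "y = (L, b, h, w)" by (metis prod.collapse)
    have K: "K \<in> index2 n" "L \<in> index2 n" "g \<noteq> a" "h \<noteq> b"
      using x y unfolding xe ye involution_pairs_def by auto
    have sub: "K \<subseteq> units n" "L \<subseteq> units n" "K \<noteq> units n" using K unfolding index2_def by auto
    have "a = b" using fun_cong[OF e, of "\<one>\<^bsub>OR n\<^esub>"] one one_in_index2[OF n(1) K(1)] one_in_index2[OF n(1) K(2)]
      unfolding xe ye endo_sign_def by simp
    moreover have "z = w" using fun_cong[OF e, of "cst n 1"] c12 unfolding xe ye endo_sign_def by simp
    moreover have val: "(if u \<in> K then a else g) = (if u \<in> L then b else h)" if "u \<in> units n" for u
      using fun_cong[OF e, of u] that units_OR[OF that] unfolding xe ye endo_sign_def by simp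
    have KL: "u \<in> K \<longleftrightarrow> u \<in> L" if "u \<in> units n" for u
      using val[OF that] K(3,4) \<open>a = b\<close> by (auto split: if_splits)
    then have "K = L" using sub by blast
    moreover obtain u where "u \<in> units n" "u \<notin> K" using sub by blast
    then have "g = h" using val[of u] KL by simp
    ultimately show "x = y" unfolding xe ye by simp
  qed
  have "endo_conj n x \<noteq> f" if "x \<in> ?P" "f (cst n 1) = f (cst n 2)" for x f
  proof
    assume f: "endo_conj n x = f"
    obtain s c where x: "x = (s, c)" by (cases x)
    have s: "s \<in> {1, -1}" using that(1) x by auto
    have "cst n (dih n s c 1) = cst n (dih n s c 2)"
      using endo_conj_cst[OF n(1) s, of 1 c] endo_conj_cst[OF n(1) s, of 2 c] that(2) n
      unfolding f[symmetric] x by simp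
    then have "cst n (dih n s c 1) 1 = cst n (dih n s c 2) 1" by simp
    then have "dih n s c 1 = dih n s c 2" using n by simp
    then have "(1::nat) = 2" by (rule inj_onD[OF inj_on_dih[OF n(1) s]]) (use n in simp_all)
    then show False by simp
  qed
  note conj_ne = this
  have tc: "endo_triv n y (cst n 1) = endo_triv n y (cst n 2)" for y
    unfolding endo_triv_def using c12 by (cases y) simp
  have sc: "endo_sign n y (cst n 1) = endo_sign n y (cst n 2)" for y
    unfolding endo_sign_def using c12 by (cases y) simp
  have d1: "endo_conj n ` ?P \<inter> endo_triv n ` idem_pairs n = {}"
    using conj_ne tc by blast
  have d2: "(endo_conj n ` ?P \<union> endo_triv n ` idem_pairs n) \<inter> endo_sign n ` ?Q = {}"
  proof -
    have "endo_triv n x \<noteq> endo_sign n y" if "y \<in> ?Q" for x y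
    proof
      assume e: "endo_triv n x = endo_sign n y"
      obtain a b where x: "x = (a, b)" by (cases x)
      obtain K c g z where y: "y = (K, c, g, z)" by (metis prod.collapse)
      have K: "K \<in> index2 n" "g \<noteq> c" using that unfolding y involution_pairs_def by auto
      then have "K \<subseteq> units n" "K \<noteq> units n" unfolding index2_def by auto
      then obtain u where u: "u \<in> units n" "u \<notin> K" by blast
      have "a = c" using fun_cong[OF e, of "\<one>\<^bsub>OR n\<^esub>"] one one_in_index2[OF n(1) K(1)]
        unfolding x y endo_sign_def endo_triv_def by simp
      moreover have "a = g" using fun_cong[OF e, of u] u units_OR[OF u(1)]
        unfolding x y endo_sign_def endo_triv_def by simp
      ultimately show False using K(2) by simp
    qed
    then show ?thesis using conj_ne sc by blast
  qed
  have "card (semigroup_endos (OR n)) = card (endo_conj n ` ?P) + card (endo_triv n ` idem_pairs n) + card (endo_sign n ` ?Q)"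
    unfolding semigroup_endos_eq[OF assms] using fin d1 d2
    by (subst card_Un_disjoint card_Un_disjoint[OF _ _ d1]; simp)+
  also have "card (endo_conj n ` ?P) = 2 * n"
    using card_image[OF inj_on_endo_conj[OF assms]] by (simp add: card_cartesian_product)
  also have "card (endo_triv n ` idem_pairs n) = card (idem_pairs n)" by (rule card_image[OF injT])
  also have "card (endo_sign n ` ?Q) = card ?Q" by (rule card_image[OF injS])
  also have "\<dots> = card (index2 n) * (\<Sum>e\<in>idems n. card (involution_pairs n e))"
    by (simp add: card_cartesian_product finite_idems finite_involution_pairs)
  finally show ?thesis .
qed

subsection \<open>Index-two subgroups and reduction to local monoids\<close>

text \<open>The flags say whether the rotation by one and the reflection \<open>dih n (-1) 0\<close> lie in the subgroup.\<close>

definition parity_set :: "nat \<Rightarrow> bool \<times> bool \<Rightarrow> (nat \<Rightarrow> nat) set" where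
  "parity_set n = (\<lambda>(a, b). {u. \<exists>s c. s \<in> {1, -1} \<and> u = dih n s c \<and> ((a \<or> even c) = (b \<or> s = 1))})"

text \<open>Well-definedness: a unit determines \<open>c\<close> only modulo \<open>n\<close>. For
  even \<open>n\<close> the parity of \<open>c\<close> is meaningful; for odd \<open>n\<close> the
  first flag is set and the parity is not consulted.\<close>

lemma dih_in_parity_set:
  assumes "n \<ge> 3" "odd n \<longrightarrow> a" "s \<in> {1, -1}"
  shows "dih n s c \<in> parity_set n (a, b) \<longleftrightarrow> ((a \<or> even c) = (b \<or> s = 1))"
proof
  assume "dih n s c \<in> parity_set n (a, b)"
  then obtain t d where td: "t \<in> {1, -1}" "dih n s c = dih n t d" "(a \<or> even d) = (b \<or> t = 1)"
    unfolding parity_set_def by blast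
  have st: "s = t" "int n dvd c - d" using td(2) dih_eq_iff[OF assms(1,3) td(1)] by simp_all
  have "a \<or> even c = even d"
  proof (cases "odd n")
    case False
    then have "2 dvd int n" by simp
    then have "even (c - d)" using st(2) by (rule dvd_trans)
    then show ?thesis by simp
  qed (use assms(2) in simp)
  then show "(a \<or> even c) = (b \<or> s = 1)" using td(3) st(1) by auto
qed (use assms(3) in \<open>auto simp: parity_set_def\<close>)

text \<open>A homomorphism to the group of order two is fixed by its values on the rotation by one
  and on one reflection. Both flags set would give all units, and for odd \<open>n\<close> the
  rotation has odd order and must lie in the kernel.\<close>

lemma index2_eq:
  assumes "n \<ge> 3"
  shows "index2 n = parity_set n ` {(a, b). \<not> (a \<and> b) \<and> (odd n \<longrightarrow> a)}"
proof (intro equalityI subsetI)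
  have n: "n > 0" using assms by simp
  interpret monoid "OR n" by (rule monoid_OR[OF n])
  fix K assume K: "K \<in> index2 n"
  have sub: "K \<subseteq> units n" "K \<noteq> units n" using K unfolding index2_def by simp_all
  have mult: "u \<odot>[n] v \<in> K \<longleftrightarrow> (u \<in> K \<longleftrightarrow> v \<in> K)" if "u \<in> units n" "v \<in> units n" for u v
    using K that unfolding index2_def by simp
  define a where "a \<longleftrightarrow> dih n 1 1 \<in> K"
  define b where "b \<longleftrightarrow> dih n (-1) 0 \<in> K"
  have one: "dih n 1 0 \<in> K" using one_in_index2[OF n K] by (simp add: dih_one n)
  have rot: "dih n 1 (int j) \<in> K \<longleftrightarrow> a \<or> even j" for j
  proof (induction j)
    case (Suc j)
    have "dih n 1 (int (Suc j)) = dih n 1 (int j) \<odot>[n] dih n 1 1"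
      using n by (simp add: dih_mult add.commute)
    then have "dih n 1 (int (Suc j)) \<in> K \<longleftrightarrow> (dih n 1 (int j) \<in> K \<longleftrightarrow> a)"
      unfolding a_def using n by (simp only: mult dih_in_units insertCI)
    then show ?case using Suc by auto
  qed (simp add: one)
  have mem: "dih n s c \<in> K \<longleftrightarrow> ((a \<or> even c) = (b \<or> s = 1))" if s: "s \<in> {1, -1}" and c: "c \<in> {0..<int n}" for s c
  proof -
    have r: "dih n 1 c \<in> K \<longleftrightarrow> a \<or> even c" using rot[of "nat c"] c by (simp add: even_nat_iff)
    have "dih n (-1) c = dih n (-1) 0 \<odot>[n] dih n 1 c" using n by (simp add: dih_mult)
    then have "dih n (-1) c \<in> K \<longleftrightarrow> (b \<longleftrightarrow> dih n 1 c \<in> K)"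
      unfolding b_def using mult[of "dih n (-1) 0" "dih n 1 c"] n by simp
    then show ?thesis using r s by auto
  qed
  have "dih n 1 (int n) = dih n 1 0" using n by (intro dih_cong) simp_all
  then have oa: "odd n \<longrightarrow> a" using rot[of n] one by auto
  have "\<not> (a \<and> b)"
  proof
    assume ab: "a \<and> b"
    have "u \<in> K" if "u \<in> units n" for u
    proof -
      obtain s c where "s \<in> {1, -1}" "c \<in> {0..<int n}" "u = dih n s c" using unitsE[OF n \<open>u \<in> units n\<close>] by metis
      then show ?thesis using mem ab by simp
    qed
    then show False using sub by blast
  qed
  moreover have "K = parity_set n (a, b)"
  proof (intro equalityI subsetI)
    fix u assume u: "u \<in> K"
    then have "u \<in> units n" using sub by blast
    then obtain s c where sc: "s \<in> {1, -1}" "c \<in> {0..<int n}" "u = dih n s c" using unitsE[OF n] by metis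
    then show "u \<in> parity_set n (a, b)" using u mem[OF sc(1,2)] dih_in_parity_set[OF assms oa sc(1)] by simp
  next
    fix u assume u: "u \<in> parity_set n (a, b)"
    then have "u \<in> units n" using n unfolding parity_set_def by auto
    then obtain s c where sc: "s \<in> {1, -1}" "c \<in> {0..<int n}" "u = dih n s c" using unitsE[OF n] by metis
    then show "u \<in> K" using u mem[OF sc(1,2)] dih_in_parity_set[OF assms oa sc(1)] by simp
  qed
  ultimately show "K \<in> parity_set n ` {(a, b). \<not> (a \<and> b) \<and> (odd n \<longrightarrow> a)}" using oa by blast
next
  have n: "n > 0" using assms by simp
  fix K assume "K \<in> parity_set n ` {(a, b). \<not> (a \<and> b) \<and> (odd n \<longrightarrow> a)}"
  then obtain a b where K: "K = parity_set n (a, b)" and ab: "\<not> (a \<and> b)" "odd n \<longrightarrow> a" by blast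
  note mem = dih_in_parity_set[OF assms ab(2)]
  show "K \<in> index2 n"
    unfolding index2_def
  proof (intro CollectI conjI ballI)
    show "K \<subseteq> units n" using n unfolding K parity_set_def by auto
    have "dih n 1 1 \<notin> K \<or> dih n (-1) 0 \<notin> K" unfolding K using ab(1) by (simp add: mem)
    moreover have "dih n 1 1 \<in> units n" "dih n (-1) 0 \<in> units n" using n by simp_all
    ultimately show "K \<noteq> units n" by blast
    fix u v assume "u \<in> units n" "v \<in> units n"
    then obtain s c t d where s: "s \<in> {1, -1}" "u = dih n s c" and t: "t \<in> {1, -1}" "v = dih n t d"
      using unitsE[OF n] by metis
    have st: "s * t \<in> {1, -1}" using s t by auto
    show "u \<odot>[n] v \<in> K \<longleftrightarrow> (u \<in> K \<longleftrightarrow> v \<in> K)"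
      unfolding s(2) t(2) dih_mult[OF n s(1) t(1)] K mem[OF st] mem[OF s(1)] mem[OF t(1)]
      using s(1) t(1) ab(1) by auto
  qed
qed

lemma card_index2:
  assumes "n \<ge> 3" shows "card (index2 n) = (if even n then 3 else 1)"
proof -
  define V where "V = {(a, b). \<not> (a \<and> b) \<and> (odd n \<longrightarrow> a)}"
  have "inj_on (parity_set n) V"
  proof (rule inj_onI)
    fix x y assume x: "x \<in> V" and y: "y \<in> V" and e: "parity_set n x = parity_set n y"
    obtain a b where xe: "x = (a, b)" by (cases x)
    obtain c d where ye: "y = (c, d)" by (cases y)
    have o: "odd n \<longrightarrow> a" "odd n \<longrightarrow> c" using x y unfolding V_def xe ye by simp_all
    have "dih n s k \<in> parity_set n (a, b) \<longleftrightarrow> dih n s k \<in> parity_set n (c, d)" for s k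
      using e unfolding xe ye by simp
    from this[of 1 1] this[of "-1" 0] show "x = y"
      unfolding xe ye using dih_in_parity_set[OF assms o(1)] dih_in_parity_set[OF assms o(2)] by simp
  qed
  then have "card (index2 n) = card V" unfolding index2_eq[OF assms] V_def by (rule card_image)
  also have "V = (if even n then {(True, False), (False, True), (False, False)} else {(True, False)})"
    unfolding V_def by auto
  finally show ?thesis by simp
qed

section \<open>Transport of idempotents and involutions to \<open>OR k\<close>\<close>

lemma local_monoid_one: "n > 0 \<Longrightarrow> local_monoid n \<one>\<^bsub>OR n\<^esub> = carrier (OR n)"
  unfolding local_monoid_def using monoid.l_one[OF monoid_OR] monoid.r_one[OF monoid_OR] by auto

lemma local_monoid_mult:
  assumes "n > 0" "e \<in> idems n" "a \<in> local_monoid n e" "b \<in> local_monoid n e"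
  shows "a \<odot>[n] b \<in> local_monoid n e"
proof -
  interpret monoid "OR n" by (rule monoid_OR[OF assms(1)])
  have c: "e \<in> carrier (OR n)" "a \<in> carrier (OR n)" "b \<in> carrier (OR n)"
    "e \<odot>[n] a = a" "b \<odot>[n] e = b"
    using assms unfolding local_monoid_def idems_def by simp_all
  have "e \<odot>[n] (a \<odot>[n] b) = a \<odot>[n] b" using c by (simp add: m_assoc[symmetric])
  moreover have "a \<odot>[n] b \<odot>[n] e = a \<odot>[n] b" using c by (simp add: m_assoc)
  ultimately show ?thesis unfolding local_monoid_def using c by simp
qed

lemma local_iso_mult_eq_iff:
  assumes "n > 0" "e \<in> idems n" "local_iso n e k \<Phi>"
    "a \<in> local_monoid n e" "b \<in> local_monoid n e" "c \<in> local_monoid n e"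
  shows "\<Phi> a \<odot>[k] \<Phi> b = \<Phi> c \<longleftrightarrow> a \<odot>[n] b = c"
  unfolding local_iso_mult[OF assms(3-5), symmetric]
  by (rule inj_on_eq_iff[OF local_iso_inj[OF assms(3)] local_monoid_mult[OF assms(1,2,4,5)] assms(6)])

lemma card_local_idems:
  assumes "n > 0" "e \<in> idems n"
  shows "card (idems n \<inter> local_monoid n e) = card (idems (card (e ` {1..n})))"
proof -
  define k where "k = card (e ` {1..n})"
  obtain \<Phi> where \<Phi>: "local_iso n e k \<Phi>"
    using local_iso_exists[OF assms(1) idems_OR[OF assms(2)] idems_mult[OF assms(2)]] unfolding k_def by blast
  have "\<Phi> ` (idems n \<inter> local_monoid n e) = idems k"
  proof (intro equalityI subsetI)
    fix y assume "y \<in> \<Phi> ` (idems n \<inter> local_monoid n e)"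
    then obtain z where z: "z \<in> idems n" "z \<in> local_monoid n e" "y = \<Phi> z" by blast
    then show "y \<in> idems k"
      using local_iso_mult_eq_iff[OF assms \<Phi> z(2) z(2) z(2)] local_iso_in[OF \<Phi> z(2)]
      unfolding idems_def by simp
  next
    fix y assume y: "y \<in> idems k"
    then obtain z where z: "z \<in> local_monoid n e" "y = \<Phi> z"
      using local_iso_surj[OF \<Phi> idems_OR[OF y]] by blast
    then have "z \<in> idems n"
      using y local_iso_mult_eq_iff[OF assms \<Phi> z(1) z(1) z(1)] local_monoid_OR[OF z(1)] unfolding idems_def by simp
    then show "y \<in> \<Phi> ` (idems n \<inter> local_monoid n e)" using z by blast
  qed
  moreover have "inj_on \<Phi> (idems n \<inter> local_monoid n e)"
    by (rule inj_on_subset[OF local_iso_inj[OF \<Phi>]]) simp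
  ultimately show ?thesis unfolding k_def[symmetric] using card_image by metis
qed

lemma card_idem_pairs:
  assumes "n > 0"
  shows "card (idem_pairs n) = (\<Sum>e\<in>idems n. card (idems (card (e ` {1..n}))))"
proof -
  have "idem_pairs n = (SIGMA e : idems n. idems n \<inter> local_monoid n e)"
    unfolding idem_pairs_def local_monoid_def idems_def by auto
  then have "card (idem_pairs n) = (\<Sum>e\<in>idems n. card (idems n \<inter> local_monoid n e))"
    by (simp add: finite_idems)
  then show ?thesis using card_local_idems[OF assms] by simp
qed

text \<open>All conditions are equations inside the local monoid, hence preserved by the
  isomorphism; \<open>z\<close> belongs there because \<open>e = g \<odot>[n] g\<close>.\<close>

lemma card_involution_pairs:
  assumes "n > 0" "e \<in> idems n"
  defines "k \<equiv> card (e ` {1..n})"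
  shows "card (involution_pairs n e) = card (involution_pairs k \<one>\<^bsub>OR k\<^esub>)"
proof -
  interpret monoid "OR n" by (rule monoid_OR[OF assms(1)])
  have k: "k > 0" using card_image_OR[OF assms(1) idems_OR[OF assms(2)]] unfolding k_def by simp
  obtain \<Phi> where \<Phi>: "local_iso n e k \<Phi>"
    using local_iso_exists[OF assms(1) idems_OR[OF assms(2)] idems_mult[OF assms(2)]] unfolding k_def by blast
  have el: "e \<in> local_monoid n e" using assms(2) unfolding idems_def local_monoid_def by simp
  note iff = local_iso_mult_eq_iff[OF assms(1,2) \<Phi>]
  have zl: "z \<in> local_monoid n e" if gz: "(g, z) \<in> involution_pairs n e" for g z
  proof -
    have g: "g \<in> carrier (OR n)" "z \<in> carrier (OR n)" "g \<odot>[n] g = e" "g \<odot>[n] z = z" "z \<odot>[n] g = z"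
      using gz unfolding involution_pairs_def idems_def local_monoid_def by simp_all
    have "e \<odot>[n] z = z" unfolding g(3)[symmetric] using g(1,2,4) by (simp add: m_assoc)
    moreover have "z \<odot>[n] e = z" unfolding g(3)[symmetric] using g(1,2,5) by (simp add: m_assoc[symmetric])
    ultimately show ?thesis unfolding local_monoid_def using g by simp
  qed
  have iff2: "(\<Phi> g, \<Phi> z) \<in> involution_pairs k \<one>\<^bsub>OR k\<^esub> \<longleftrightarrow> (g, z) \<in> involution_pairs n e"
    if g: "g \<in> local_monoid n e" and z: "z \<in> local_monoid n e" for g z
  proof -
    have "\<Phi> g \<noteq> \<one>\<^bsub>OR k\<^esub> \<longleftrightarrow> g \<noteq> e"
      unfolding local_iso_one[OF \<Phi>, symmetric] using inj_on_eq_iff[OF local_iso_inj[OF \<Phi>] g el] by simp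
    moreover have "\<Phi> g \<odot>[k] \<Phi> g = \<one>\<^bsub>OR k\<^esub> \<longleftrightarrow> g \<odot>[n] g = e"
      unfolding local_iso_one[OF \<Phi>, symmetric] by (rule iff[OF g g el])
    moreover have "\<Phi> z \<in> idems k \<longleftrightarrow> z \<in> idems n"
      using iff[OF z z z] local_iso_in[OF \<Phi> z] local_monoid_OR[OF z] unfolding idems_def by simp
    ultimately show ?thesis
      unfolding involution_pairs_def local_monoid_one[OF k]
      using iff[OF g z z] iff[OF z g z] local_iso_in[OF \<Phi> g] g by simp
  qed
  have "map_prod \<Phi> \<Phi> ` involution_pairs n e = involution_pairs k \<one>\<^bsub>OR k\<^esub>"
  proof (intro equalityI subsetI)
    fix y assume "y \<in> map_prod \<Phi> \<Phi> ` involution_pairs n e"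
    then obtain g z where gz: "(g, z) \<in> involution_pairs n e" "y = (\<Phi> g, \<Phi> z)" by auto
    then have "g \<in> local_monoid n e" unfolding involution_pairs_def by simp
    then show "y \<in> involution_pairs k \<one>\<^bsub>OR k\<^esub>" using iff2 zl[OF gz(1)] gz by simp
  next
    fix y assume y: "y \<in> involution_pairs k \<one>\<^bsub>OR k\<^esub>"
    obtain g' z' where y': "y = (g', z')" by (cases y)
    have "g' \<in> carrier (OR k)" "z' \<in> carrier (OR k)"
      using y unfolding y' involution_pairs_def local_monoid_one[OF k] idems_def by simp_all
    then obtain g z where g: "g \<in> local_monoid n e" "g' = \<Phi> g" and z: "z \<in> local_monoid n e" "z' = \<Phi> z"
      using local_iso_surj[OF \<Phi>] by metis
    then have "(g, z) \<in> involution_pairs n e" using iff2[OF g(1) z(1)] y y' by simp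
    then show "y \<in> map_prod \<Phi> \<Phi> ` involution_pairs n e" unfolding y' g(2) z(2) by force
  qed
  moreover have "inj_on (map_prod \<Phi> \<Phi>) (involution_pairs n e)"
  proof (rule inj_on_subset)
    show "inj_on (map_prod \<Phi> \<Phi>) (local_monoid n e \<times> local_monoid n e)"
      by (intro map_prod_inj_on local_iso_inj[OF \<Phi>])
    show "involution_pairs n e \<subseteq> local_monoid n e \<times> local_monoid n e"
      using zl unfolding involution_pairs_def by auto
  qed
  ultimately show ?thesis using card_image by metis
qed

subsection \<open>Order-preserving idempotents\<close>

definition lin_idems :: "nat \<Rightarrow> nat \<Rightarrow> (nat \<Rightarrow> nat) set" where
  "lin_idems m j = {f \<in> {1..m} \<rightarrow>\<^sub>E {1..m}. mono_on {1..m} f \<and> (\<forall>i\<in>{1..m}. f (f i) = f i) \<and> card (f ` {1..m}) = j}"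

text \<open>The last kernel class of an order-preserving \<open>f\<close> is
  \<open>{last_start m f + 1..m}\<close>: the number is the length of the part before that class,
  not its first point.\<close>

definition last_start :: "nat \<Rightarrow> (nat \<Rightarrow> nat) \<Rightarrow> nat" where
  "last_start m f = card {x \<in> {1..m}. f x \<noteq> f m}"

lemma finite_lin_idems: "finite (lin_idems m j)"
  unfolding lin_idems_def by (rule finite_subset[of _ "{1..m} \<rightarrow>\<^sub>E {1..m}"]) (auto simp: finite_PiE)

lemma down_closed_eq:
  assumes "S \<subseteq> {1..m::nat}" "\<And>x y. y \<in> S \<Longrightarrow> 1 \<le> x \<Longrightarrow> x \<le> y \<Longrightarrow> x \<in> S"
  shows "S = {1..card S}"
proof (cases "S = {}")
  case False
  have fin: "finite S" using assms(1) by (rule finite_subset) simp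
  have "S = {1..Max S}"
  proof (intro equalityI subsetI)
    fix x assume "x \<in> S"
    then show "x \<in> {1..Max S}" using assms(1) fin by auto
  next
    fix x assume "x \<in> {1..Max S}"
    then show "x \<in> S" using assms(2)[OF Max_in[OF fin False], of x] by simp
  qed
  then have "card S = Max S" by (metis card_atLeastAtMost diff_Suc_1)
  then show ?thesis using \<open>S = {1..Max S}\<close> by simp
qed simp

text \<open>An idempotent maps every kernel class into itself. So \<open>f m\<close> lies in the
  last class, and cutting that class off leaves an order-preserving idempotent of rank one less on
  the points before it.\<close>

lemma lin_idems_last_block:
  assumes "f \<in> lin_idems m (Suc j)"
  shows "{x \<in> {1..m}. f x \<noteq> f m} = {1..last_start m f}" "last_start m f < m"
    "f m \<in> {last_start m f + 1..m}" "restrict f {1..last_start m f} \<in> lin_idems (last_start m f) j"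
proof -
  define a where "a = last_start m f"
  have f: "\<And>i. i \<in> {1..m} \<Longrightarrow> f i \<in> {1..m}" "mono_on {1..m} f"
    "\<And>i. i \<in> {1..m} \<Longrightarrow> f (f i) = f i" "card (f ` {1..m}) = Suc j"
    using assms unfolding lin_idems_def by auto
  have m: "m > 0" using f(4) by (cases m) auto
  then have mm: "m \<in> {1..m}" by simp
  have S: "{x \<in> {1..m}. f x \<noteq> f m} = {1..a}"
    unfolding a_def last_start_def
  proof (rule down_closed_eq)
    fix x y assume y: "y \<in> {x \<in> {1..m}. f x \<noteq> f m}" and x: "1 \<le> x" "x \<le> y"
    have "f x \<le> f y" "f y \<le> f m" using x y by (auto intro!: mono_onD[OF f(2)])
    then show "x \<in> {x \<in> {1..m}. f x \<noteq> f m}" using x y by auto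
  qed blast
  show "{x \<in> {1..m}. f x \<noteq> f m} = {1..last_start m f}" using S unfolding a_def .
  have notin: "x \<le> a \<longleftrightarrow> f x \<noteq> f m" if "x \<in> {1..m}" for x
  proof -
    have "x \<in> {1..a} \<longleftrightarrow> f x \<noteq> f m" unfolding S[symmetric] using that by simp
    then show ?thesis using that by simp
  qed
  have am: "a < m" using notin[OF mm] by simp
  then show "last_start m f < m" unfolding a_def .
  have fm: "f m \<in> {1..m}" by (rule f(1)[OF mm])
  have fma: "f m > a" using notin[OF fm] f(3)[OF mm] by simp
  then show "f m \<in> {last_start m f + 1..m}" using fm unfolding a_def by simp
  have fa: "f x \<in> {1..a}" if "x \<in> {1..a}" for x
  proof -
    have xm: "x \<in> {1..m}" using that am by simp
    have "f (f x) \<noteq> f m" using notin[OF xm] that f(3)[OF xm] by simp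
    then show ?thesis using notin[OF f(1)[OF xm]] f(1)[OF xm] by simp
  qed
  have "f ` {1..m} = insert (f m) (f ` {1..a})"
  proof (intro equalityI subsetI)
    fix y assume "y \<in> f ` {1..m}"
    then obtain x where "x \<in> {1..m}" "y = f x" by blast
    then show "y \<in> insert (f m) (f ` {1..a})" using notin[of x] by auto
  next
    fix y assume "y \<in> insert (f m) (f ` {1..a})"
    then show "y \<in> f ` {1..m}" using mm am by auto
  qed
  moreover have "f m \<notin> f ` {1..a}" using fa fma by fastforce
  ultimately have "card (f ` {1..a}) = j" using f(4) by simp
  moreover have "restrict f {1..a} ` {1..a} = f ` {1..a}" by simp
  moreover have "mono_on {1..a} (restrict f {1..a})"
    using am by (intro mono_onI) (auto intro!: mono_onD[OF f(2)])
  moreover have "f (f i) = f i" if "i \<in> {1..a}" for i using that am f(3) by simp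
  ultimately show "restrict f {1..last_start m f} \<in> lin_idems (last_start m f) j"
    unfolding lin_idems_def a_def[symmetric] using fa by (auto simp: restrict_apply')
qed

definition glue :: "nat \<Rightarrow> nat \<Rightarrow> (nat \<Rightarrow> nat) \<Rightarrow> nat \<Rightarrow> nat \<Rightarrow> nat" where
  "glue m a g p = restrict (\<lambda>x. if x \<le> a then g x else p) {1..m}"

lemma glue_lin_idems:
  assumes "a < m" "g \<in> lin_idems a j" "p \<in> {a + 1..m}"
  shows "glue m a g p \<in> lin_idems m (Suc j)" "last_start m (glue m a g p) = a"
    "restrict (glue m a g p) {1..a} = g" "glue m a g p m = p"
proof -
  have g: "\<And>i. i \<in> {1..a} \<Longrightarrow> g i \<in> {1..a}" "mono_on {1..a} g"
    "\<And>i. i \<in> {1..a} \<Longrightarrow> g (g i) = g i" "card (g ` {1..a}) = j" "g \<in> extensional {1..a}"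
    using assms unfolding lin_idems_def by (auto simp: PiE_iff)
  define f where "f = glue m a g p"
  have f1: "f x = g x" if "x \<in> {1..a}" for x using that assms(1) unfolding f_def glue_def by simp
  have f2: "f x = p" if "x \<in> {a + 1..m}" for x using that unfolding f_def glue_def by simp
  have split: "{1..m} = {1..a} \<union> {a + 1..m}" using assms(1) by auto
  have fin: "f x \<in> {1..m}" if "x \<in> {1..m}" for x
    using that f1[of x] f2[of x] g(1)[of x] assms unfolding split by auto
  have fm: "f m = p" using f2[of m] assms(1) by simp
  then show "glue m a g p m = p" unfolding f_def .
  have im: "f ` {1..m} = insert p (g ` {1..a})"
  proof -
    have "f ` {1..a} = g ` {1..a}" using f1 by (intro image_cong) auto
    moreover have "f ` {a + 1..m} = {p}" using f2 assms(1) by force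
    ultimately show ?thesis unfolding split image_Un by simp
  qed
  moreover have "p \<notin> g ` {1..a}" using g(1) assms(3) by fastforce
  ultimately have "card (f ` {1..m}) = Suc j" using g(4) by simp
  moreover have "mono_on {1..m} f"
  proof (rule mono_onI)
    fix x y assume xy: "x \<in> {1..m}" "y \<in> {1..m}" "x \<le> y"
    show "f x \<le> f y"
    proof (cases "y \<le> a")
      case True
      then show ?thesis using xy f1[of x] f1[of y] mono_onD[OF g(2), of x y] by simp
    next
      case False
      then have "f y = p" using f2[of y] xy by simp
      then show ?thesis using f1[of x] f2[of x] g(1)[of x] xy assms(3) by (cases "x \<le> a") simp_all
    qed
  qed
  moreover have "f (f x) = f x" if "x \<in> {1..m}" for x
  proof (cases "x \<le> a")
    case True
    then have x: "x \<in> {1..a}" using that by simp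
    then show ?thesis using f1[OF x] f1[OF g(1)[OF x]] g(3)[OF x] by simp
  next
    case False
    then have "f x = p" using f2[of x] that by simp
    then show ?thesis using f2[OF assms(3)] by simp
  qed
  moreover have "f \<in> extensional {1..m}" unfolding f_def glue_def by simp
  ultimately show "glue m a g p \<in> lin_idems m (Suc j)"
    unfolding f_def[symmetric] lin_idems_def using fin by (simp add: PiE_iff)
  have "{x \<in> {1..m}. f x \<noteq> f m} = {1..a}"
  proof (intro equalityI subsetI)
    fix x assume x: "x \<in> {x \<in> {1..m}. f x \<noteq> f m}"
    then show "x \<in> {1..a}" using f2[of x] fm by (cases "x \<le> a") simp_all
  next
    fix x assume x: "x \<in> {1..a}"
    then show "x \<in> {x \<in> {1..m}. f x \<noteq> f m}" using f1[OF x] g(1)[OF x] fm assms by auto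
  qed
  then show "last_start m (glue m a g p) = a" unfolding f_def[symmetric] last_start_def by simp
  show "restrict (glue m a g p) {1..a} = g"
    unfolding f_def[symmetric]
  proof (rule extensionalityI[OF restrict_extensional g(5)])
    show "restrict f {1..a} x = g x" if "x \<in> {1..a}" for x using f1[OF that] that by simp
  qed
qed

lemma glue_last_start:
  assumes "f \<in> lin_idems m (Suc j)"
  shows "glue m (last_start m f) (restrict f {1..last_start m f}) (f m) = f"
proof (rule extensionalityI[of _ "{1..m}"])
  note S = lin_idems_last_block[OF assms]
  show "f \<in> extensional {1..m}" using assms unfolding lin_idems_def by (auto simp: PiE_iff)
  fix x assume x: "x \<in> {1..m}"
  have "x \<in> {x \<in> {1..m}. f x \<noteq> f m} \<longleftrightarrow> x \<in> {1..last_start m f}" unfolding S(1) ..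
  then show "glue m (last_start m f) (restrict f {1..last_start m f}) (f m) x = f x"
    using x unfolding glue_def by auto
qed (simp add: glue_def)

text \<open>Cutting off the last class is inverted by \<open>glue\<close>: \<open>a\<close> points
  remain before it, and its value is any of \<open>m - a\<close> points. The weight \<open>h\<close>
  is 1 for plain counting and \<open>m - a\<close> later, where it counts rotations.\<close>

lemma sum_lin_idems:
  fixes h :: "nat \<Rightarrow> nat"
  shows "(\<Sum>f\<in>lin_idems m (Suc j). h (last_start m f)) = (\<Sum>a<m. card (lin_idems a j) * ((m - a) * h a))"
proof -
  let ?D = "SIGMA a : {..<m}. lin_idems a j \<times> {a + 1..m}"
  let ?glue = "\<lambda>x. glue m (fst x) (fst (snd x)) (snd (snd x))"
  let ?cut = "\<lambda>f. (last_start m f, restrict f {1..last_start m f}, f m)"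
  have "(\<Sum>f\<in>lin_idems m (Suc j). h (last_start m f)) = (\<Sum>x\<in>?D. h (fst x))"
  proof (rule sum.reindex_bij_witness[where i = ?glue and j = ?cut])
    fix f assume f: "f \<in> lin_idems m (Suc j)"
    show "?cut f \<in> ?D"
      using lin_idems_last_block(2-4)[OF f] by simp
    show "?glue (?cut f) = f" using glue_last_start[OF f] by simp
  next
    fix x assume "x \<in> ?D"
    then obtain a g p where x: "x = (a, g, p)" and agp: "a < m" "g \<in> lin_idems a j" "p \<in> {a + 1..m}" by auto
    note gl = glue_lin_idems[OF agp]
    show "?glue x \<in> lin_idems m (Suc j)" unfolding x using gl(1) by simp
    show "?cut (?glue x) = x"
      unfolding x using gl by simp
  qed simp
  also have "\<dots> = (\<Sum>a<m. \<Sum>y\<in>lin_idems a j \<times> {a + 1..m}. h a)"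
    by (subst sum.Sigma) (auto simp: finite_lin_idems split_def)
  also have "\<dots> = (\<Sum>a<m. card (lin_idems a j) * ((m - a) * h a))"
    by (simp add: card_cartesian_product mult.assoc)
  finally show ?thesis .
qed

section \<open>Hockey-stick sums and the number of order-preserving idempotents\<close>

lemma sum_choose_shift: "(\<Sum>a\<le>m. (a + j) choose (2 * j + 1)) = (m + j + 1) choose (2 * j + 2)"
  by (induction m) simp_all

text \<open>Raising \<open>m\<close> by one adds the unweighted sum, so this is a twofold
  hockey-stick summation, which raises the lower index by two.\<close>

lemma sum_choose_weighted:
  "(\<Sum>a<m. ((a + j) choose (2 * j + 1)) * (m - a)) = (m + j + 1) choose (2 * j + 3)"
proof (induction m)
  case (Suc m)
  have "(\<Sum>a<Suc m. ((a + j) choose (2 * j + 1)) * (Suc m - a))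
    = (\<Sum>a<Suc m. ((a + j) choose (2 * j + 1)) * (m - a) + ((a + j) choose (2 * j + 1)))"
    by (intro sum.cong refl) (simp add: Suc_diff_le)
  also have "\<dots> = (\<Sum>a<m. ((a + j) choose (2 * j + 1)) * (m - a)) + (\<Sum>a\<le>m. (a + j) choose (2 * j + 1))"
    by (simp add: sum.distrib lessThan_Suc_atMost[symmetric])
  also have "\<dots> = (Suc m + j + 1) choose (2 * j + 3)"
    unfolding Suc.IH sum_choose_shift by (simp add: numeral_3_eq_3)
  finally show ?case .
qed simp

text \<open>The recursion over the last class is the weighted binomial sum. It starts from rank
  zero, which only the empty map on no points has.\<close>

lemma card_lin_idems: "card (lin_idems m (Suc j)) = (m + j) choose (2 * j + 1)"
proof (induction j arbitrary: m)
  case 0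
  have "card (lin_idems 0 0) = 1" unfolding lin_idems_def by simp
  moreover have "lin_idems a 0 = {}" if "a > 0" for a
    using that unfolding lin_idems_def by (auto simp: card_eq_0_iff)
  ultimately have c: "card (lin_idems a 0) = (if a = 0 then 1 else 0)" for a by simp
  have "card (lin_idems m (Suc 0)) = (\<Sum>a<m. card (lin_idems a 0) * (m - a))"
    using sum_lin_idems[of "\<lambda>_. 1" m 0] by simp
  also have "\<dots> = (\<Sum>a<m. if a = 0 then m else 0)" unfolding c by (intro sum.cong) auto
  also have "\<dots> = m" by (simp add: sum.delta)
  finally show ?case by simp
next
  case (Suc j)
  have "card (lin_idems m (Suc (Suc j))) = (\<Sum>a<m. card (lin_idems a (Suc j)) * (m - a))"
    using sum_lin_idems[of "\<lambda>_. 1" m "Suc j"] by simp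
  also have "\<dots> = (m + j + 1) choose (2 * j + 3)" unfolding Suc.IH by (rule sum_choose_weighted)
  finally show ?case by (simp add: numeral_3_eq_3)
qed

subsection \<open>Idempotents of given rank\<close>

definition rot_conj :: "nat \<Rightarrow> int \<Rightarrow> (nat \<Rightarrow> nat) \<Rightarrow> nat \<Rightarrow> nat" where
  "rot_conj n s f = dih n 1 (- s) \<odot>[n] f \<odot>[n] dih n 1 s"

abbreviation idems_rank :: "nat \<Rightarrow> nat \<Rightarrow> (nat \<Rightarrow> nat) set" where
  "idems_rank n k \<equiv> {e \<in> idems n. card (e ` {1..n}) = k}"

lemma rot_conj_OR: "n > 0 \<Longrightarrow> f \<in> carrier (OR n) \<Longrightarrow> rot_conj n s f \<in> carrier (OR n)"
  unfolding rot_conj_def by (simp add: mult_in_OR)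

lemma rot_conj_res:
  assumes "n > 0" "f \<in> carrier (OR n)"
  shows "rot_conj n s f (res n x) = res n (int (f (res n (x - s))) + s)"
proof -
  have "rot_conj n s f (res n x) = dih n 1 s (f (res n (x - s)))"
    unfolding rot_conj_def using assms(1) by simp
  also have "f (res n (x - s)) = res n (int (f (res n (x - s))))"
    using OR_res_in[OF assms, of "x - s"] by simp
  finally show ?thesis using assms(1) by (simp del: res_int)
qed

lemma rot_conj_inverse:
  assumes "n > 0" "f \<in> carrier (OR n)"
  shows "rot_conj n (- s) (rot_conj n s f) = f"
proof -
  interpret monoid "OR n" by (rule monoid_OR[OF assms(1)])
  have P: "dih n 1 c \<in> carrier (OR n)" for c using assms(1) by simp
  have 1: "dih n 1 s \<odot>[n] dih n 1 (- s) = \<one>\<^bsub>OR n\<^esub>"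
    using assms(1) by (simp add: dih_mult dih_one)
  have "rot_conj n (- s) (rot_conj n s f)
    = (dih n 1 s \<odot>[n] dih n 1 (- s)) \<odot>[n] f \<odot>[n] (dih n 1 s \<odot>[n] dih n 1 (- s))"
    unfolding rot_conj_def using assms(2) P by (simp add: m_assoc)
  then show ?thesis unfolding 1 using assms(2) by simp
qed

lemma rot_conj_idem:
  assumes "n > 0" "e \<in> idems n"
  shows "rot_conj n s e \<in> idems n"
proof -
  interpret monoid "OR n" by (rule monoid_OR[OF assms(1)])
  have P: "dih n 1 c \<in> carrier (OR n)" for c using assms(1) by simp
  have e: "e \<in> carrier (OR n)" "e \<odot>[n] e = e" using assms(2) unfolding idems_def by simp_all
  have 1: "dih n 1 s \<odot>[n] dih n 1 (- s) = \<one>\<^bsub>OR n\<^esub>"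
    using assms(1) by (simp add: dih_mult dih_one)
  have "rot_conj n s e \<odot>[n] rot_conj n s e
    = dih n 1 (- s) \<odot>[n] e \<odot>[n] (dih n 1 s \<odot>[n] dih n 1 (- s)) \<odot>[n] e \<odot>[n] dih n 1 s"
    unfolding rot_conj_def using e(1) P by (simp add: m_assoc)
  also have "\<dots> = dih n 1 (- s) \<odot>[n] (e \<odot>[n] e) \<odot>[n] dih n 1 s"
    unfolding 1 using e(1) P by (simp add: m_assoc)
  finally show ?thesis unfolding e(2) idems_def using rot_conj_OR[OF assms(1) e(1)]
    by (simp add: rot_conj_def)
qed

lemma rot_conj_rank:
  assumes "n > 0" "f \<in> carrier (OR n)"
  shows "card (rot_conj n s f ` {1..n}) = card (f ` {1..n})"
proof -
  have D: "dih n 1 c ` {1..n} = {1..n}" for c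
  proof (rule endo_inj_surj)
    show "dih n 1 c ` {1..n} \<subseteq> {1..n}" using OR_apply_in[OF dih_in_OR[OF assms(1), of 1 c]] by blast
    show "inj_on (dih n 1 c) {1..n}" using assms(1) by (intro inj_on_dih) simp_all
  qed simp
  have "rot_conj n s f i = dih n 1 s (f (dih n 1 (- s) i))" if "i \<in> {1..n}" for i
    unfolding rot_conj_def using that by simp
  then have "rot_conj n s f ` {1..n} = (\<lambda>i. dih n 1 s (f (dih n 1 (- s) i))) ` {1..n}" by (rule image_cong[OF refl])
  also have "\<dots> = dih n 1 s ` f ` dih n 1 (- s) ` {1..n}" by (simp add: image_image)
  also have "\<dots> = dih n 1 s ` f ` {1..n}" unfolding D ..
  also have "card \<dots> = card (f ` {1..n})"
  proof (rule card_image, rule inj_on_subset)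
    show "inj_on (dih n 1 s) {1..n}" using assms(1) by (intro inj_on_dih) simp_all
    show "f ` {1..n} \<subseteq> {1..n}" using OR_apply_in[OF assms(2)] by blast
  qed
  finally show ?thesis .
qed

lemma lin_idems_idems:
  assumes "n > 0" "f \<in> lin_idems n k"
  shows "f \<in> idems n" "card (f ` {1..n}) = k"
proof -
  have f: "f \<in> {1..n} \<rightarrow>\<^sub>E {1..n}" "mono_on {1..n} f" "\<And>i. i \<in> {1..n} \<Longrightarrow> f (f i) = f i" "card (f ` {1..n}) = k"
    using assms(2) unfolding lin_idems_def by auto
  have "restrict f {1..n} \<in> carrier (OR n)"
    using f(1) by (intro mono_in_OR[OF assms(1)] mono_onD[OF f(2)]) auto
  moreover have "restrict f {1..n} = f" using f(1) by (intro extensional_restrict) (auto simp: PiE_iff)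
  ultimately have c: "f \<in> carrier (OR n)" by simp
  have "f \<odot>[n] f = f" by (rule OR_eqI[OF mult_in_OR[OF assms(1) c c] c]) (simp add: f(3))
  then show "f \<in> idems n" unfolding idems_def using c by simp
  show "card (f ` {1..n}) = k" by (rule f(4))
qed

lemma res_0: "n > 0 \<Longrightarrow> res n 0 = n"
  using res_add_period[of n 0] res_int[of n n] by simp

lemma lin_idems_rank_ge2:
  assumes "n > 0" "k \<ge> 2" "f \<in> lin_idems n k"
  shows "1 \<le> last_start n f" "last_start n f < n" "f 1 \<noteq> f n"
    "\<And>x. x \<in> {1..n} \<Longrightarrow> f x = f n \<longleftrightarrow> last_start n f < x"
proof -
  obtain j where k: "k = Suc j" "j \<ge> 1" using assms(2) by (cases k) auto
  note B = lin_idems_last_block[OF assms(3)[unfolded k(1)]]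
  show mem: "f x = f n \<longleftrightarrow> last_start n f < x" if "x \<in> {1..n}" for x
  proof -
    have "x \<in> {x \<in> {1..n}. f x \<noteq> f n} \<longleftrightarrow> x \<in> {1..last_start n f}" unfolding B(1) ..
    then show ?thesis using that by auto
  qed
  have "card (restrict f {1..last_start n f} ` {1..last_start n f}) = j" using B(4) unfolding lin_idems_def by simp
  then show 1: "1 \<le> last_start n f" using k(2) by (cases "last_start n f") auto
  show "last_start n f < n" by (rule B(2))
  show "f 1 \<noteq> f n" using mem[of 1] 1 assms(1) by simp
qed

text \<open>The shift \<open>s\<close> is recovered from \<open>rot_conj n s f\<close> as the number of points
  that follow \<open>n\<close> in its kernel class.\<close>

lemma rot_conj_shift:
  assumes "n > 0" "k \<ge> 2" "f \<in> lin_idems n k" "s < n - last_start n f"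
  shows "\<And>t. t \<le> s \<Longrightarrow> rot_conj n (int s) f (res n (int t)) = rot_conj n (int s) f (res n 0)"
    "rot_conj n (int s) f (res n (int s + 1)) \<noteq> rot_conj n (int s) f (res n 0)"
proof -
  note L = lin_idems_rank_ge2[OF assms(1-3)]
  have f: "f \<in> carrier (OR n)" using lin_idems_idems(1)[OF assms(1,3)] unfolding idems_def by simp
  have val: "rot_conj n (int s) f (res n (int t)) = res n (int (f n) + int s)" if t: "t \<le> s" for t
  proof -
    have "res n (int t - int s) = res n (int t - int s + int n)" using assms(1) by simp
    also have "int t - int s + int n = int (n - s + t)" using assms(4) by (simp add: of_nat_diff)
    also have "res n (int (n - s + t)) = n - s + t" using t assms(4) by (intro res_int) auto
    finally have "f (res n (int t - int s)) = f (n - s + t)" by simp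
    also have "\<dots> = f n"
    proof -
      have "n - s + t \<in> {1..n}" "last_start n f < n - s + t"
        unfolding atLeastAtMost_iff using t assms(4) by arith+
      then show ?thesis using L(4) by blast
    qed
    finally show ?thesis unfolding rot_conj_res[OF assms(1) f] by simp
  qed
  then have v0: "rot_conj n (int s) f (res n 0) = res n (int (f n) + int s)" using val[of 0] by simp
  show "rot_conj n (int s) f (res n (int t)) = rot_conj n (int s) f (res n 0)" if "t \<le> s" for t
    using val[OF that] v0 by simp
  have n1: "1 \<in> {1..n}" "n \<in> {1..n}" using assms(1) by simp_all
  show "rot_conj n (int s) f (res n (int s + 1)) \<noteq> rot_conj n (int s) f (res n 0)"
  proof
    assume *: "rot_conj n (int s) f (res n (int s + 1)) = rot_conj n (int s) f (res n 0)"
    have "res n 1 = 1" using res_int[OF n1(1)] by simp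
    then have "rot_conj n (int s) f (res n (int s + 1)) = res n (int (f 1) + int s)"
      unfolding rot_conj_res[OF assms(1) f] by simp
    then have "res n (int (f 1) + int s) = res n (int (f n) + int s)" using * v0 by simp
    then have "res n (int (f 1)) = res n (int (f n))" using assms(1) by (simp only: res_eq_iff) simp
    then show False using OR_apply_in[OF f n1(1)] OR_apply_in[OF f n1(2)] L(3) by simp
  qed
qed

text \<open>Rotating back by the number \<open>s\<close> of points that follow \<open>n\<close> in
  its kernel class makes this class end at \<open>n\<close>, so that no class wraps around. Classes
  are then intervals which the idempotent maps into themselves, and this forces monotonicity. Rank
  at least two ensures that the class of \<open>n\<close> ends somewhere.\<close>

lemma idem_normal_form:
  assumes "n > 0" "k \<ge> 2" "e \<in> idems n" "card (e ` {1..n}) = k"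
  obtains f s where "f \<in> lin_idems n k" "s < n - last_start n f" "e = rot_conj n (int s) f"
proof -
  have ec: "e \<in> carrier (OR n)" using assms(3) unfolding idems_def by simp
  have "\<exists>t. e (res n (int t + 1)) \<noteq> e (res n 0)"
  proof (rule ccontr)
    assume *: "\<not> ?thesis"
    have "e i = e (res n 0)" if i: "i \<in> {1..n}" for i
    proof -
      have "int (i - 1) + 1 = int i" using i by (simp add: of_nat_diff)
      then show ?thesis using * i by (metis res_int)
    qed
    then have "e ` {1..n} \<subseteq> {e (res n 0)}" by blast
    then have "card (e ` {1..n}) \<le> 1" using card_mono[of "{e (res n 0)}"] by simp
    then show False using assms(2,4) by simp
  qed
  define s where "s = (LEAST t. e (res n (int t + 1)) \<noteq> e (res n 0))"
  have s1: "e (res n (int s + 1)) \<noteq> e (res n 0)"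
    unfolding s_def by (rule LeastI_ex) fact
  have s0: "e (res n (int t)) = e (res n 0)" if "t \<le> s" for t
  proof (cases t)
    case (Suc r)
    then have "\<not> e (res n (int r + 1)) \<noteq> e (res n 0)" using that unfolding s_def by (intro not_less_Least) simp
    then show ?thesis using Suc by (simp add: add.commute)
  qed simp
  have sn: "s < n"
  proof (rule ccontr)
    assume "\<not> s < n"
    then have "s - n + 1 \<le> s" "int s + 1 = int (s - n + 1) + int n" using assms(1) by auto
    then have "res n (int s + 1) = res n (int (s - n + 1))" using assms(1) by (simp only: res_add_period)
    then show False using s0[OF \<open>s - n + 1 \<le> s\<close>] s1 by (simp only:)
  qed
  define f where "f = rot_conj n (- int s) e"
  have fi: "f \<in> idems n" unfolding f_def by (rule rot_conj_idem[OF assms(1,3)])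
  have fc: "f \<in> carrier (OR n)" "f \<odot>[n] f = f" using fi unfolding idems_def by simp_all
  have rank: "card (f ` {1..n}) = k" unfolding f_def rot_conj_rank[OF assms(1) ec] by (rule assms(4))
  have ef: "e = rot_conj n (int s) f" unfolding f_def using rot_conj_inverse[OF assms(1) ec, of "- int s"] by simp
  have fres: "f (res n x) = res n (int (e (res n (x + int s))) - int s)" for x
    unfolding f_def rot_conj_res[OF assms(1) ec] by simp
  have wrap: "f (res n (- int t)) = f n" if "t \<le> s" for t
  proof -
    have "f (res n (- int t)) = res n (int (e (res n (int (s - t)))) - int s)"
      unfolding fres using that by (simp add: of_nat_diff)
    also have "e (res n (int (s - t))) = e (res n (int s))" using s0[of "s - t"] s0[of s] by simp
    also have "res n (int (e (res n (int s))) - int s) = f (res n 0)" unfolding fres by simp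
    finally show ?thesis unfolding res_0[OF assms(1)] .
  qed
  have f1n: "f (res n 1) \<noteq> f (res n 0)"
  proof
    assume "f (res n 1) = f (res n 0)"
    then have "res n (int (e (res n (1 + int s)))) = res n (int (e (res n (int s))))"
      unfolding fres using assms(1) by (simp only: res_eq_iff) simp
    then have "e (res n (1 + int s)) = e (res n (int s))"
      using OR_res_in[OF assms(1) ec] by simp
    then show False using s1 s0[of s] by (simp add: add.commute)
  qed
  \<comment> \<open>A class containing \<open>x\<close> and \<open>z\<close> contains what lies
    between them: the complementary arc would contain \<open>n\<close> and its successor 1, which
    are in different classes.\<close>
  have conv: "f y = f x" if "1 \<le> x" "x \<le> y" "y \<le> z" "z \<le> n" "f x = f z" for x y z
  proof -
    have i: "x \<in> {1..n}" "y \<in> {1..n}" "z \<in> {1..n}" using that by auto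
    have eq: "f (res n (int x)) = f (res n (int z))" using that i by simp
    have "(\<forall>w\<in>{int x..int z}. f (res n w) = f (res n (int x))) \<or>
        (\<forall>w\<in>{int z..int x + int n}. f (res n w) = f (res n (int x)))"
      using that assms(1) eq by (intro oriented_arc[OF OR_oriented[OF assms(1) fc(1)] assms(1)]) simp_all
    then show ?thesis
    proof
      assume *: "\<forall>w\<in>{int x..int z}. f (res n w) = f (res n (int x))"
      have "f (res n (int y)) = f (res n (int x))" by (rule bspec[OF *]) (use that in simp)
      then show ?thesis using i by simp
    next
      assume *: "\<forall>w\<in>{int z..int x + int n}. f (res n w) = f (res n (int x))"
      have "f (res n (0 + int n)) = f (res n (int x))" by (rule bspec[OF *]) (use that in simp)
      moreover have "f (res n (1 + int n)) = f (res n (int x))" by (rule bspec[OF *]) (use that in simp)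
      ultimately have "f (res n 1) = f (res n 0)" using res_add_period[OF assms(1)] by metis
      then show ?thesis using f1n by simp
    qed
  qed
  have ff: "f (f x) = f x" if "x \<in> {1..n}" for x
    using idempotent_fix[OF fc(2), of "f x"] that by blast
  have fin: "f x \<in> {1..n}" if "x \<in> {1..n}" for x by (rule OR_apply_in[OF fc(1) that])
  \<comment> \<open>A violation \<open>f y < f x\<close> gives \<open>f y \<le> x \<le> y\<close> or
    \<open>x < f y < f x\<close>. The outer points then share a class, so by convexity the middle
    one does too, and \<open>f x = f y\<close>.\<close>
  have mono: "f x \<le> f y" if x: "x \<in> {1..n}" and y: "y \<in> {1..n}" and xy: "x \<le> y" for x y
  proof (rule ccontr)
    assume "\<not> f x \<le> f y"
    then have gt: "f y < f x" by simp
    show False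
    proof (cases "f y \<le> x")
      case True
      have "f x = f (f y)" using True xy fin[OF y] y ff[OF y] by (intro conv[of "f y" x y]) auto
      then show False using ff[OF y] gt by simp
    next
      case False
      have "f (f y) = f x" using False gt fin[OF x] x ff[OF x] by (intro conv[of x "f y" "f x"]) auto
      then show False using ff[OF y] gt by simp
    qed
  qed
  have fl: "f \<in> lin_idems n k"
    unfolding lin_idems_def
  proof (intro CollectI conjI ballI)
    show "f \<in> {1..n} \<rightarrow>\<^sub>E {1..n}" using fc(1) unfolding OR_def by simp
    show "mono_on {1..n} f" using mono by (rule mono_onI)
  qed (use ff rank in simp_all)
  have "s < n - last_start n f"
  proof -
    have "res n (- int s) = res n (int (n - s))" using assms(1) sn by (simp add: res_eq_iff of_nat_diff)
    also have "\<dots> = n - s" using sn by (intro res_int) auto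
    finally have "f (n - s) = f n" using wrap[of s] by simp
    then have "last_start n f < n - s" using lin_idems_rank_ge2(4)[OF assms(1,2) fl, of "n - s"] sn by simp
    then show ?thesis by simp
  qed
  then show thesis using fl ef by (intro that)
qed

lemma card_idems_rank:
  assumes "n > 0" "k \<ge> 2"
  shows "card (idems_rank n k) = (\<Sum>f\<in>lin_idems n k. n - last_start n f)"
proof -
  let ?D = "SIGMA f : lin_idems n k. {0..<n - last_start n f}"
  have "bij_betw (\<lambda>(f, s). rot_conj n (int s) f) ?D (idems_rank n k)"
  proof (rule bij_betw_imageI)
    show "inj_on (\<lambda>(f, s). rot_conj n (int s) f) ?D"
    proof (rule inj_onI)
      fix x y assume x: "x \<in> ?D" and y: "y \<in> ?D"
        and e: "(\<lambda>(f, s). rot_conj n (int s) f) x = (\<lambda>(f, s). rot_conj n (int s) f) y"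
      obtain f s where xf: "x = (f, s)" by (cases x)
      obtain g t where yg: "y = (g, t)" by (cases y)
      have f: "f \<in> lin_idems n k" "s < n - last_start n f" and g: "g \<in> lin_idems n k" "t < n - last_start n g"
        using x y unfolding xf yg by simp_all
      have eq: "rot_conj n (int s) f = rot_conj n (int t) g" using e unfolding xf yg by simp
      note F = rot_conj_shift[OF assms f] and G = rot_conj_shift[OF assms g]
      have "\<not> s < t"
      proof
        assume "s < t"
        then have "rot_conj n (int t) g (res n (int (Suc s))) = rot_conj n (int t) g (res n 0)" by (intro G(1)) simp
        then show False using F(2) unfolding eq by (simp add: add.commute)
      qed
      moreover have "\<not> t < s"
      proof
        assume "t < s"
        then have "rot_conj n (int s) f (res n (int (Suc t))) = rot_conj n (int s) f (res n 0)" by (intro F(1)) simp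
        then show False using G(2) unfolding eq by (simp add: add.commute)
      qed
      ultimately have st: "s = t" by simp
      have "f \<in> carrier (OR n)" "g \<in> carrier (OR n)"
        using lin_idems_idems(1)[OF assms(1)] f(1) g(1) unfolding idems_def by auto
      then have "f = g" using eq unfolding st using rot_conj_inverse[OF assms(1)] by metis
      then show "x = y" unfolding xf yg using st by simp
    qed
    show "(\<lambda>(f, s). rot_conj n (int s) f) ` ?D = idems_rank n k"
    proof (intro equalityI subsetI)
      fix e assume "e \<in> (\<lambda>(f, s). rot_conj n (int s) f) ` ?D"
      then obtain f s where f: "f \<in> lin_idems n k" and e: "e = rot_conj n (int s) f" by auto
      note fi = lin_idems_idems[OF assms(1) f]
      show "e \<in> idems_rank n k"
        unfolding e using rot_conj_idem[OF assms(1) fi(1)] rot_conj_rank[OF assms(1) idems_OR[OF fi(1)]] fi(2) by simp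
    next
      fix e assume "e \<in> idems_rank n k"
      then have "e \<in> idems n" "card (e ` {1..n}) = k" by simp_all
      then obtain f s where "f \<in> lin_idems n k" "s < n - last_start n f" "e = rot_conj n (int s) f"
        using idem_normal_form[OF assms] by metis
      then show "e \<in> (\<lambda>(f, s). rot_conj n (int s) f) ` ?D" by (intro image_eqI[of _ _ "(f, s)"]) simp_all
    qed
  qed
  then have "card (idems_rank n k) = card ?D" by (simp add: bij_betw_same_card)
  then show ?thesis by (simp add: finite_lin_idems)
qed

text \<open>With \<open>a = last_start n f\<close>, one factor \<open>n - a\<close> counts the
  values on the last class and the other the admissible rotations.\<close>

lemma card_idems_rank_formula:
  assumes "n > 0" "k \<ge> 2"
  shows "card (idems_rank n k) = (\<Sum>a<n. ((a + k - 2) choose (2 * k - 3)) * (n - a)\<^sup>2)"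
proof -
  obtain j where k: "k = Suc (Suc j)" using assms(2) by (metis Suc_le_D numeral_2_eq_2 Suc_le_mono)
  have "card (idems_rank n k) = (\<Sum>a<n. card (lin_idems a (Suc j)) * ((n - a) * (n - a)))"
    using card_idems_rank[OF assms] sum_lin_idems[of "\<lambda>a. n - a" n "Suc j"] unfolding k by simp
  also have "\<dots> = (\<Sum>a<n. ((a + k - 2) choose (2 * k - 3)) * (n - a)\<^sup>2)"
    unfolding card_lin_idems k by (simp add: power2_eq_square numeral_3_eq_3)
  finally show ?thesis .
qed

text \<open>Rank one is treated apart: the single kernel class is everything, so it has no boundary
  that could be rotated to \<open>n\<close>.\<close>

lemma idems_rank_one:
  assumes "n > 0"
  shows "idems_rank n 1 = cst n ` {1..n}"
proof (intro equalityI subsetI)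
  fix e assume e: "e \<in> idems_rank n 1"
  then obtain p where p: "e ` {1..n} = {p}" by (auto simp: card_1_singleton_iff)
  have ec: "e \<in> carrier (OR n)" using e idems_OR by simp
  have "1 \<in> {1..n}" using assms by simp
  then have "e 1 = p" using p by blast
  then have pn: "p \<in> {1..n}" using OR_apply_in[OF ec \<open>1 \<in> {1..n}\<close>] by simp
  have "e = cst n p"
  proof (rule OR_eqI[OF ec cst_in_OR[OF pn]])
    fix i assume i: "i \<in> {1..n}"
    then have "e i = p" using p by blast
    then show "e i = cst n p i" using i by simp
  qed
  then show "e \<in> cst n ` {1..n}" using pn by blast
next
  fix e assume "e \<in> cst n ` {1..n}"
  then obtain p where p: "p \<in> {1..n}" "e = cst n p" by blast
  have "cst n p \<odot>[n] cst n p = cst n p" using p by (intro mult_cst cst_in_OR)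
  moreover have "cst n p ` {1..n} = {p}" using assms by (force simp: image_iff)
  ultimately show "e \<in> idems_rank n 1" using p unfolding idems_def by simp
qed

lemma card_idems_rank_one:
  assumes "n > 0" shows "card (idems_rank n 1) = n"
proof -
  have "inj_on (cst n) {1..n}"
  proof (rule inj_onI)
    fix p q assume "cst n p = cst n q"
    then have "cst n p 1 = cst n q 1" by simp
    then show "p = q" using assms by simp
  qed
  then show ?thesis unfolding idems_rank_one[OF assms] by (simp add: card_image)
qed

subsection \<open>Reflections absorbed by an idempotent\<close>

lemma involution_pairs_one:
  assumes "n > 0"
  shows "(g, z) \<in> involution_pairs n \<one>\<^bsub>OR n\<^esub> \<longleftrightarrow> g \<in> carrier (OR n) \<and> z \<in> idems n \<and>
    g \<noteq> \<one>\<^bsub>OR n\<^esub> \<and> g \<odot>[n] g = \<one>\<^bsub>OR n\<^esub> \<and> g \<odot>[n] z = z \<and> z \<odot>[n] g = z"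
  unfolding involution_pairs_def local_monoid_one[OF assms] by simp

text \<open>\<open>z \<odot>[n] g = z\<close> makes \<open>g\<close> fix the image of
  \<open>z\<close> pointwise, and a nontrivial dihedral map fixing \<open>p\<close> is the
  reflection in \<open>p\<close>. Then \<open>g \<odot>[n] z = z\<close> makes \<open>z\<close>
  symmetric about \<open>p\<close>.\<close>

lemma involution_pair_reflection:
  assumes "n > 0" "(g, z) \<in> involution_pairs n \<one>\<^bsub>OR n\<^esub>" "p \<in> z ` {1..n}"
  shows "p \<in> {1..n}" "z p = p" "g = dih n (-1) (2 * int p)" "z (res n (2 * int p - x)) = z (res n x)"
proof -
  have gz: "g \<in> carrier (OR n)" "z \<in> carrier (OR n)" "z \<odot>[n] z = z" "g \<noteq> \<one>\<^bsub>OR n\<^esub>"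
    "g \<odot>[n] g = \<one>\<^bsub>OR n\<^esub>" "g \<odot>[n] z = z" "z \<odot>[n] g = z"
    using assms(2) unfolding involution_pairs_one[OF assms(1)] idems_def by simp_all
  show p: "p \<in> {1..n}" using assms(3) OR_apply_in[OF gz(2)] by blast
  show "z p = p" by (rule idempotent_fix[OF gz(3) assms(3)])
  have gp: "g p = p"
  proof -
    obtain i where i: "i \<in> {1..n}" "p = z i" using assms(3) by blast
    have "(z \<odot>[n] g) i = z i" unfolding gz(7) ..
    then show ?thesis using i by simp
  qed
  have "g \<in> units n" by (rule right_inverse_unit[OF assms(1) gz(1,1,5)])
  then obtain s c where s: "s \<in> {1, -1}" and g: "g = dih n s c" using unitsE[OF assms(1)] by metis
  have "dih n s c (res n (int p)) = res n (int p)" using gp p g by simp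
  then have d: "int n dvd s * int p + c - int p" using assms(1) by (simp add: res_eq_iff del: res_int)
  have "s \<noteq> 1"
  proof
    assume "s = 1"
    then have "dih n s c = dih n 1 0" using d by (simp add: dih_cong[OF assms(1)])
    then show False using gz(4) g dih_one[OF assms(1)] by simp
  qed
  then have s1: "s = -1" using s by simp
  show geq: "g = dih n (-1) (2 * int p)"
    unfolding g s1 using d s1 by (intro dih_cong[OF assms(1)]) (simp add: algebra_simps)
  have "(g \<odot>[n] z) (res n x) = z (res n x)" unfolding gz(6) ..
  then show "z (res n (2 * int p - x)) = z (res n x)" using assms(1) unfolding geq by simp
qed

text \<open>On at most two points every reflection that fixes a point is the identity; this is why
  the second sum of the formula starts at rank three.\<close>

lemma involution_pairs_small:
  assumes "n > 0" "n \<le> 2" shows "involution_pairs n \<one>\<^bsub>OR n\<^esub> = {}"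
proof (rule ccontr)
  assume "\<not> ?thesis"
  then obtain g z where gz: "(g, z) \<in> involution_pairs n \<one>\<^bsub>OR n\<^esub>" by (metis ex_in_conv prod.collapse)
  have "z 1 \<in> z ` {1..n}" using assms(1) by simp
  note R = involution_pair_reflection(3)[OF assms(1) gz this]
  have "int n dvd 2"
  proof -
    have "n = 1 \<or> n = 2" using assms by linarith
    then show ?thesis by auto
  qed
  have "g = \<one>\<^bsub>OR n\<^esub>"
    unfolding R dih_one[OF assms(1), symmetric]
  proof (rule OR_res_eqI[of _ n])
    fix x
    have "int n dvd 2 * (int (z 1) - x)" using \<open>int n dvd 2\<close> by simp
    then show "dih n (-1) (2 * int (z 1)) (res n x) = dih n 1 0 (res n x)"
      using assms(1) by (simp add: res_eq_iff algebra_simps)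
  qed (use assms in simp_all)
  then show False using gz unfolding involution_pairs_one[OF assms(1)] by simp
qed

text \<open>The symmetric two-valued idempotent: the arc of radius \<open>j\<close> around \<open>p\<close> goes to \<open>p\<close>,
  its complement to the antipode \<open>p + h\<close>.\<close>

definition arc_idem :: "nat \<Rightarrow> nat \<Rightarrow> nat \<Rightarrow> nat \<Rightarrow> nat" where
  "arc_idem h p j = dih (2 * h) 1 (int j + 1 - int p) \<odot>[2 * h]
     restrict (\<lambda>i. if i \<le> 2 * j + 1 then p else p + h) {1..2 * h}"

lemma arc_idem_OR:
  assumes "p \<in> {1..h}" shows "arc_idem h p j \<in> carrier (OR (2 * h))"
proof -
  have "restrict (\<lambda>i. if i \<le> 2 * j + 1 then p else p + h) {1..2 * h} \<in> carrier (OR (2 * h))"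
    using assms by (intro mono_in_OR) auto
  then show ?thesis unfolding arc_idem_def using assms by (intro mult_in_OR dih_in_OR) simp_all
qed

lemma arc_idem_res:
  assumes "h > 0"
  shows "arc_idem h p j (res (2 * h) x) = (if (x - int p + int j) mod int (2 * h) \<le> 2 * int j then p else p + h)"
proof -
  let ?n = "2 * h"
  have n: "?n > 0" using assms by simp
  let ?r = "res ?n (x + (int j + 1 - int p))"
  have "int ?r = (x - int p + int j) mod int ?n + 1"
  proof -
    have "x + (int j + 1 - int p) - 1 = x - int p + int j" by simp
    then show ?thesis by (simp only: int_res[OF n])
  qed
  then have "?r \<le> 2 * j + 1 \<longleftrightarrow> (x - int p + int j) mod int ?n \<le> 2 * int j" by linarith
  moreover have "arc_idem h p j (res ?n x) = (if ?r \<le> 2 * j + 1 then p else p + h)"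
    unfolding arc_idem_def mult_OR_res[OF n] dih_res[OF n]
    using res_in[OF n, of "x + (int j + 1 - int p)"] by simp
  ultimately show ?thesis by simp
qed

lemma arc_idem_near:
  assumes "j < h" "\<bar>t\<bar> \<le> int j" shows "arc_idem h p j (res (2 * h) (int p + t)) = p"
proof -
  have "(t + int j) mod int (2 * h) = t + int j" using assms by (intro mod_pos_pos_trivial) auto
  then show ?thesis using assms by (subst arc_idem_res) auto
qed

lemma arc_idem_far:
  assumes "j < h" "int j < t" "t < int (2 * h) - int j" shows "arc_idem h p j (res (2 * h) (int p + t)) = p + h"
proof -
  have "(t + int j) mod int (2 * h) = t + int j" using assms by (intro mod_pos_pos_trivial) auto
  then show ?thesis using assms by (subst arc_idem_res) auto
qed

text \<open>Coordinates centred at \<open>p\<close>: \<open>t \<le> int j\<close> describes the arc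
  around \<open>p\<close>, and larger \<open>t\<close> its complement.\<close>

lemma arc_coord:
  assumes "j < (h::nat)"
  obtains t q where "x = int p + t + int (2 * h) * q" "- int j \<le> t" "t < int (2 * h) - int j"
proof -
  let ?v = "(x - int p + int j) mod int (2 * h)"
  have "x - int p + int j = int (2 * h) * ((x - int p + int j) div int (2 * h)) + ?v" by simp
  moreover have "0 \<le> ?v" "?v < int (2 * h)" using assms by simp_all
  ultimately show thesis
    by (intro that[of "?v - int j" "(x - int p + int j) div int (2 * h)"]) linarith+
qed

text \<open>The reflection in \<open>p\<close> also fixes the antipode \<open>p + h\<close>, and it
  preserves the arc around \<open>p\<close> and its complement.\<close>

lemma arc_idem_pair:
  assumes "p \<in> {1..h}" "j < h" "h \<ge> 2"
  shows "(dih (2 * h) (-1) (2 * int p), arc_idem h p j) \<in> involution_pairs (2 * h) \<one>\<^bsub>OR (2 * h)\<^esub>"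
proof -
  let ?n = "2 * h" and ?z = "arc_idem h p j" and ?g = "dih (2 * h) (-1) (2 * int p)"
  have n: "?n > 0" "?n \<ge> 3" using assms by simp_all
  have z: "?z \<in> carrier (OR ?n)" by (rule arc_idem_OR[OF assms(1)])
  have g: "?g \<in> carrier (OR ?n)" using n by simp
  have pn: "p \<in> {1..?n}" "p + h \<in> {1..?n}" using assms by auto
  have rp: "res ?n (int p) = p" "res ?n (int p + int h) = p + h" using res_int[OF pn(1)] res_int[OF pn(2)] by simp_all
  have per: "res ?n (y + int ?n * q) = res ?n y" for y q using n(1) by (simp add: res_eq_iff)
  have "?z p = p" using arc_idem_near[OF assms(2), of 0 p] rp by simp
  moreover have "?z (p + h) = p + h" using arc_idem_far[OF assms(2), of "int h" p] assms(2) rp by simp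
  moreover have "?g p = p"
  proof -
    have "?g (res ?n (int p)) = res ?n (int p)" using n(1) by (simp del: res_int)
    then show ?thesis unfolding rp .
  qed
  moreover have "?g (p + h) = p + h"
  proof -
    have "?g (res ?n (int p + int h)) = res ?n (int p + int h)"
      unfolding dih_res[OF n(1)] res_eq_iff[OF n(1)] by simp
    then show ?thesis unfolding rp .
  qed
  moreover have val: "?z (res ?n x) = p \<or> ?z (res ?n x) = p + h" for x
    using arc_idem_res[of h p j x] assms by simp
  ultimately have zz: "?z \<odot>[?n] ?z = ?z" and zg: "?z \<odot>[?n] ?g = ?z"
    using n(1) z g by (intro OR_res_eqI[of _ ?n] mult_in_OR; metis mult_OR_res)+
  have gz: "?g \<odot>[?n] ?z = ?z"
  proof (rule OR_res_eqI[OF mult_in_OR[OF n(1) g z] z])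
    fix x
    obtain t q where t: "x = int p + t + int ?n * q" "- int j \<le> t" "t < int ?n - int j"
      using arc_coord[OF assms(2)] by metis
    have "?g (res ?n x) = res ?n (int p - t + int ?n * (- q))"
      unfolding dih_res[OF n(1)] t(1) by (simp add: algebra_simps)
    then have gx: "?g (res ?n x) = res ?n (int p - t)" unfolding per .
    have x: "res ?n x = res ?n (int p + t)" unfolding t(1) per ..
    show "(?g \<odot>[?n] ?z) (res ?n x) = ?z (res ?n x)"
    proof (cases "t \<le> int j")
      case True
      then show ?thesis unfolding mult_OR_res[OF n(1)] gx unfolding x
        using arc_idem_near[OF assms(2), of t p] arc_idem_near[OF assms(2), of "- t" p] t(2) by simp
    next
      case False
      \<comment> \<open>The complement is \<open>j < t < 2 * h - j\<close>, a range that is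
        symmetric under replacing \<open>t\<close> by \<open>2 * h - t\<close>.\<close>
      have "res ?n (int p - t) = res ?n (int p + (int ?n - t))" using per[of "int p - t" 1] by (simp add: algebra_simps)
      then show ?thesis unfolding mult_OR_res[OF n(1)] gx unfolding x
        using arc_idem_far[OF assms(2), of t p] arc_idem_far[OF assms(2), of "int ?n - t" p] t(2,3) False by simp
    qed
  qed
  have "?g \<noteq> \<one>\<^bsub>OR ?n\<^esub>" unfolding dih_one[OF n(1), symmetric] using dih_eq_iff[OF n(2), of "-1" 1] by simp
  moreover have "?g \<odot>[?n] ?g = \<one>\<^bsub>OR ?n\<^esub>" using n(1) by (simp add: dih_mult dih_one)
  ultimately show ?thesis unfolding involution_pairs_one[OF n(1)] idems_def using g z zz zg gz by simp
qed

text \<open>\<open>p\<close> is the only value that is at most \<open>h\<close>, and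
  \<open>j\<close> tells where this value stops. The range \<open>p \<le> h\<close> suffices for all
  centres, as the complement of an arc around \<open>p\<close> is an arc around
  \<open>p + h\<close>.\<close>

lemma inj_on_arc_idem: "inj_on (\<lambda>(p, j). arc_idem h p j) ({1..h} \<times> {0..<h})"
proof (rule inj_onI)
  fix x y assume x: "x \<in> {1..h} \<times> {0..<h}" and y: "y \<in> {1..h} \<times> {0..<h}"
    and e: "(\<lambda>(p, j). arc_idem h p j) x = (\<lambda>(p, j). arc_idem h p j) y"
  obtain p i where xp: "x = (p, i)" by (cases x)
  obtain q j where yq: "y = (q, j)" by (cases y)
  have pq: "p \<in> {1..h}" "i < h" "q \<in> {1..h}" "j < h" using x y xp yq by auto
  have e: "arc_idem h p i = arc_idem h q j" using e xp yq by simp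
  have "arc_idem h q j (res (2 * h) (int p)) = p"
    using arc_idem_near[OF pq(2), of 0 p] e by simp
  then have "p = q \<or> p = q + h" using arc_idem_res[of h q j "int p"] pq by (simp split: if_splits)
  then have p: "p = q" using pq by auto
  have *: False if "i < j" "j < h" "arc_idem h p i = arc_idem h p j" for i j
  proof -
    have "arc_idem h p i (res (2 * h) (int p + (int i + 1))) = p + h"
      using that by (intro arc_idem_far) auto
    moreover have "arc_idem h p j (res (2 * h) (int p + (int i + 1))) = p"
      using that by (intro arc_idem_near) auto
    ultimately show False using that by simp
  qed
  have "i = j" using *[of i j] *[of j i] pq e p by (metis linorder_neqE_nat)
  then show "x = y" using p xp yq by simp
qed

text \<open>The reflections in all image points equal \<open>g\<close>, so any two image points are
  antipodal and there are at most two. If there are two, \<open>z\<close> is symmetric about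
  \<open>p\<close> and its classes are arcs, which leaves only the radius \<open>j\<close>
  free.\<close>

lemma involution_pairs_cases:
  assumes "n \<ge> 3" "(g, z) \<in> involution_pairs n \<one>\<^bsub>OR n\<^esub>"
  shows "(\<exists>p\<in>{1..n}. g = dih n (-1) (2 * int p) \<and> z = cst n p) \<or>
    (\<exists>h p j. n = 2 * h \<and> p \<in> {1..h} \<and> j < h \<and> g = dih n (-1) (2 * int p) \<and> z = arc_idem h p j)"
proof -
  have n: "n > 0" using assms(1) by simp
  note R = involution_pair_reflection[OF n assms(2)]
  have z: "z \<in> carrier (OR n)" using assms(2) unfolding involution_pairs_one[OF n] idems_def by simp
  have z1: "z 1 \<in> z ` {1..n}" using n by simp
  show ?thesis
  proof (cases "\<forall>i\<in>{1..n}. z i = z 1")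
    case True
    have "z = cst n (z 1)"
      by (rule OR_eqI[OF z cst_in_OR[OF R(1)[OF z1]]]) (use True in \<open>metis cst_apply\<close>)
    then show ?thesis using R(1,3)[OF z1] by blast
  next
    case False
    then obtain i where "i \<in> {1..n}" "z i \<noteq> z 1" by blast
    then obtain p q where pq: "p \<in> z ` {1..n}" "q \<in> z ` {1..n}" "p < q"
      using z1 by (metis imageI linorder_neqE_nat)
    have half: "2 * (s - r) = n" if r: "r \<in> z ` {1..n}" and s: "s \<in> z ` {1..n}" and rs: "r < s" for r s
    proof -
      have "dih n (-1) (2 * int s) = dih n (-1) (2 * int r)" using R(3)[OF r] R(3)[OF s] by simp
      then have "int n dvd 2 * int s - 2 * int r" using dih_eq_iff[OF assms(1), of "-1" "-1"] by simp
      also have "2 * int s - 2 * int r = int (2 * (s - r))" using rs by (simp add: of_nat_diff)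
      finally have "n dvd 2 * (s - r)" by (simp only: of_nat_dvd_iff)
      then obtain k where k: "2 * (s - r) = n * k" by (rule dvdE)
      have "2 * (s - r) < n * 2" using R(1)[OF r] R(1)[OF s] rs by auto
      then have "k < 2" using k by simp
      moreover have "k \<noteq> 0" using k rs by (cases "k = 0") simp_all
      ultimately show ?thesis using k by (cases "k = 1") auto
    qed
    define h where "h = q - p"
    have nh: "n = 2 * h" using half[OF pq] unfolding h_def by simp
    have q: "q = p + h" unfolding h_def using pq(3) by simp
    have p: "p \<in> {1..h}" using R(1)[OF pq(1)] R(1)[OF pq(2)] nh q by auto
    have h: "h > 0" using p by simp
    have val: "z (res n x) = p \<or> z (res n x) = q" for x
    proof -
      have r: "z (res n x) \<in> z ` {1..n}" using res_in[OF n] by blast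
      show ?thesis
        using half[OF pq] half[OF r pq(1)] half[OF r pq(2)] half[OF pq(1) r] pq(3)
        by (cases "z (res n x)" p rule: linorder_cases) auto
    qed
    have zp: "z (res n (int p)) = p" using R(1,2)[OF pq(1)] by simp
    have zq: "z (res n (int p + int h)) = q"
      using R(1,2)[OF pq(2)] q by (metis of_nat_add res_int)
    \<comment> \<open>The radius of the largest arc around \<open>p\<close> on which
      \<open>z\<close> has the value \<open>p\<close>.\<close>
    define j where "j = (LEAST t. z (res n (int p + int t + 1)) \<noteq> p)"
    have exj: "z (res n (int p + int (h - 1) + 1)) \<noteq> p"
      using zq pq(3) h by (simp add: of_nat_diff)
    have j1: "z (res n (int p + int j + 1)) = q"
    proof -
      have "z (res n (int p + int j + 1)) \<noteq> p" unfolding j_def using exj by (rule LeastI)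
      then show ?thesis using val by blast
    qed
    have "j \<le> h - 1" unfolding j_def using exj by (rule Least_le)
    then have jh: "j < h" using h by simp
    have near: "z (res n (int p + int t)) = p" if t: "t \<le> j" for t
    proof (cases t)
      case (Suc r)
      then have "\<not> z (res n (int p + int r + 1)) \<noteq> p" using t unfolding j_def by (intro not_less_Least) simp
      then show ?thesis using Suc by (simp add: algebra_simps)
    qed (simp add: zp)
    have sym: "z (res n (int p - t)) = z (res n (int p + t))" for t
      using R(4)[OF pq(1), of "int p + t"] by simp
    \<comment> \<open>\<open>a\<close> and \<open>b\<close> are the first points beyond the arc on
      either side, with \<open>b\<close> written one turn ahead. Both have value \<open>q\<close>,
      so the arc between them that avoids \<open>p\<close> is constant.\<close>
    define a where "a = int p + int j + 1"
    define b where "b = int p - (int j + 1) + int n"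
    have za: "z (res n a) = q" unfolding a_def by (rule j1)
    have zb: "z (res n b) = q"
    proof -
      have "z (res n b) = z (res n (int p - (int j + 1)))" unfolding b_def using n by simp
      also have "\<dots> = q" using sym[of "int j + 1"] j1 by (simp add: algebra_simps)
      finally show ?thesis .
    qed
    have "a \<le> b" "b \<le> a + int n" unfolding a_def b_def using jh nh by simp_all
    moreover have "z (res n a) = z (res n b)" using za zb by simp
    ultimately have "(\<forall>y\<in>{a..b}. z (res n y) = z (res n a)) \<or> (\<forall>y\<in>{b..a + int n}. z (res n y) = z (res n a))"
      by (rule oriented_arc[OF OR_oriented[OF n z] n])
    moreover have "\<not> (\<forall>y\<in>{b..a + int n}. z (res n y) = z (res n a))"
    proof
      assume *: "\<forall>y\<in>{b..a + int n}. z (res n y) = z (res n a)"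
      have "z (res n (int p + int n)) = z (res n a)" by (rule bspec[OF *]) (simp add: a_def b_def)
      then show False using zp za n pq(3) by simp
    qed
    ultimately have far: "\<forall>y\<in>{a..b}. z (res n y) = z (res n a)" by blast
    have "z = arc_idem h p j"
    proof (rule OR_res_eqI[OF z])
      show "arc_idem h p j \<in> carrier (OR n)" unfolding nh by (rule arc_idem_OR[OF p])
      fix x
      obtain t k where t: "x = int p + t + int (2 * h) * k" "- int j \<le> t" "t < int (2 * h) - int j"
        using arc_coord[OF jh] by metis
      have x: "res n x = res n (int p + t)" unfolding t(1) nh[symmetric] using n by (simp add: res_eq_iff)
      show "z (res n x) = arc_idem h p j (res n x)"
      proof (cases "t \<le> int j")
        case True
        have "z (res n (int p + t)) = p"
        proof (cases "t \<ge> 0")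
          case t0: True
          then show ?thesis using near[of "nat t"] True by simp
        next
          case False
          then show ?thesis using near[of "nat (- t)"] sym[of "- t"] t(2) by simp
        qed
        moreover have "arc_idem h p j (res n (int p + t)) = p"
          unfolding nh using True t(2) by (intro arc_idem_near[OF jh]) simp
        ultimately show ?thesis unfolding x by simp
      next
        case False
        have "z (res n (int p + t)) = z (res n a)"
          by (rule bspec[OF far]) (use False t(3) nh in \<open>simp add: a_def b_def\<close>)
        moreover have "arc_idem h p j (res n (int p + t)) = p + h"
          unfolding nh using False t(3) by (intro arc_idem_far[OF jh]) simp_all
        ultimately show ?thesis unfolding x using za q by simp
      qed
    qed
    then show ?thesis using nh p jh R(3)[OF pq(1)] by blast
  qed
qed

text \<open>Each point gives one pair with a constant; for \<open>n = 2 * h\<close> there are also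
  \<open>h\<close> centres times \<open>h\<close> radii.\<close>

lemma card_involution_pairs_one:
  assumes "n \<ge> 3"
  shows "card (involution_pairs n \<one>\<^bsub>OR n\<^esub>) = n + (if even n then (n div 2)\<^sup>2 else 0)"
proof -
  have n: "n > 0" using assms by simp
  define h where "h = n div 2"
  let ?arc = "\<lambda>(p, j). (dih n (-1) (2 * int p), arc_idem h p j)"
  define C where "C = (\<lambda>p. (dih n (-1) (2 * int p), cst n p)) ` {1..n}"
  define A where "A = (if even n then ?arc ` ({1..h} \<times> {0..<h}) else {})"
  have "involution_pairs n \<one>\<^bsub>OR n\<^esub> = C \<union> A"
  proof (intro equalityI subsetI)
    fix x assume x: "x \<in> involution_pairs n \<one>\<^bsub>OR n\<^esub>"
    obtain g z where gz: "x = (g, z)" by (cases x)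
    show "x \<in> C \<union> A"
      using involution_pairs_cases[OF assms x[unfolded gz]]
    proof (elim disjE exE conjE bexE)
      fix k p j assume k: "n = 2 * k" "p \<in> {1..k}" "j < k" "g = dih n (-1) (2 * int p)" "z = arc_idem k p j"
      then have "k = h" "even n" unfolding h_def by simp_all
      then have "x \<in> A" unfolding A_def gz using k by (auto intro!: image_eqI[of _ _ "(p, j)"])
      then show ?thesis ..
    qed (auto simp: C_def gz)
  next
    fix x assume "x \<in> C \<union> A"
    then show "x \<in> involution_pairs n \<one>\<^bsub>OR n\<^esub>"
    proof
      assume "x \<in> C"
      then obtain p where p: "p \<in> {1..n}" "x = (dih n (-1) (2 * int p), cst n p)" unfolding C_def by blast
      let ?g = "dih n (-1) (2 * int p)"
      have g: "?g \<in> carrier (OR n)" using n by simp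
      have "?g (res n (int p)) = res n (int p)" using n by (simp del: res_int)
      then have gp: "?g p = p" using p by simp
      have "?g \<noteq> \<one>\<^bsub>OR n\<^esub>" unfolding dih_one[OF n, symmetric] using dih_eq_iff[OF assms, of "-1" 1] by simp
      moreover have "?g \<odot>[n] ?g = \<one>\<^bsub>OR n\<^esub>" using n by (simp add: dih_mult dih_one)
      moreover have "cst n p \<in> idems n" unfolding idems_def using p mult_cst[OF p(1) cst_in_OR[OF p(1)]] by simp
      moreover have "?g \<odot>[n] cst n p = cst n p" by (rule mult_cst[OF p(1) g])
      moreover have "cst n p \<odot>[n] ?g = cst n p" using cst_mult[OF p(1) g] gp by simp
      ultimately show ?thesis unfolding p(2) involution_pairs_one[OF n] using g by simp
    next
      assume x: "x \<in> A"
      then have ev: "even n" unfolding A_def by (auto split: if_splits)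
      then have nh: "n = 2 * h" unfolding h_def by simp
      obtain p j where pj: "p \<in> {1..h}" "j < h" "x = (dih n (-1) (2 * int p), arc_idem h p j)"
        using x ev unfolding A_def by auto
      have "h \<ge> 2" using assms nh by simp
      then show ?thesis unfolding pj(3) nh by (rule arc_idem_pair[OF pj(1,2)])
    qed
  qed
  moreover have "C \<inter> A = {}"
  proof (rule ccontr)
    assume "C \<inter> A \<noteq> {}"
    then obtain x where x: "x \<in> C" "x \<in> A" by blast
    then have ev: "even n" unfolding A_def by (auto split: if_splits)
    then have nh: "n = 2 * h" unfolding h_def by simp
    obtain r where r: "snd x = cst n r" using x(1) unfolding C_def by auto
    obtain p j where pj: "p \<in> {1..h}" "j < h" "snd x = arc_idem h p j" using x(2) ev unfolding A_def by auto
    have c1: "arc_idem h p j (res (2 * h) (int p + 0)) = p" using pj(2) by (intro arc_idem_near) simp_all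
    have c2: "arc_idem h p j (res (2 * h) (int p + int h)) = p + h" using pj(2) by (intro arc_idem_far) simp_all
    have c: "arc_idem h p j (res (2 * h) y) = r" for y
      using r n unfolding pj(3) nh[symmetric] by simp
    show False using c1 c2 pj(2) unfolding c by simp
  qed
  moreover have "finite C" unfolding C_def by simp
  moreover have "finite A" unfolding A_def by simp
  moreover have "card C = n"
  proof -
    have "inj_on (\<lambda>p. (dih n (-1) (2 * int p), cst n p)) {1..n}"
    proof (rule inj_onI)
      fix p q assume "(dih n (-1) (2 * int p), cst n p) = (dih n (-1) (2 * int q), cst n q)"
      then have "cst n p 1 = cst n q 1" by simp
      then show "p = q" using n by simp
    qed
    then show ?thesis unfolding C_def by (simp add: card_image)
  qed
  moreover have "card A = (if even n then (n div 2)\<^sup>2 else 0)"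
  proof -
    have "inj_on ?arc ({1..h} \<times> {0..<h})"
    proof (rule inj_onI)
      fix x y assume x: "x \<in> {1..h} \<times> {0..<h}" and y: "y \<in> {1..h} \<times> {0..<h}"
        and e: "?arc x = ?arc y"
      have "(\<lambda>(p, j). arc_idem h p j) x = (\<lambda>(p, j). arc_idem h p j) y" using e by (simp add: split_def)
      then show "x = y" using x y by (rule inj_onD[OF inj_on_arc_idem])
    qed
    then show ?thesis unfolding A_def by (simp add: card_image card_cartesian_product power2_eq_square h_def)
  qed
  ultimately show ?thesis by (simp add: card_Un_disjoint)
qed

subsection \<open>The count\<close>

lemma sum_idems_by_rank:
  fixes F :: "nat \<Rightarrow> nat"
  assumes "n > 0"
  shows "(\<Sum>e\<in>idems n. F (card (e ` {1..n}))) = (\<Sum>k=1..n. card (idems_rank n k) * F k)"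
proof -
  have "(\<Sum>e\<in>idems n. F (card (e ` {1..n})))
    = (\<Sum>k=1..n. \<Sum>e\<in>idems_rank n k. F (card (e ` {1..n})))"
    using card_image_OR[OF assms idems_OR] by (intro sum.group[symmetric] finite_idems) auto
  also have "\<dots> = (\<Sum>k=1..n. card (idems_rank n k) * F k)" by simp
  finally show ?thesis .
qed

text \<open>Diagonal sums of Pascal's triangle, for both parities at once because Pascal's rule
  links them. The bound \<open>a < m\<close> ensures that all nonzero terms are present.\<close>

lemma fib_sum_choose:
  assumes "a < m"
  shows "(\<Sum>l<m. (a + l) choose (2 * l + 1)) = fib (2 * a) \<and> (\<Sum>l<m. (a + l) choose (2 * l)) = fib (2 * a + 1)"
  using assms
proof (induction a)
  case 0
  have "(\<Sum>l<m. l choose (2 * l + 1)) = 0" by (intro sum.neutral) simp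
  moreover have "(\<Sum>l<m. l choose (2 * l)) = (\<Sum>l<m. if l = 0 then 1 else 0)" by (intro sum.cong) auto
  ultimately show ?case using 0 by (simp add: sum.delta)
next
  case (Suc a)
  obtain r where m: "m = Suc r" using Suc.prems by (cases m) auto
  have IH: "(\<Sum>l<m. (a + l) choose (2 * l + 1)) = fib (2 * a)" "(\<Sum>l<m. (a + l) choose (2 * l)) = fib (2 * a + 1)"
    using Suc by simp_all
  have G: "(\<Sum>l<m. (Suc a + l) choose (2 * l + 1)) = fib (2 * Suc a)"
    using IH by (simp add: sum.distrib)
  have "(\<Sum>l<m. (Suc a + l) choose (2 * l)) = 1 + (\<Sum>l<r. (Suc a + Suc l) choose (2 * Suc l))"
    unfolding m by (subst sum.lessThan_Suc_shift) simp
  also have "\<dots> = 1 + (\<Sum>l<r. (a + Suc l) choose (2 * Suc l)) + (\<Sum>l<r. (Suc a + l) choose (2 * l + 1))"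
    by (simp add: sum.distrib)
  also have "1 + (\<Sum>l<r. (a + Suc l) choose (2 * Suc l)) = (\<Sum>l<m. (a + l) choose (2 * l))"
    unfolding m by (subst sum.lessThan_Suc_shift) simp
  \<comment> \<open>The extra term \<open>l = r\<close> vanishes: \<open>Suc a \<le> r\<close> makes
    the lower index exceed the upper one.\<close>
  also have "(\<Sum>l<r. (Suc a + l) choose (2 * l + 1)) = (\<Sum>l<m. (Suc a + l) choose (2 * l + 1))"
    using Suc.prems unfolding m by simp
  finally show ?case using G IH by simp
qed

text \<open>Moments of the Fibonacci numbers of even index: passing from \<open>k\<close> to
  \<open>k + 1\<close> expands the weight and adds the sums of lower degree.\<close>

lemma fib_sums:
  shows "(\<Sum>a\<le>k. real (fib (2 * a))) = real (fib (2 * k + 1)) - 1"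
    and "(\<Sum>a<k. (real k - real a) * real (fib (2 * a))) = real (fib (2 * k)) - real k"
    and "(\<Sum>a<k. (real k - real a)\<^sup>2 * real (fib (2 * a)))
      = 2 * real (fib (2 * k + 1)) - real (fib (2 * k)) - (real k)\<^sup>2 - 2"
proof -
  show 0: "(\<Sum>a\<le>k. real (fib (2 * a))) = real (fib (2 * k + 1)) - 1" for k
    by (induction k) simp_all
  show 1: "(\<Sum>a<k. (real k - real a) * real (fib (2 * a))) = real (fib (2 * k)) - real k" for k
  proof (induction k)
    case (Suc k)
    have "(\<Sum>a<Suc k. (real (Suc k) - real a) * real (fib (2 * a)))
      = (\<Sum>a<Suc k. (real k - real a) * real (fib (2 * a)) + real (fib (2 * a)))"
      by (intro sum.cong) (simp_all add: algebra_simps)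
    also have "\<dots> = (\<Sum>a<k. (real k - real a) * real (fib (2 * a))) + (\<Sum>a\<le>k. real (fib (2 * a)))"
      by (simp add: sum.distrib lessThan_Suc_atMost[symmetric])
    finally show ?case unfolding Suc 0 by simp
  qed simp
  show "(\<Sum>a<k. (real k - real a)\<^sup>2 * real (fib (2 * a)))
      = 2 * real (fib (2 * k + 1)) - real (fib (2 * k)) - (real k)\<^sup>2 - 2"
  proof (induction k)
    case (Suc k)
    have "(\<Sum>a<Suc k. (real (Suc k) - real a)\<^sup>2 * real (fib (2 * a)))
      = (\<Sum>a<Suc k. (real k - real a)\<^sup>2 * real (fib (2 * a))
          + 2 * ((real k - real a) * real (fib (2 * a))) + real (fib (2 * a)))"
      by (intro sum.cong) (simp_all add: algebra_simps power2_eq_square)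
    also have "\<dots> = (\<Sum>a<k. (real k - real a)\<^sup>2 * real (fib (2 * a)))
        + 2 * (\<Sum>a<k. (real k - real a) * real (fib (2 * a))) + (\<Sum>a\<le>k. real (fib (2 * a)))"
      by (simp add: sum.distrib sum_distrib_left lessThan_Suc_atMost[symmetric])
    finally show ?case unfolding Suc 0 1 by (simp add: power2_eq_square algebra_simps)
  qed simp
qed

text \<open>Summing over the rank first turns the binomials into \<open>fib (2 * a)\<close>; what
  remains is the moment with weight \<open>(k - a)\<^sup>2\<close>.\<close>

lemma card_idems:
  assumes "k > 0"
  shows "real (card (idems k)) = real (fib (2 * k - 1)) + real (fib (2 * k + 1)) - real k ^ 2 + real k - 2"
proof -
  have inner: "(\<Sum>j=2..k. (a + j - 2) choose (2 * j - 3)) = fib (2 * a)" if a: "a < k" for a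
  proof -
    have e: "2 \<le> j \<Longrightarrow> Suc (j * 2 - 4) = j * 2 - 3" for j by arith
    \<comment> \<open>The added term \<open>j = k + 1\<close> is zero for \<open>a < k\<close>; with
      it the range matches \<open>l < k\<close>.\<close>
    have "(\<Sum>j=2..k. (a + j - 2) choose (2 * j - 3)) = (\<Sum>j=2..Suc k. (a + j - 2) choose (2 * j - 3))"
    proof -
      have "(a + Suc k - 2) choose (2 * Suc k - 3) = 0" using a by (intro binomial_eq_0) simp
      then show ?thesis using assms by simp
    qed
    also have "\<dots> = (\<Sum>l<k. (a + l) choose (2 * l + 1))"
      by (rule sum.reindex_bij_witness[of _ "\<lambda>l. l + 2" "\<lambda>j. j - 2"]) (auto simp: algebra_simps e)
    also have "\<dots> = fib (2 * a)" using fib_sum_choose[OF a] by simp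
    finally show ?thesis .
  qed
  have "card (idems k) = (\<Sum>j=1..k. card (idems_rank k j))"
    using sum_idems_by_rank[OF assms, of "\<lambda>_. 1"] by simp
  also have "\<dots> = k + (\<Sum>j=2..k. card (idems_rank k j))"
    using assms card_idems_rank_one[OF assms] by (subst sum.atLeast_Suc_atMost) (simp_all add: numeral_2_eq_2)
  also have "(\<Sum>j=2..k. card (idems_rank k j))
      = (\<Sum>j=2..k. \<Sum>a<k. ((a + j - 2) choose (2 * j - 3)) * (k - a)\<^sup>2)"
    using card_idems_rank_formula[OF assms] by (intro sum.cong refl) simp
  also have "\<dots> = (\<Sum>a<k. (\<Sum>j=2..k. (a + j - 2) choose (2 * j - 3)) * (k - a)\<^sup>2)"
    by (subst sum.swap) (simp add: sum_distrib_right)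
  also have "\<dots> = (\<Sum>a<k. fib (2 * a) * (k - a)\<^sup>2)" using inner by (intro sum.cong refl) simp
  finally have "real (card (idems k)) = real k + (\<Sum>a<k. real (fib (2 * a)) * (real (k - a))\<^sup>2)"
    by simp
  also have "(\<Sum>a<k. real (fib (2 * a)) * (real (k - a))\<^sup>2) = (\<Sum>a<k. (real k - real a)\<^sup>2 * real (fib (2 * a)))"
    by (intro sum.cong refl) (simp add: of_nat_diff mult.commute)
  also have "\<dots> = 2 * real (fib (2 * k + 1)) - real (fib (2 * k)) - (real k)\<^sup>2 - 2" by (rule fib_sums(3))
  finally have *: "real (card (idems k)) = real k + (2 * real (fib (2 * k + 1)) - real (fib (2 * k)) - (real k)\<^sup>2 - 2)" .
  obtain r where r: "k = Suc r" using assms by (cases k) auto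
  \<comment> \<open>This turns \<open>2 * fib (2 * k + 1) - fib (2 * k)\<close> into
    \<open>fib (2 * k + 1) + fib (2 * k - 1)\<close>.\<close>
  have "fib (2 * k + 1) = fib (2 * k) + fib (2 * k - 1)" unfolding r by simp
  then show ?thesis unfolding * by simp
qed

text \<open>Here \<open>i = n - a\<close>, and terms with \<open>i > n - k + 1\<close> vanish
  because the lower index exceeds the upper one.\<close>

lemma real_card_idems_rank:
  assumes "n > 0" "k \<in> {2..n}"
  shows "real (card (idems_rank n k))
    = (\<Sum>i=1..n-k+1. real i ^ 2 * real ((n - i + k - 2) choose (2 * k - 3)))"
proof -
  have "(\<Sum>a<n. ((a + k - 2) choose (2 * k - 3)) * (n - a)\<^sup>2)
      = (\<Sum>i=1..n. i\<^sup>2 * ((n - i + k - 2) choose (2 * k - 3)))"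
    by (rule sum.reindex_bij_witness[of _ "\<lambda>i. n - i" "\<lambda>a. n - a"]) auto
  also have "\<dots> = (\<Sum>i=1..n-k+1. i\<^sup>2 * ((n - i + k - 2) choose (2 * k - 3)))"
  proof (rule sum.mono_neutral_right)
    show "\<forall>i\<in>{1..n} - {1..n - k + 1}. i\<^sup>2 * ((n - i + k - 2) choose (2 * k - 3)) = 0"
    proof
      fix i assume "i \<in> {1..n} - {1..n - k + 1}"
      then have "n - i + k - 2 < 2 * k - 3" using assms(2) by auto
      then show "i\<^sup>2 * ((n - i + k - 2) choose (2 * k - 3)) = 0" by (simp add: binomial_eq_0)
    qed
  qed (use assms in auto)
  finally have "card (idems_rank n k)
      = (\<Sum>i=1..n-k+1. i\<^sup>2 * ((n - i + k - 2) choose (2 * k - 3)))"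
    using card_idems_rank_formula[OF assms(1)] assms(2) by simp
  then show ?thesis by simp
qed

text \<open>The coefficient \<open>((-1) ^ k + 1) / 8\<close> is 1/4 for even \<open>k\<close> and 0
  for odd \<open>k\<close>, so it encodes the square of \<open>k div 2\<close> together with the
  case distinction.\<close>

lemma real_card_involution_pairs_one:
  assumes "k \<ge> 3"
  shows "real (card (involution_pairs k \<one>\<^bsub>OR k\<^esub>)) = real k + ((-1) ^ k + 1) / 8 * real k ^ 2"
proof (cases "even k")
  case True
  then obtain h where "k = 2 * h" by (rule evenE)
  then show ?thesis using card_involution_pairs_one[OF assms] by (simp add: power2_eq_square)
next
  case False
  then show ?thesis using card_involution_pairs_one[OF assms] by simp
qed

theorem theorem3p6:
  fixes n :: nat
  assumes "n \<ge> 3"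
  shows "real (card (semigroup_endos (OR n))) =
      3 * real n
    + (\<Sum>k=2..n. \<Sum>i=1..n-k+1.
         real i ^ 2 * real ((n - i + k - 2) choose (2 * k - 3))
           * (real (fib (2 * k - 1)) + real (fib (2 * k + 1)) - real k ^ 2 + real k - 2))
    + ((-1) ^ n + 2) *
      (\<Sum>k=3..n. \<Sum>i=1..n-k+1.
         real i ^ 2 * real ((n - i + k - 2) choose (2 * k - 3))
           * (real k + ((-1) ^ k + 1) / 8 * real k ^ 2))"
proof -
  have n: "n > 0" using assms by simp
  let ?E = "\<lambda>k. card (idems_rank n k)"
  let ?S = "\<lambda>k. \<Sum>i=1..n-k+1. real i ^ 2 * real ((n - i + k - 2) choose (2 * k - 3))
    * (real (fib (2 * k - 1)) + real (fib (2 * k + 1)) - real k ^ 2 + real k - 2)"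
  let ?T = "\<lambda>k. \<Sum>i=1..n-k+1. real i ^ 2 * real ((n - i + k - 2) choose (2 * k - 3))
    * (real k + ((-1) ^ k + 1) / 8 * real k ^ 2)"
  let ?R = "\<lambda>k. card (involution_pairs k \<one>\<^bsub>OR k\<^esub>)"
  have "card (idem_pairs n) = (\<Sum>k=1..n. ?E k * card (idems k))"
    unfolding card_idem_pairs[OF n] by (rule sum_idems_by_rank[OF n, of "\<lambda>k. card (idems k)"])
  \<comment> \<open>Rank one: \<open>n\<close> constants, each with a single idempotent in its local
    monoid, supply the third \<open>n\<close> of \<open>3 * real n\<close>.\<close>
  also have "\<dots> = n * card (idems 1) + (\<Sum>k=2..n. ?E k * card (idems k))"
    using n card_idems_rank_one[OF n] by (subst sum.atLeast_Suc_atMost) (simp_all add: numeral_2_eq_2)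
  finally have "real (card (idem_pairs n)) = real n * real (card (idems 1)) + (\<Sum>k=2..n. real (?E k) * real (card (idems k)))"
    by simp
  moreover have "real (card (idems 1)) = 1" using card_idems[of 1] by (simp add: numeral_3_eq_3)
  moreover have "(\<Sum>k=2..n. real (?E k) * real (card (idems k))) = (\<Sum>k=2..n. ?S k)"
  proof (intro sum.cong refl)
    fix k assume k: "k \<in> {2..n}"
    then have "k > 0" by simp
    show "real (?E k) * real (card (idems k)) = ?S k"
      unfolding real_card_idems_rank[OF n k] card_idems[OF \<open>k > 0\<close>] by (rule sum_distrib_right)
  qed
  ultimately have I: "real (card (idem_pairs n)) = real n + (\<Sum>k=2..n. ?S k)"
    by simp
  have "(\<Sum>e\<in>idems n. card (involution_pairs n e)) = (\<Sum>e\<in>idems n. ?R (card (e ` {1..n})))"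
    using card_involution_pairs[OF n] by (intro sum.cong refl)
  also have "\<dots> = (\<Sum>k=1..n. ?E k * ?R k)" by (rule sum_idems_by_rank[OF n])
  also have "\<dots> = (\<Sum>k=3..n. ?E k * ?R k)"
  proof (rule sum.mono_neutral_right)
    show "\<forall>k\<in>{1..n} - {3..n}. ?E k * ?R k = 0"
    proof
      fix k assume "k \<in> {1..n} - {3..n}"
      then have "0 < k" "k \<le> 2" by auto
      then show "?E k * ?R k = 0" by (simp add: involution_pairs_small)
    qed
  qed auto
  finally have "real (\<Sum>e\<in>idems n. card (involution_pairs n e)) = (\<Sum>k=3..n. real (?E k) * real (?R k))" by simp
  also have "\<dots> = (\<Sum>k=3..n. ?T k)"
  proof (intro sum.cong refl)
    fix k assume k: "k \<in> {3..n}"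
    then have k': "k \<in> {2..n}" "k \<ge> 3" by auto
    show "real (?E k) * real (?R k) = ?T k"
      unfolding real_card_idems_rank[OF n k'(1)] real_card_involution_pairs_one[OF k'(2)] by (rule sum_distrib_right)
  qed
  finally have R: "real (\<Sum>e\<in>idems n. card (involution_pairs n e)) = (\<Sum>k=3..n. ?T k)" .
  have c: "real (card (index2 n)) = (-1) ^ n + 2" unfolding card_index2[OF assms] by simp
  show ?thesis
    unfolding card_semigroup_endos[OF assms] of_nat_add of_nat_mult I R c by simp
qed

end
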